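(* Let $T>0$, let $(u^{\varepsilon},v^{\varepsilon})$, $\varepsilon\in(0,1)$, be the solutions of the system in the context, and let $v$, $\lambda_1,\lambda_2,\lambda_3$ and $n$ be the limit function, the weights and the measure described in the context. Set $$\kappa_1(t,x)=1-\lambda_1(t,x),\qquad \kappa_2(t,x)=\lambda_3(t,x).$$ (1) Suppose additionally that $\{\partial_t v^{\varepsilon}\}_{\varepsilon\in(0,1)}$ and $\{\Delta v^{\varepsilon}\}_{\varepsilon\in(0,1)}$ are uniformly bounded in $L^2((0,T)\times\Omega)$. Then $\partial_t\lambda_i(t,x)=0$ for $i=1,2,3$ and $(t,x)\in\mathcal{O}$, where $\mathcal{O}\subset(0,T)\times\Omega$ is any open set where $v(t,x)$ is continuous. (2) In general, if $\mathcal{O}\subset\{(t,x,\xi): f_-<v(t,x)<\xi_0<\xi<f_+\}$ is an open set for some $\xi_0$, then for $(t,x,\xi)\in\mathcal{O}$ $$\partial_t\int_{S_1(v(t,x))}^{S_2(v(t,x))}\kappa_1(t,x)\,\delta_{\xi=F(\lambda)}(\xi)\,d\lambda=\partial_\xi n(t,x,\xi).$$ Similarly, if $\mathcal{O}\subset\{(t,x,\xi): f_-<\xi<\xi_0<v(t,x)<f_+\}$ is an open set for some $\xi_0$, then for $(t,x,\xi)\in\mathcal{O}$ $$\partial_t\int_0^{S_1(v(t,x))}\delta_{\xi=F(\lambda)}(\xi)\,d\lambda+\partial_t\int_{S_2(v(t,x))}^{S_3(v(t,x))}\kappa_2(t,x)\,\delta_{\xi=F(\lambda)}(\xi)\,d\lambda=\partial_\xi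 n(t,x,\xi).$$ The equations are understood in the sense of distributions.
   Context: $\Omega\subset\mathbb{R}^d$ is a smooth bounded domain. The system is $\partial_t u^{\varepsilon}=\frac{v^{\varepsilon}-F(u^{\varepsilon})}{\varepsilon}$, $\partial_t v^{\varepsilon}=\Delta v^{\varepsilon}+\frac{F(u^{\varepsilon})-v^{\varepsilon}}{\varepsilon}$ in $\Omega$, with Neumann boundary conditions and $u^{\varepsilon}(0,x)=u_0(x)$, $v^{\varepsilon}(0,x)=v_0(x)$. Assumptions on $F$: (1) $F\in C^1(\mathbb{R};\mathbb{R})$, $F(0)=0$, $F\ge0$ on $[0,\infty)$. (2) There are $0<\alpha_-<\alpha_+<\beta_-<\beta_+$ with $F(\beta_-)=F(\alpha_-)=:f_-$ and $F(\alpha_+)=F(\beta_+)=:f_+$; $F$ is strictly increasing on $(-\infty,\alpha_+)$ and on $(\beta_-,\infty)$ and strictly decreasing on $(\alpha_+,\beta_-)$; $\lim_{u\to\infty}F(u)=\infty$ and $\lim_{u\to-\infty}F(u)=-\infty$. The inverses of $F$ on its monotone branches are $S_1:(-\infty,f_+)\to(-\infty,\alpha_+)$, $S_2:(f_-,f_+)\to(\alpha_+,\beta_-)$, $S_3:(f_-,\infty)\to(\beta_-,\infty)$, so $F(S_i(r))=r$; each $S_i$ is extended to all of $\mathbb{R}$ by constants (continuously). (3) Nondegeneracy: for every (nonempty open) subinterval of $(f_-,f_+)$ and real $a_1,a_2,a_3$, if $\sum_{i=1}^3a_i\,(S_i'(r)+1)=0$ on that subinterval, then $a_1+a_2+a_3=0$.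 Assumptions on initial data: $u_0,v_0\ge0$, $u_0,v_0\in C^{2+\alpha}(\overline{\Omega})$ for some $\alpha\in(0,1)$, and $u_0,v_0$ satisfy the Neumann boundary condition. For each $\varepsilon$ the system has a unique global classical solution; it is nonnegative and bounded in $L^\infty$ uniformly in $\varepsilon$. Limit objects: along a subsequence $\varepsilon\to0$, $v^{\varepsilon}\to v$ strongly in $L^2((0,T)\times\Omega)$, and the Young measure of $\{u^{\varepsilon}\}$ (the probability measures $\mu_{t,x}$ with $G(u^{\varepsilon})\to\int G\,d\mu_{t,x}$ weakly$^*$ for all bounded continuous $G$) is $\mu_{t,x}=\sum_{i=1}^3\lambda_i(t,x)\,\delta_{S_i(v(t,x))}$ with $\lambda_i\ge0$, $\sum_i\lambda_i=1$; this defines the weights $\lambda_i$. Along the same subsequence let $p,q$ be the weak$^*$ limits in $L^\infty((0,T)\times\Omega\times\mathbb{R})$ of $\mathbf{1}_{0\le\xi\le u^{\varepsilon}(t,x)}$ and $\mathbf{1}_{0\le\xi\le v^{\varepsilon}(t,x)}$. The measure $n$ is a bounded nonnegative measure on $(0,T)\times\Omega\times\mathbb{R}$ satisfying, in the sense of distributions, $\partial_t\left[\int_{\mathbb{R}}p(t,x,\lambda)\,\delta_{\xi=F(\lambda)}(\xi)\,d\lambda+q(t,x,\xi)\right]-\Delta_x q(t,x,\xi)=\partial_\xi n(t,x,\xi)$ (such $n$ exists). For a bounded, compactly supported $h$, the expression $\int_{\mathbb{R}}h(\lambda)\,\delta_{\xi=F(\lambda)}(\xi)\,d\lambda$ is the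 distribution in $\xi$ acting by $\psi\mapsto\int_{\mathbb{R}}h(\lambda)\,\psi(F(\lambda))\,d\lambda$; integrals over $[a,b]$ correspond to $h$ multiplied by $\mathbf{1}_{[a,b]}$.
   Formalization: In (1), ∂_tλ_1=0 is asserted on O∩{v≠f_+}, ∂_tλ_3=0 on O∩{v≠f_-}, ∂_tλ_2=0 on O∩{v≠f_-,f_+}: at the removed levels two branches S_i coincide and the Young measure does not determine that weight (e.g. the stationary solution u=β_-, v=f_-). *)

theory Defs
  imports "HOL-Analysis.Analysis" "HOL-Probability.Probability_Measure"
begin

section \<open>Smooth functions, differential operators, distributions\<close>

definition partial_deriv :: "'a::euclidean_space \<Rightarrow> ('a \<Rightarrow> real) \<Rightarrow> 'a \<Rightarrow> real" where
  "partial_deriv b f x = frechet_derivative f (at x) b"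

text \<open>Meant for open \<open>S\<close>.\<close>
primrec Ck_on :: "nat \<Rightarrow> 'a::euclidean_space set \<Rightarrow> ('a \<Rightarrow> real) \<Rightarrow> bool" where
  "Ck_on 0 S f \<longleftrightarrow> continuous_on S f"
| "Ck_on (Suc k) S f \<longleftrightarrow>
     (\<forall>x\<in>S. f differentiable (at x)) \<and> (\<forall>b\<in>Basis. Ck_on k S (partial_deriv b f))"

definition smooth_fun_on :: "'a::euclidean_space set \<Rightarrow> ('a \<Rightarrow> real) \<Rightarrow> bool" where
  "smooth_fun_on S f \<longleftrightarrow> (\<forall>k. Ck_on k S f)"

definition laplacian :: "('a::euclidean_space \<Rightarrow> real) \<Rightarrow> 'a \<Rightarrow> real" where
  "laplacian f x = (\<Sum>b\<in>Basis. partial_deriv b (partial_deriv b f) x)"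

text \<open>Partial differential operators for functions of \<open>(t, x)\<close> and of \<open>(t, x, \<xi>)\<close>; in \<open>D_t\<close> the
  second component may be \<open>x\<close> or \<open>(x, \<xi>)\<close>.\<close>

definition D_t :: "(real \<times> 'b \<Rightarrow> real) \<Rightarrow> real \<times> 'b \<Rightarrow> real" where
  "D_t f = (\<lambda>(t, y). deriv (\<lambda>s. f (s, y)) t)"

definition Lap_x2 :: "(real \<times> 'a::euclidean_space \<Rightarrow> real) \<Rightarrow> real \<times> 'a \<Rightarrow> real" where
  "Lap_x2 f = (\<lambda>(t, x). laplacian (\<lambda>y. f (t, y)) x)"

definition Lap_x3 :: "(real \<times> 'a::euclidean_space \<times> real \<Rightarrow> real) \<Rightarrow> real \<times> 'a \<times> real \<Rightarrow> real" where
  "Lap_x3 f = (\<lambda>(t, x, \<xi>). laplacian (\<lambda>y. f (t, y, \<xi>)) x)"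

definition D_xi :: "(real \<times> 'a \<times> real \<Rightarrow> real) \<Rightarrow> real \<times> 'a \<times> real \<Rightarrow> real" where
  "D_xi f = (\<lambda>(t, x, \<xi>). deriv (\<lambda>s. f (t, x, s)) \<xi>)"

definition test_function :: "'b::euclidean_space set \<Rightarrow> ('b \<Rightarrow> real) \<Rightarrow> bool" where
  "test_function W \<psi> \<longleftrightarrow>
     smooth_fun_on UNIV \<psi> \<and> (\<exists>K. compact K \<and> K \<subseteq> W \<and> (\<forall>z. z \<notin> K \<longrightarrow> \<psi> z = 0))"

text \<open>A distribution is represented by its action on test functions.\<close>

type_synonym 'b distribution = "('b \<Rightarrow> real) \<Rightarrow> real"

definition eq_distr_on ::
  "'b::euclidean_space set \<Rightarrow> 'b distribution \<Rightarrow> 'b distribution \<Rightarrow> bool" where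
  "eq_distr_on W L L' \<longleftrightarrow> (\<forall>\<psi>. test_function W \<psi> \<longrightarrow> L \<psi> = L' \<psi>)"

definition fun_distr :: "'b::euclidean_space set \<Rightarrow> ('b \<Rightarrow> real) \<Rightarrow> 'b distribution" where
  "fun_distr W f \<psi> = (\<integral>z. f z * \<psi> z \<partial>lebesgue_on W)"

definition measure_distr :: "'b measure \<Rightarrow> 'b distribution" where
  "measure_distr n \<psi> = (\<integral>z. \<psi> z \<partial>n)"

text \<open>The distribution \<open>\<integral> h(t,x,\<lambda>) \<delta>\<^bsub>\<xi>=F(\<lambda>)\<^esub>(\<xi>) d\<lambda>\<close> in \<open>(t, x, \<xi>)\<close>, with \<open>(t, x)\<close> ranging over \<open>D\<close>.\<close>
definition delta_distr ::
  "(real \<times> 'a::euclidean_space) set \<Rightarrow> (real \<Rightarrow> real) \<Rightarrow> (real \<times> 'a \<times> real \<Rightarrow> real)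
     \<Rightarrow> (real \<times> 'a \<times> real) distribution" where
  "delta_distr D F h \<psi> =
     (\<integral>z. (case z of (t, x) \<Rightarrow> \<integral>l. h (t, x, l) * \<psi> (t, x, F l) \<partial>lebesgue) \<partial>lebesgue_on D)"

definition dt_distr :: "(real \<times> 'b) distribution \<Rightarrow> (real \<times> 'b) distribution" where
  "dt_distr L \<psi> = - L (D_t \<psi>)"

definition dxi_distr ::
  "(real \<times> 'a \<times> real) distribution \<Rightarrow> (real \<times> 'a \<times> real) distribution" where
  "dxi_distr L \<psi> = - L (D_xi \<psi>)"

definition lap_distr ::
  "(real \<times> 'a::euclidean_space \<times> real) distribution \<Rightarrow> (real \<times> 'a \<times> real) distribution" where
  "lap_distr L \<psi> = L (Lap_x3 \<psi>)"


section \<open>Domain, boundary condition, initial data\<close>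

definition boundary_function ::
  "'a::euclidean_space set \<Rightarrow> 'a \<Rightarrow> 'a set \<Rightarrow> ('a \<Rightarrow> real) \<Rightarrow> bool" where
  "boundary_function \<Omega> x U \<rho> \<longleftrightarrow>
     open U \<and> x \<in> U \<and> smooth_fun_on U \<rho> \<and> (\<forall>y\<in>U. \<exists>b\<in>Basis. partial_deriv b \<rho> y \<noteq> 0) \<and>
     \<Omega> \<inter> U = {y\<in>U. \<rho> y < 0} \<and> frontier \<Omega> \<inter> U = {y\<in>U. \<rho> y = 0}"

definition smooth_bounded_domain :: "'a::euclidean_space set \<Rightarrow> bool" where
  "smooth_bounded_domain \<Omega> \<longleftrightarrow>
     open \<Omega> \<and> connected \<Omega> \<and> bounded \<Omega> \<and> \<Omega> \<noteq> {} \<and>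
     (\<forall>x\<in>frontier \<Omega>. \<exists>U \<rho>. boundary_function \<Omega> x U \<rho>)"

definition outer_normal :: "'a::euclidean_space set \<Rightarrow> 'a \<Rightarrow> 'a \<Rightarrow> bool" where
  "outer_normal \<Omega> x \<nu> \<longleftrightarrow>
     norm \<nu> = 1 \<and>
     (\<exists>U \<rho> c. boundary_function \<Omega> x U \<rho> \<and> c > 0 \<and>
        (\<forall>h. frechet_derivative \<rho> (at x) h = c * (\<nu> \<bullet> h)))"

text \<open>The derivative at a boundary point is the one relative to the closed domain.\<close>
definition neumann :: "'a::euclidean_space set \<Rightarrow> ('a \<Rightarrow> real) \<Rightarrow> bool" where
  "neumann \<Omega> w \<longleftrightarrow>
     (\<forall>x\<in>frontier \<Omega>. \<forall>\<nu>. outer_normal \<Omega> x \<nu> \<longrightarrow>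
        (\<exists>w'. (w has_derivative w') (at x within closure \<Omega>) \<and> w' \<nu> = 0))"

definition extends_cont :: "'a::euclidean_space set \<Rightarrow> ('a \<Rightarrow> real) \<Rightarrow> bool" where
  "extends_cont \<Omega> g \<longleftrightarrow> (\<exists>G. continuous_on (closure \<Omega>) G \<and> (\<forall>x\<in>\<Omega>. G x = g x))"

text \<open>The space \<open>C\<^bsup>2+\<alpha>\<^esup>\<close> on the closure of \<open>\<Omega>\<close>.\<close>
definition C2_holder :: "real \<Rightarrow> 'a::euclidean_space set \<Rightarrow> ('a \<Rightarrow> real) \<Rightarrow> bool" where
  "C2_holder \<alpha> \<Omega> w \<longleftrightarrow>
     continuous_on (closure \<Omega>) w \<and> Ck_on 2 \<Omega> w \<and>
     (\<forall>b\<in>Basis. extends_cont \<Omega> (partial_deriv b w)) \<and>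
     (\<forall>b\<in>Basis. \<forall>c\<in>Basis. extends_cont \<Omega> (partial_deriv c (partial_deriv b w)) \<and>
        (\<exists>H. \<forall>x\<in>\<Omega>. \<forall>y\<in>\<Omega>.
           \<bar>partial_deriv c (partial_deriv b w) x - partial_deriv c (partial_deriv b w) y\<bar>
             \<le> H * dist x y powr \<alpha>))"


section \<open>The reaction function and its branches\<close>

text \<open>Inverses of \<open>F\<close> on its three monotone branches, extended by constants; \<open>f\<^sub>-\<close> is \<open>F bm\<close> and
  \<open>f\<^sub>+\<close> is \<open>F ap\<close>.\<close>

definition S1 :: "(real \<Rightarrow> real) \<Rightarrow> real \<Rightarrow> real \<Rightarrow> real" where
  "S1 F ap r = (if r < F ap then the_inv_into {..<ap} F r else ap)"

definition S2 :: "(real \<Rightarrow> real) \<Rightarrow> real \<Rightarrow> real \<Rightarrow> real \<Rightarrow> real" where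
  "S2 F ap bm r =
     (if r \<le> F bm then bm else if r \<ge> F ap then ap else the_inv_into {ap<..<bm} F r)"

definition S3 :: "(real \<Rightarrow> real) \<Rightarrow> real \<Rightarrow> real \<Rightarrow> real" where
  "S3 F bm r = (if r > F bm then the_inv_into {bm<..} F r else bm)"

text \<open>Since \<open>F'\<close> may vanish inside a branch, the identity in the nondegeneracy condition is
  understood to include that the derivatives of the branches exist.\<close>
definition nondegenerate :: "(real \<Rightarrow> real) \<Rightarrow> real \<Rightarrow> real \<Rightarrow> bool" where
  "nondegenerate F ap bm \<longleftrightarrow>
     (\<forall>c d a1 a2 a3. F bm \<le> c \<and> c < d \<and> d \<le> F ap \<and>
        (\<forall>r\<in>{c<..<d}. \<exists>s1 s2 s3.
            (S1 F ap has_real_derivative s1) (at r) \<and>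
            (S2 F ap bm has_real_derivative s2) (at r) \<and>
            (S3 F bm has_real_derivative s3) (at r) \<and>
            a1 * (s1 + 1) + a2 * (s2 + 1) + a3 * (s3 + 1) = 0)
        \<longrightarrow> a1 + a2 + a3 = 0)"

definition reaction_function ::
  "(real \<Rightarrow> real) \<Rightarrow> real \<Rightarrow> real \<Rightarrow> real \<Rightarrow> real \<Rightarrow> bool" where
  "reaction_function F am ap bm bp \<longleftrightarrow>
     F C1_differentiable_on UNIV \<and> F 0 = 0 \<and> (\<forall>u\<ge>0. F u \<ge> 0) \<and>
     0 < am \<and> am < ap \<and> ap < bm \<and> bm < bp \<and> F bm = F am \<and> F ap = F bp \<and>
     strict_mono_on {..<ap} F \<and> strict_mono_on {bm<..} F \<and> strict_antimono_on {ap<..<bm} F \<and>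
     filterlim F at_top at_top \<and> filterlim F at_bot at_bot \<and>
     nondegenerate F ap bm"


section \<open>The reaction-diffusion system\<close>

text \<open>Global classical solutions. Continuity of the time derivatives follows from the equations.
  Only \<open>v\<close> diffuses, so the boundary condition is imposed on \<open>v\<close>.\<close>
definition classical_solution ::
  "(real \<Rightarrow> real) \<Rightarrow> 'a::euclidean_space set \<Rightarrow> ('a \<Rightarrow> real) \<Rightarrow> ('a \<Rightarrow> real) \<Rightarrow> real
     \<Rightarrow> (real \<times> 'a \<Rightarrow> real) \<Rightarrow> (real \<times> 'a \<Rightarrow> real) \<Rightarrow> bool" where
  "classical_solution F \<Omega> u0 v0 \<epsilon> u v \<longleftrightarrow>
     continuous_on ({0..} \<times> closure \<Omega>) u \<and> continuous_on ({0..} \<times> closure \<Omega>) v \<and>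
     (\<forall>t>0. Ck_on 2 \<Omega> (\<lambda>y. v (t, y))) \<and>
     (\<forall>b\<in>Basis. \<forall>c\<in>Basis. continuous_on ({0<..} \<times> \<Omega>)
        (\<lambda>(t, x). partial_deriv c (partial_deriv b (\<lambda>y. v (t, y))) x)) \<and>
     (\<exists>G. continuous_on ({0<..} \<times> closure \<Omega>) G \<and>
        (\<forall>t>0. \<forall>x\<in>closure \<Omega>.
           ((\<lambda>y. v (t, y)) has_derivative (\<lambda>h. G (t, x) \<bullet> h)) (at x within closure \<Omega>))) \<and>
     (\<forall>t>0. \<forall>x\<in>\<Omega>.
        ((\<lambda>s. u (s, x)) has_real_derivative (v (t, x) - F (u (t, x))) / \<epsilon>) (at t) \<and>
        ((\<lambda>s. v (s, x)) has_real_derivative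
            laplacian (\<lambda>y. v (t, y)) x + (F (u (t, x)) - v (t, x)) / \<epsilon>) (at t)) \<and>
     (\<forall>t>0. neumann \<Omega> (\<lambda>y. v (t, y))) \<and>
     (\<forall>x\<in>closure \<Omega>. u (0, x) = u0 x \<and> v (0, x) = v0 x)"


section \<open>Modes of convergence\<close>

definition strong_L2_limit ::
  "'b::euclidean_space set \<Rightarrow> (nat \<Rightarrow> 'b \<Rightarrow> real) \<Rightarrow> ('b \<Rightarrow> real) \<Rightarrow> bool" where
  "strong_L2_limit D w w0 \<longleftrightarrow>
     w0 \<in> borel_measurable (lebesgue_on D) \<and> integrable (lebesgue_on D) (\<lambda>z. (w0 z)\<^sup>2) \<and>
     (\<lambda>k. \<integral>\<^sup>+ z. ennreal ((w k z - w0 z)\<^sup>2) \<partial>lebesgue_on D) \<longlonglongrightarrow> 0"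

definition weak_star_limit ::
  "'b::euclidean_space set \<Rightarrow> (nat \<Rightarrow> 'b \<Rightarrow> real) \<Rightarrow> ('b \<Rightarrow> real) \<Rightarrow> bool" where
  "weak_star_limit D w w0 \<longleftrightarrow>
     w0 \<in> borel_measurable (lebesgue_on D) \<and> (\<exists>C. AE z in lebesgue_on D. \<bar>w0 z\<bar> \<le> C) \<and>
     (\<forall>\<phi>. integrable (lebesgue_on D) \<phi> \<longrightarrow>
        (\<lambda>k. \<integral>z. w k z * \<phi> z \<partial>lebesgue_on D) \<longlonglongrightarrow> (\<integral>z. w0 z * \<phi> z \<partial>lebesgue_on D))"

definition young_measure ::
  "'b::euclidean_space set \<Rightarrow> (nat \<Rightarrow> 'b \<Rightarrow> real) \<Rightarrow> ('b \<Rightarrow> real measure) \<Rightarrow> bool" where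
  "young_measure D w \<mu> \<longleftrightarrow>
     (\<forall>z\<in>D. prob_space (\<mu> z) \<and> sets (\<mu> z) = sets borel) \<and>
     (\<forall>G. continuous_on UNIV G \<and> bounded (range G) \<longrightarrow>
        weak_star_limit D (\<lambda>k z. G (w k z)) (\<lambda>z. \<integral>s. G s \<partial>\<mu> z))"

text \<open>Uniform \<open>L\<^sup>2\<close> bound for a family indexed by \<open>\<epsilon> \<in> (0,1)\<close>.\<close>
definition bounded_in_L2 ::
  "'b::euclidean_space set \<Rightarrow> (real \<Rightarrow> 'b \<Rightarrow> real) \<Rightarrow> bool" where
  "bounded_in_L2 D w \<longleftrightarrow>
     (\<exists>C::real. \<forall>\<epsilon>\<in>{0<..<1}. w \<epsilon> \<in> borel_measurable (lebesgue_on D) \<and>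
        (\<integral>\<^sup>+ z. ennreal ((w \<epsilon> z)\<^sup>2) \<partial>lebesgue_on D) \<le> ennreal C)"

end

theory Submission
  imports Defs
begin

text \<open>For part (1), let \<open>A' = \<theta> \<circ> F\<close> and \<open>B' = \<theta>\<close> for a Lipschitz bump function \<open>\<theta>\<close>. The system gives
  \<open>\<partial>\<^sub>t (A(u) + B(v)) = \<theta>(v) \<Delta>v + (\<theta>(v) - \<theta>(F(u))) (F(u) - v) / \<epsilon>\<close>. If \<open>(F(u) - v) / \<epsilon> = \<partial>\<^sub>t v - \<Delta>v\<close> is bounded
  in \<open>L\<^sup>2\<close>, the last term is \<open>O(\<epsilon>)\<close> in \<open>L\<^sup>1\<close>, and \<open>\<theta>(v) \<Delta>v\<close> tends to \<open>0\<close> wherever \<open>\<theta>\<close> vanishes at the limit of \<open>v\<close>.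
  A bump supported in \<open>(f\<^sub>-, f\<^sub>+)\<close> above the values of the limit turns the Young mean of \<open>A\<close> into an affine function of
  \<open>lam1\<close>, a bump below these values into one of \<open>lam3\<close>. Beyond \<open>f\<^sub>+\<close> and \<open>f\<^sub>-\<close> these weights vanish, since
  \<open>F(u) - v\<close> tends to \<open>0\<close>.

  For part (2), testing the weak limits with boxes shows that \<open>p\<close> is the sum of the indicators of
  \<open>[0, S\<^sub>i(v)]\<close> weighted by \<open>\<lambda>\<^sub>i\<close> and \<open>q\<close> is the indicator of \<open>[0, v]\<close>. On the given sets \<open>q\<close> is constant
  and the sign of \<open>F(\<lambda>) - v\<close> decides which layers of \<open>p\<close> contribute.\<close>

section \<open>Integration\<close>

text \<open>Two obstacles shape the proof. First, Young measures are tested only with bounded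
  continuous functions, and a primitive of \<open>\<theta> \<circ> F\<close> may grow. Placing the
  bump between the critical levels cures this: \<open>F\<close> meets that range only on
  \<open>{am..bp}\<close>, so the primitive is constant outside. The bump must also miss the values
  of \<open>vlim\<close> on the support of the test function, since otherwise the Laplacian term
  survives in the limit; compactness of the support leaves the gap. This gap can be guaranteed only
  on one side of a critical level, which is why supports are cut along the level and the two pieces
  are treated by different arguments. Second, the weights, \<open>vlim\<close>, \<open>p\<close> and
  \<open>q\<close> are Lebesgue measurable and identified only up to null sets, whereas product
  measures live on Borel sets and the distributions are iterated integrals. Completeness permits
  replacement almost everywhere without measurability conditions, and Borel versions carry
  Fubini.\<close>

lemma complete_measure_lebesgue_on:
  assumes S: "S \<in> sets lebesgue"
  shows "complete_measure (lebesgue_on S)"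
proof
  fix A B :: "'a set" assume BA: "B \<subseteq> A" and A: "A \<in> null_sets (lebesgue_on S)"
  have "A \<in> null_sets lebesgue" and AS: "A \<subseteq> S"
    using A S by (auto simp: null_sets_restrict_space)
  then have "B \<in> null_sets lebesgue"
    using BA complete_measure.complete2[OF completion.complete_measure_axioms] by blast
  then show "B \<in> sets (lebesgue_on S)"
    using BA AS S by (auto simp: sets_restrict_space_iff)
qed

lemma borel_measurable_cong_AE_complete:
  assumes M: "complete_measure M" and ae: "AE x in M. f x = g x"
    and f: "f \<in> borel_measurable M"
  shows "g \<in> borel_measurable M"
proof (rule measurableI)
  fix A :: "'b set" assume A: "A \<in> sets borel"
  have fA: "f -` A \<inter> space M \<in> sets M" using f A by (rule measurable_sets)
  have "AE x in M. x \<in> f -` A \<inter> space M \<longleftrightarrow> x \<in> g -` A \<inter> space M"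
    using ae by eventually_elim auto
  from complete_measure.in_sets_AE[OF M this fA] show "g -` A \<inter> space M \<in> sets M" by auto
qed auto

text \<open>Completeness transfers measurability between \<open>f\<close> and \<open>g\<close>. If
  one of them is not measurable, neither is the other, and both integrals have the default value
  0.\<close>

lemma integral_cong_AE_complete:
  fixes f g :: "'a \<Rightarrow> 'b::{banach, second_countable_topology}"
  assumes M: "complete_measure M" and ae: "AE x in M. f x = g x"
  shows "integral\<^sup>L M f = integral\<^sup>L M g"
proof (cases "f \<in> borel_measurable M")
  case True
  then show ?thesis
    using ae borel_measurable_cong_AE_complete[OF M ae] by (intro integral_cong_AE) auto
next
  case False
  have ae': "AE x in M. g x = f x" using ae by eventually_elim simp
  have "g \<notin> borel_measurable M"
    using False borel_measurable_cong_AE_complete[OF M ae'] by blast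
  then have "\<not> integrable M g" "\<not> integrable M f"
    using False borel_measurable_integrable by blast+
  then show ?thesis by (simp add: not_integrable_integral_eq)
qed

lemma integrable_compact_support:
  fixes f :: "'a::euclidean_space \<Rightarrow> real"
  assumes "compact K" "continuous_on UNIV f" "\<And>z. z \<notin> K \<Longrightarrow> f z = 0"
  shows "integrable lborel f"
proof -
  have "integrable lborel (\<lambda>z. indicator K z *\<^sub>R f z)"
    using assms by (intro borel_integrable_compact) (auto intro: continuous_on_subset)
  moreover have "(\<lambda>z. indicator K z *\<^sub>R f z) = f"
    using assms(3) by (auto simp: fun_eq_iff indicator_def)
  ultimately show ?thesis by simp
qed

lemma bounded_compact_support:
  fixes f :: "'a::euclidean_space \<Rightarrow> real"
  assumes "compact K" "continuous_on UNIV f" "\<And>z. z \<notin> K \<Longrightarrow> f z = 0"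
  obtains M where "M \<ge> 0" "\<And>z. \<bar>f z\<bar> \<le> M"
proof -
  have "bounded (f ` K)"
    using assms by (intro compact_imp_bounded compact_continuous_image) (auto intro: continuous_on_subset)
  then obtain M where M: "\<And>z. z \<in> K \<Longrightarrow> \<bar>f z\<bar> \<le> M"
    by (auto simp: bounded_iff)
  have "\<bar>f z\<bar> \<le> max 0 M" for z
    using M[of z] assms(3)[of z] by (cases "z \<in> K") auto
  then show thesis by (intro that[of "max 0 M"]) auto
qed

text \<open>The integral of each difference quotient vanishes by translation invariance.\<close>
lemma integral_directional_derivative_eq_0:
  fixes f g :: "'a::euclidean_space \<Rightarrow> real"
  assumes K: "compact K" and f0: "\<And>z. z \<notin> K \<Longrightarrow> f z = 0"
    and contf: "continuous_on UNIV f" and contg: "continuous_on UNIV g"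
    and deriv: "\<And>z. ((\<lambda>s. f (z + s *\<^sub>R b)) has_real_derivative g z) (at 0)"
  shows "(\<integral>z. g z \<partial>lborel) = 0"
proof -
  have deriv': "((\<lambda>s. f (z + s *\<^sub>R b)) has_real_derivative g (z + r *\<^sub>R b)) (at r)" for z r
  proof -
    have "((\<lambda>s. f ((z + r *\<^sub>R b) + s *\<^sub>R b)) has_real_derivative g (z + r *\<^sub>R b)) (at 0)"
      by (rule deriv)
    then have "((\<lambda>s. f (z + (s + r) *\<^sub>R b)) has_real_derivative g (z + r *\<^sub>R b)) (at 0)"
      by (simp add: algebra_simps)
    then show ?thesis
      using DERIV_shift[of "\<lambda>s. f (z + s *\<^sub>R b)" "g (z + r *\<^sub>R b)" 0 r] by simp
  qed
  \<comment> \<open>The complement of \<open>K\<close> is open, so \<open>f\<close> vanishes along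
    the line through \<open>z\<close> near the parameter 0 and has derivative 0 there.\<close>
  have g0: "g z = 0" if "z \<notin> K" for z
  proof -
    have "open ((\<lambda>s. z + s *\<^sub>R b) -` (- K))"
      by (intro open_vimage continuous_intros) (use K compact_imp_closed in auto)
    then have "eventually (\<lambda>s. s \<in> (\<lambda>s. z + s *\<^sub>R b) -` (- K)) (nhds 0)"
      by (rule eventually_nhds_in_open) (use that in auto)
    then have ev: "eventually (\<lambda>s. f (z + s *\<^sub>R b) = 0) (nhds 0)"
      by eventually_elim (auto intro: f0)
    have "((\<lambda>s. f (z + s *\<^sub>R b)) has_real_derivative 0) (at 0)"
      using DERIV_cong_ev[OF refl ev refl] by simp
    with deriv[of z] show ?thesis by (rule DERIV_unique)
  qed
  obtain M where M: "M \<ge> 0" "\<And>z. \<bar>g z\<bar> \<le> M"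
    using bounded_compact_support[OF K contg g0] by metis
  have intf: "integrable lborel f"
    by (rule integrable_compact_support[OF K contf f0])
  \<comment> \<open>All shifts of \<open>K\<close> backwards along \<open>b\<close> by at most one
    step. The difference quotients \<open>h k\<close> have step at most 1, so they all vanish
    outside this one compact set and share an integrable bound.\<close>
  define K' where "K' = (\<lambda>(z, s). z - s *\<^sub>R b) ` (K \<times> {0..1::real})"
  have K': "compact K'"
    unfolding K'_def using K
    by (intro compact_continuous_image compact_Times) (auto intro!: continuous_intros simp: case_prod_unfold)
  define h where "h k z = (f (z + inverse (real (Suc k)) *\<^sub>R b) - f z) * real (Suc k)" for k z
  have bd: "\<bar>h k z\<bar> \<le> M * indicator K' z" for k z
  proof -
    define s where "s = inverse (real (Suc k))"
    have s: "0 < s" "s \<le> 1" by (auto simp: s_def field_simps)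
    have eq: "h k z = (f (z + s *\<^sub>R b) - f z) / s"
      by (simp add: h_def s_def field_simps)
    show ?thesis
    proof (cases "z \<in> K'")
      case True
      obtain r where "f (z + s *\<^sub>R b) - f (z + 0 *\<^sub>R b) = (s - 0) * g (z + r *\<^sub>R b)"
        using MVT2[of 0 s "\<lambda>s. f (z + s *\<^sub>R b)" "\<lambda>s. g (z + s *\<^sub>R b)"] s deriv' by blast
      then have "h k z = g (z + r *\<^sub>R b)" using s by (simp add: eq)
      then show ?thesis using M True by simp
    next
      case False
      have "z \<notin> K" using False unfolding K'_def by (force intro!: image_eqI[of _ _ "(z, 0)"])
      moreover have "z + s *\<^sub>R b \<notin> K"
        using False s unfolding K'_def by (auto intro!: image_eqI[of _ _ "(z + s *\<^sub>R b, s)"])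
      ultimately show ?thesis using f0 False by (simp add: eq)
    qed
  qed
  have hm: "h k \<in> borel_measurable lborel" for k
  proof -
    have "continuous_on UNIV (h k)"
      unfolding h_def by (intro continuous_intros continuous_on_compose2[OF contf]) auto
    then show ?thesis by (simp add: borel_measurable_continuous_onI)
  qed
  have "(\<lambda>k. \<integral>z. h k z \<partial>lborel) \<longlonglongrightarrow> (\<integral>z. g z \<partial>lborel)"
  proof (rule integral_dominated_convergence[where w = "\<lambda>z. M * indicator K' z"])
    show "g \<in> borel_measurable lborel" using contg by (simp add: borel_measurable_continuous_onI)
    have "emeasure lborel K' < \<infinity>" using K' by (intro emeasure_bounded_finite compact_imp_bounded)
    then show "integrable lborel (\<lambda>z. M * indicator K' z)"
      using K' by (intro integrable_mult_right integrable_real_indicator) (auto simp: borel_compact)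
    show "AE z in lborel. (\<lambda>k. h k z) \<longlonglongrightarrow> g z"
    proof (rule AE_I2)
      fix z
      have "((\<lambda>s. (f (z + (0 + s) *\<^sub>R b) - f (z + 0 *\<^sub>R b)) / s) \<longlongrightarrow> g z) (at 0)"
        using deriv[of z] by (simp add: has_field_derivative_iff)
      moreover have "filterlim (\<lambda>k. inverse (real (Suc k))) (at 0) sequentially"
        unfolding filterlim_at using LIMSEQ_inverse_real_of_nat by auto
      ultimately have "(\<lambda>k. (f (z + (0 + inverse (real (Suc k))) *\<^sub>R b) - f (z + 0 *\<^sub>R b)) / inverse (real (Suc k))) \<longlonglongrightarrow> g z"
        by (rule filterlim_compose)
      then show "(\<lambda>k. h k z) \<longlonglongrightarrow> g z" by (simp add: h_def divide_inverse)
    qed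
  qed (use bd hm in auto)
  moreover have "(\<integral>z. h k z \<partial>lborel) = 0" for k
  proof -
    let ?c = "inverse (real (Suc k)) *\<^sub>R b"
    have fm: "f \<in> borel_measurable borel" using contf by (rule borel_measurable_continuous_onI)
    have eq: "(\<integral>z. f (?c + z) \<partial>lborel) = (\<integral>z. f z \<partial>lborel)"
      using integral_distr[of "(+) ?c" lborel borel f] fm lborel_distr_plus[of ?c] by simp
    have int: "integrable lborel (\<lambda>z. f (?c + z))"
      using integrable_distr_eq[of "(+) ?c" lborel borel f] fm lborel_distr_plus[of ?c] intf by simp
    show ?thesis using eq int intf by (simp add: h_def add.commute)
  qed
  ultimately show ?thesis by (simp add: LIMSEQ_const_iff)
qed

section \<open>Test functions\<close>

lemma partial_deriv_has_derivative:
  assumes "f differentiable (at z)"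
  shows "((\<lambda>s. f (z + s *\<^sub>R b)) has_real_derivative partial_deriv b f z) (at 0)"
proof -
  have f': "(f has_derivative frechet_derivative f (at z)) (at (z + 0 *\<^sub>R b))"
    using assms frechet_derivative_works by force
  have "((\<lambda>s. z + s *\<^sub>R b) has_derivative (\<lambda>s. s *\<^sub>R b)) (at 0)"
    by (auto intro!: derivative_eq_intros)
  from diff_chain_at[OF this f'] have
    "((\<lambda>s. f (z + s *\<^sub>R b)) has_derivative (\<lambda>s. frechet_derivative f (at z) (s *\<^sub>R b))) (at 0)"
    by (simp add: o_def)
  moreover have "frechet_derivative f (at z) (s *\<^sub>R b) = partial_deriv b f z * s" for s
    using linear_cmul[OF linear_frechet_derivative[OF assms]] by (simp add: partial_deriv_def)
  ultimately show ?thesis by (simp add: has_field_derivative_def)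
qed

lemma partial_deriv_cong_open:
  assumes "open U" "z \<in> U" "\<And>y. y \<in> U \<Longrightarrow> f y = g y"
  shows "partial_deriv b f z = partial_deriv b g z" "f differentiable (at z) \<longleftrightarrow> g differentiable (at z)"
proof -
  have *: "(f has_derivative D) (at z) \<longleftrightarrow> (g has_derivative D) (at z)" for D
    using assms by (auto elim!: has_derivative_transform_within_open)
  show "partial_deriv b f z = partial_deriv b g z"
    by (simp add: partial_deriv_def frechet_derivative_def *)
  show "f differentiable (at z) \<longleftrightarrow> g differentiable (at z)" by (simp add: differentiable_def *)
qed

lemma partial_deriv_const_0 [simp]: "partial_deriv b (\<lambda>_. 0) z = 0"
  using frechet_derivative_const[of "0::real" z] by (simp add: partial_deriv_def)

lemma partial_deriv_eq_0:
  assumes "closed K" "\<And>z. z \<notin> K \<Longrightarrow> f z = 0" "z \<notin> K"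
  shows "partial_deriv b f z = 0"
  using partial_deriv_cong_open(1)[of "- K" z f "\<lambda>_. 0"] assms by auto

lemma smooth_fun_on_partial_deriv:
  "smooth_fun_on S f \<Longrightarrow> b \<in> Basis \<Longrightarrow> smooth_fun_on S (partial_deriv b f)"
  unfolding smooth_fun_on_def using Ck_on.simps(2) by blast

lemma smooth_fun_on_continuous: "smooth_fun_on S f \<Longrightarrow> continuous_on S f"
  unfolding smooth_fun_on_def using Ck_on.simps(1) by blast

lemma smooth_fun_on_differentiable: "smooth_fun_on S f \<Longrightarrow> z \<in> S \<Longrightarrow> f differentiable (at z)"
  unfolding smooth_fun_on_def using Ck_on.simps(2) by blast

lemma test_function_partial_deriv:
  assumes "test_function W f" "b \<in> Basis"
  shows "test_function W (partial_deriv b f)"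
proof -
  obtain K where K: "compact K" "K \<subseteq> W" "\<And>z. z \<notin> K \<Longrightarrow> f z = 0" and f: "smooth_fun_on UNIV f"
    using assms(1) by (auto simp: test_function_def)
  have "partial_deriv b f z = 0" if "z \<notin> K" for z
    using partial_deriv_eq_0[OF compact_imp_closed[OF K(1)] K(3) that] .
  then show ?thesis
    using K smooth_fun_on_partial_deriv[OF f assms(2)] unfolding test_function_def by blast
qed

lemma test_function_mono: "test_function U f \<Longrightarrow> U \<subseteq> W \<Longrightarrow> test_function W f"
  unfolding test_function_def by blast

lemma test_function_cont: "test_function W f \<Longrightarrow> continuous_on UNIV f"
  by (auto simp: test_function_def smooth_fun_on_continuous)

lemma test_function_differentiable: "test_function W f \<Longrightarrow> f differentiable (at z)"
  by (auto simp: test_function_def smooth_fun_on_differentiable)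

lemma test_function_eq_0: "test_function W f \<Longrightarrow> z \<notin> W \<Longrightarrow> f z = 0"
  by (auto simp: test_function_def)

lemma integral_partial_deriv_test_function:
  assumes "test_function W f" "b \<in> Basis"
  shows "(\<integral>z. partial_deriv b f z \<partial>lborel) = 0"
proof -
  obtain K where K: "compact K" "\<And>z. z \<notin> K \<Longrightarrow> f z = 0"
    using assms(1) by (auto simp: test_function_def)
  show ?thesis
    by (rule integral_directional_derivative_eq_0[OF K])
       (use assms in \<open>auto intro: test_function_cont test_function_partial_deriv
          test_function_differentiable partial_deriv_has_derivative\<close>)
qed

text \<open>Links the slicewise \<open>deriv\<close> to the Frechet partial derivative, through
  which smoothness, support and the vanishing integral are inherited.\<close>

lemma D_t_eq_partial_deriv:
  fixes f :: "real \<times> 'b::euclidean_space \<Rightarrow> real"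
  assumes "f differentiable (at z)"
  shows "D_t f z = partial_deriv (1, 0) f z"
proof -
  obtain t y where z: "z = (t, y)" by (cases z)
  have "((\<lambda>s. f (s + t, y)) has_real_derivative partial_deriv (1, 0) f z) (at 0)"
    using partial_deriv_has_derivative[OF assms, of "(1, 0)"] by (simp add: z add.commute)
  then have "((\<lambda>s. f (s, y)) has_real_derivative partial_deriv (1, 0) f z) (at t)"
    using DERIV_shift[of "\<lambda>s. f (s, y)" _ 0 t] by simp
  then show ?thesis by (simp add: D_t_def z DERIV_imp_deriv)
qed

lemma Basis_time: "(1, 0) \<in> (Basis :: (real \<times> 'b::euclidean_space) set)"
  by (auto simp: Basis_prod_def)

lemma D_t_test_function:
  fixes f :: "real \<times> 'b::euclidean_space \<Rightarrow> real"
  assumes "test_function W f"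
  shows "D_t f = partial_deriv (1, 0) f" "test_function W (D_t f)" "(\<integral>z. D_t f z \<partial>lborel) = 0"
proof -
  show eq: "D_t f = partial_deriv (1, 0) f"
    using D_t_eq_partial_deriv[OF test_function_differentiable[OF assms]] by (simp add: fun_eq_iff)
  show "test_function W (D_t f)" "(\<integral>z. D_t f z \<partial>lborel) = 0"
    unfolding eq using assms Basis_time
    by (auto intro: test_function_partial_deriv integral_partial_deriv_test_function)
qed

lemma partial_deriv_slice:
  fixes f :: "real \<times> 'a::euclidean_space \<times> real \<Rightarrow> real"
  assumes "f differentiable (at (t, x, \<xi>))"
  shows "partial_deriv b (\<lambda>y. f (t, y, \<xi>)) x = partial_deriv (0, b, 0) f (t, x, \<xi>)"
proof -
  have f': "(f has_derivative frechet_derivative f (at (t, x, \<xi>))) (at (t, x, \<xi>))"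
    using assms frechet_derivative_works by blast
  have "((\<lambda>y. (t, y, \<xi>)) has_derivative (\<lambda>h. (0, h, 0))) (at x)"
    by (auto intro!: derivative_eq_intros)
  from diff_chain_at[OF this f'] have
    "((\<lambda>y. f (t, y, \<xi>)) has_derivative (\<lambda>h. frechet_derivative f (at (t, x, \<xi>)) (0, h, 0))) (at x)"
    by (simp add: o_def)
  from frechet_derivative_at[OF this] show ?thesis
    by (simp add: partial_deriv_def) metis
qed

lemma Lap_x3_test_function:
  fixes f :: "real \<times> 'a::euclidean_space \<times> real \<Rightarrow> real"
  assumes "test_function W f"
  shows "Lap_x3 f z = (\<Sum>b\<in>Basis. partial_deriv (0, b, 0) (partial_deriv (0, b, 0) f) z)"
proof -
  obtain t x \<xi> where z: "z = (t, x, \<xi>)" by (cases z) auto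
  have B: "(0, b, 0) \<in> (Basis :: (real \<times> 'a \<times> real) set)" if "b \<in> Basis" for b :: 'a
    using that by (auto simp: Basis_prod_def)
  have 1: "partial_deriv b (\<lambda>y. f (t, y, \<xi>)) = (\<lambda>y. partial_deriv (0, b, 0) f (t, y, \<xi>))" for b
    by (rule ext) (rule partial_deriv_slice, rule test_function_differentiable[OF assms])
  show ?thesis
    unfolding z Lap_x3_def laplacian_def prod.case 1
    by (intro sum.cong refl partial_deriv_slice)
       (rule test_function_differentiable[OF test_function_partial_deriv[OF assms B]])
qed

text \<open>Where \<open>q\<close> is constant, testing its Laplacian gives a multiple of this
  integral. Each summand is a partial derivative of a test function and therefore integrates to
  0.\<close>

lemma
  fixes f :: "real \<times> 'a::euclidean_space \<times> real \<Rightarrow> real"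
  assumes "test_function W f"
  shows integral_Lap_x3_test_function: "(\<integral>z. Lap_x3 f z \<partial>lborel) = 0"
    and Lap_x3_eq_0: "z \<notin> W \<Longrightarrow> Lap_x3 f z = 0"
proof -
  have B: "(0, b, 0) \<in> (Basis :: (real \<times> 'a \<times> real) set)" if "b \<in> Basis" for b :: 'a
    using that by (auto simp: Basis_prod_def)
  have t1: "test_function W (partial_deriv (0, b, 0) f)" if "b \<in> Basis" for b
    by (rule test_function_partial_deriv[OF assms B[OF that]])
  have t2: "test_function W (partial_deriv (0, b, 0) (partial_deriv (0, b, 0) f))" if "b \<in> Basis" for b
    by (rule test_function_partial_deriv[OF t1[OF that] B[OF that]])
  have int: "integrable lborel (partial_deriv (0, b, 0) (partial_deriv (0, b, 0) f))" if b: "b \<in> Basis" for b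
  proof -
    obtain K where K: "compact K" "\<And>z. z \<notin> K \<Longrightarrow> partial_deriv (0, b, 0) (partial_deriv (0, b, 0) f) z = 0"
      using t2[OF b] by (auto simp: test_function_def)
    show ?thesis by (rule integrable_compact_support[OF K(1) test_function_cont[OF t2[OF b]] K(2)])
  qed
  show "(\<integral>z. Lap_x3 f z \<partial>lborel) = 0"
    unfolding Lap_x3_test_function[OF assms]
    by (subst Bochner_Integration.integral_sum)
       (auto intro!: int sum.neutral integral_partial_deriv_test_function t1 B)
  show "Lap_x3 f z = 0" if "z \<notin> W"
    unfolding Lap_x3_test_function[OF assms]
    by (intro sum.neutral ballI) (rule test_function_eq_0[OF t2 that])
qed

section \<open>Cutting a test function along disjoint open sets\<close>

lemma partial_deriv_indicator:
  assumes U: "open U" and C: "closed C" "C \<subseteq> U" and f0: "\<And>z. z \<in> U - C \<Longrightarrow> f z = 0"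
  shows "partial_deriv b (\<lambda>z. indicator U z * f z) z = indicator U z * partial_deriv b f z"
proof (cases "z \<in> U")
  case True
  then show ?thesis
    using partial_deriv_cong_open(1)[OF U, of z "\<lambda>z. indicator U z * f z" f] by simp
next
  case False
  then show ?thesis
    using partial_deriv_cong_open(1)[of "- C" z "\<lambda>z. indicator U z * f z" "\<lambda>_. 0"] C f0
    by (auto simp: indicator_def)
qed

lemma continuous_on_indicator_mult:
  fixes f :: "'a::euclidean_space \<Rightarrow> real"
  assumes U: "open U" and C: "closed C" "C \<subseteq> U" and f0: "\<And>z. z \<in> U - C \<Longrightarrow> f z = 0"
    and f: "continuous_on U f"
  shows "continuous_on UNIV (\<lambda>z. indicator U z * f z)"
proof -
  have "continuous_on (U \<union> - C) (\<lambda>z. indicator U z * f z)"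
  proof (rule continuous_on_open_Un)
    show "continuous_on U (\<lambda>z. indicator U z * f z)"
      using f by (rule continuous_on_eq) auto
    show "continuous_on (- C) (\<lambda>z. indicator U z * f z)"
      by (rule continuous_on_eq[of _ "\<lambda>_. 0"]) (use f0 in \<open>auto simp: indicator_def\<close>)
  qed (use U C in auto)
  moreover have "U \<union> - C = UNIV" using C by auto
  ultimately show ?thesis by simp
qed

text \<open>\<open>U\<close> and the complement of \<open>C\<close> are open and cover the space;
  the product is \<open>f\<close> on the first and 0 on the second. Cutting therefore commutes with
  partial derivatives, and these vanish on \<open>U - C\<close> again, which lets the induction run
  with \<open>f\<close> arbitrary.\<close>

lemma Ck_on_indicator_mult:
  assumes U: "open U" and C: "closed C" "C \<subseteq> U"
    and "\<And>z. z \<in> U - C \<Longrightarrow> f z = 0" "Ck_on k UNIV f"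
  shows "Ck_on k UNIV (\<lambda>z. indicator U z * f z)"
  using assms(4,5)
proof (induction k arbitrary: f)
  case 0
  then show ?case
    using continuous_on_indicator_mult[OF U C, of f] by (auto intro: continuous_on_subset)
next
  case (Suc k)
  have eq: "partial_deriv b (\<lambda>z. indicator U z * f z) = (\<lambda>z. indicator U z * partial_deriv b f z)" for b
    using partial_deriv_indicator[OF U C Suc.prems(1)] by (simp add: fun_eq_iff)
  have "partial_deriv b f z = 0" if "z \<in> U - C" for z b
    using partial_deriv_cong_open(1)[of "U - C" z f "\<lambda>_. 0"] U C that Suc.prems(1) by auto
  then have "Ck_on k UNIV (partial_deriv b (\<lambda>z. indicator U z * f z))" if "b \<in> Basis" for b
    unfolding eq using Suc.IH[of "partial_deriv b f"] Suc.prems(2) that by simp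
  moreover have "(\<lambda>z. indicator U z * f z) differentiable (at z)" for z
  proof (cases "z \<in> U")
    case True
    have "f differentiable (at z)" using Suc.prems(2) by simp
    then show ?thesis
      using partial_deriv_cong_open(2)[OF U True, of "\<lambda>z. indicator U z * f z" f] by simp
  next
    case False
    then show ?thesis
      using partial_deriv_cong_open(2)[of "- C" z "\<lambda>z. indicator U z * f z" "\<lambda>_. 0"] C Suc.prems(1)
      by (auto simp: indicator_def)
  qed
  ultimately show ?case by simp
qed

text \<open>The support splits without a smooth cutoff: \<open>K \<inter> U = K - V\<close> is
  compact because \<open>V\<close> is open.\<close>

lemma test_function_disjoint_Un:
  fixes f :: "real \<times> 'b::euclidean_space \<Rightarrow> real"
  assumes f: "test_function (U \<union> V) f" and U: "open U" "open V" "U \<inter> V = {}"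
  shows "test_function U (\<lambda>z. indicator U z * f z)"
    "D_t (\<lambda>z. indicator U z * f z) = (\<lambda>z. indicator U z * D_t f z)"
proof -
  obtain K where K: "compact K" "K \<subseteq> U \<union> V" "\<And>z. z \<notin> K \<Longrightarrow> f z = 0"
    and s: "smooth_fun_on UNIV f"
    using f by (auto simp: test_function_def)
  have "K \<inter> U = K - V" using K U by auto
  then have C: "compact (K \<inter> U)" using K U by (auto intro: compact_diff)
  have f0: "\<And>z. z \<in> U - (K \<inter> U) \<Longrightarrow> f z = 0" using K by auto
  note C' = U(1) compact_imp_closed[OF C] Int_lower2
  have "smooth_fun_on UNIV (\<lambda>z. indicator U z * f z)"
    unfolding smooth_fun_on_def
  proof
    fix k
    show "Ck_on k UNIV (\<lambda>z. indicator U z * f z)"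
      by (rule Ck_on_indicator_mult[OF C' f0]) (use s in \<open>auto simp: smooth_fun_on_def\<close>)
  qed
  then show t: "test_function U (\<lambda>z. indicator U z * f z)"
    unfolding test_function_def using C K by (auto intro!: exI[of _ "K \<inter> U"] simp: indicator_def)
  show "D_t (\<lambda>z. indicator U z * f z) = (\<lambda>z. indicator U z * D_t f z)"
    unfolding D_t_test_function(1)[OF t] D_t_test_function(1)[OF f]
    by (rule ext, rule partial_deriv_indicator[OF C' f0])
qed

section \<open>The branches of the reaction function\<close>

text \<open>The monotonicity of the reaction function is given on open intervals; this adds an
  endpoint. A limit alone would give only \<open>F x \<le> F a\<close>, so a point \<open>y\<close>
  strictly between is interposed: \<open>F x < F y \<le> F a\<close>.\<close>

lemma strict_increase_to_endpoint:
  fixes F :: "real \<Rightarrow> real"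
  assumes F: "isCont F a" and x: "x < a" and mono: "\<And>y. x < y \<Longrightarrow> y < a \<Longrightarrow> F x < F y"
    and mono': "\<And>y z. x < y \<Longrightarrow> y < z \<Longrightarrow> z < a \<Longrightarrow> F y < F z"
  shows "F x < F a"
proof -
  define y where "y = (x + a) / 2"
  have y: "x < y" "y < a" using x by (auto simp: y_def)
  have "(F \<longlongrightarrow> F a) (at_left a)"
    using F by (simp add: isCont_def filterlim_at_split)
  moreover have "eventually (\<lambda>z. F y \<le> F z) (at_left a)"
    using eventually_at_left_real[OF y(2)] by eventually_elim (use y mono' in \<open>auto intro: less_imp_le\<close>)
  ultimately have "F y \<le> F a" by (intro tendsto_lowerbound[of F "F a" "at_left a"]) auto
  then show ?thesis using mono[OF y] by simp
qed

text \<open>The reflection \<open>s \<mapsto> - F (- s)\<close> turns the left endpoint into a right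
  one.\<close>

lemma strict_increase_from_endpoint:
  fixes F :: "real \<Rightarrow> real"
  assumes F: "isCont F a" and x: "a < x" and mono: "\<And>y. a < y \<Longrightarrow> y < x \<Longrightarrow> F y < F x"
    and mono': "\<And>y z. a < y \<Longrightarrow> y < z \<Longrightarrow> z < x \<Longrightarrow> F y < F z"
  shows "F a < F x"
proof -
  have "isCont (\<lambda>s. F (- s)) (- a)"
    using isCont_o2[of "- a" uminus F] F by simp
  then have c: "isCont (\<lambda>s. - F (- s)) (- a)" by (rule isCont_minus)
  have "- F (- (- x)) < - F (- (- a))"
  proof (rule strict_increase_to_endpoint[where F = "\<lambda>s. - F (- s)", OF c])
    show "- F (- (- x)) < - F (- y)" if "- x < y" "y < - a" for y
      using mono[of "- y"] that by simp
    show "- F (- y) < - F (- z)" if "- x < y" "y < z" "z < - a" for y z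
      using mono'[of "- z" "- y"] that by simp
  qed (use x in simp)
  then show ?thesis by simp
qed

lemma borel_measurable_antimono:
  fixes f :: "real \<Rightarrow> real"
  assumes "antimono f"
  shows "f \<in> borel_measurable borel"
proof -
  have "mono (\<lambda>x. - f x)" using assms by (auto simp: mono_def antimono_def)
  then have "(\<lambda>x. - (- f x)) \<in> borel_measurable borel"
    by (intro borel_measurable_uminus borel_measurable_mono)
  then show ?thesis by simp
qed

text \<open>The bump of the overview. Its primitive needs continuity and the error terms need
  Lipschitz constant 1, so a piecewise linear function suffices; it is positive exactly on the open
  interval.\<close>

definition tent :: "real \<Rightarrow> real \<Rightarrow> real \<Rightarrow> real" where
  "tent a b r = max 0 (min (r - a) (b - r))"

lemma tent_lipschitz: "\<bar>tent a b r - tent a b s\<bar> \<le> \<bar>r - s\<bar>"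
  unfolding tent_def by linarith

lemma tent_bounds: "0 \<le> tent a b r" "\<bar>tent a b r\<bar> \<le> \<bar>b - a\<bar>"
  unfolding tent_def by linarith+

lemma tent_pos: "a < r \<Longrightarrow> r < b \<Longrightarrow> tent a b r > 0"
  and tent_eq_0: "r \<le> a \<or> b \<le> r \<Longrightarrow> tent a b r = 0"
  unfolding tent_def by (auto simp: max_def min_def)

lemma continuous_tent: "continuous_on S (tent a b)"
  unfolding tent_def by (intro continuous_intros)

lemma ex_antiderivative:
  fixes f :: "real \<Rightarrow> real"
  assumes "continuous_on UNIV f"
  obtains G where "\<And>x. (G has_real_derivative f x) (at x)"
proof -
  have "\<exists>G. \<forall>x. -\<infinity> < ereal x \<longrightarrow> ereal x < \<infinity> \<longrightarrow> (G has_vector_derivative f x) (at x)"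
    by (rule einterval_antiderivative)
       (use assms in \<open>auto simp: continuous_on_eq_continuous_at\<close>)
  then show thesis using that by (auto simp: has_real_derivative_iff_has_vector_derivative)
qed

lemma antiderivative_const:
  fixes G f :: "real \<Rightarrow> real"
  assumes G: "\<And>x. (G has_real_derivative f x) (at x)"
    and f0: "\<And>z. min x y \<le> z \<Longrightarrow> z \<le> max x y \<Longrightarrow> f z = 0"
  shows "G x = G y"
proof -
  have "\<exists>c. \<forall>z\<in>{min x y..max x y}. G z = c"
  proof (rule has_field_derivative_zero_constant)
    fix z assume "z \<in> {min x y..max x y}"
    then show "(G has_real_derivative 0) (at z within {min x y..max x y})"
      using has_field_derivative_at_within[OF G[of z]] f0[of z] by simp
  qed simp
  then obtain c where "\<And>z. z \<in> {min x y..max x y} \<Longrightarrow> G z = c" by blast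
  from this[of x] this[of y] show ?thesis by auto
qed

section \<open>Turning points and the extended inverses of the reaction function\<close>

locale reaction =
  fixes F :: "real \<Rightarrow> real" and am ap bm bp :: real
  assumes reaction: "reaction_function F am ap bm bp"
begin

lemma order: "0 < am" "am < ap" "ap < bm" "bm < bp" and Fam: "F am = F bm" and Fbp: "F bp = F ap"
  and F0: "F 0 = 0"
  using reaction unfolding reaction_function_def by simp_all

lemma F_isCont: "isCont F x"
proof -
  have "F C1_differentiable_on UNIV" using reaction unfolding reaction_function_def by blast
  then show ?thesis
    using C1_differentiable_imp_continuous_on[of F UNIV] by (simp add: continuous_on_eq_continuous_at)
qed

lemma F_cont: "continuous_on S F"
  by (simp add: F_isCont continuous_at_imp_continuous_on)

lemma F_measurable: "F \<in> borel_measurable borel"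
  by (rule borel_measurable_continuous_onI) (rule F_cont)

lemma F_left: "x < y \<Longrightarrow> y \<le> ap \<Longrightarrow> F x < F y"
proof -
  assume xy: "x < y" "y \<le> ap"
  have "strict_mono_on {..<ap} F" using reaction unfolding reaction_function_def by blast
  then have m: "u < w \<Longrightarrow> w < ap \<Longrightarrow> F u < F w" for u w
    by (rule strict_mono_onD) auto
  show ?thesis
  proof (cases "y = ap")
    case True
    show ?thesis unfolding True
    proof (rule strict_increase_to_endpoint[where F = F, OF F_isCont])
      show "x < ap" using xy True by simp
    qed (rule m; assumption)+
  next
    case False
    then show ?thesis using xy by (intro m) simp_all
  qed
qed

lemma F_right: "bm \<le> x \<Longrightarrow> x < y \<Longrightarrow> F x < F y"
proof -
  assume xy: "bm \<le> x" "x < y"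
  have "strict_mono_on {bm<..} F" using reaction unfolding reaction_function_def by blast
  then have m: "bm < u \<Longrightarrow> u < w \<Longrightarrow> F u < F w" for u w
    by (rule strict_mono_onD) auto
  show ?thesis
  proof (cases "x = bm")
    case True
    show ?thesis unfolding True
    proof (rule strict_increase_from_endpoint[where F = F, OF F_isCont])
      show "bm < y" using xy True by simp
    qed (rule m; assumption)+
  next
    case False
    then show ?thesis using xy by (intro m) simp_all
  qed
qed

lemma F_mid: "ap \<le> x \<Longrightarrow> x < y \<Longrightarrow> y \<le> bm \<Longrightarrow> F y < F x"
proof -
  assume xy: "ap \<le> x" "x < y" "y \<le> bm"
  have "strict_antimono_on {ap<..<bm} F" using reaction unfolding reaction_function_def by blast
  then have m: "ap < u \<Longrightarrow> u < w \<Longrightarrow> w < bm \<Longrightarrow> F w < F u" for u w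
    by (rule monotone_onD) auto
  have c: "isCont (\<lambda>x. - F x) x" for x using F_isCont by (intro continuous_intros)
  \<comment> \<open>Stated up to and including \<open>bm\<close>, so that adding the left endpoint
    \<open>ap\<close> can use comparisons that already reach the right endpoint.\<close>
  have 1: "F w < F u" if "ap < u" "u < w" "w \<le> bm" for u w
  proof (cases "w = bm")
    case True
    have "- F u < - F bm"
    proof (rule strict_increase_to_endpoint[where F = "\<lambda>x. - F x", OF c])
      show "u < bm" using that True by simp
    qed (use that(1) m in \<open>simp_all\<close>)
    then show ?thesis using True by simp
  next
    case False
    then show ?thesis using that by (intro m) simp_all
  qed
  show ?thesis
  proof (cases "x = ap")
    case True
    have "- F ap < - F y"
    proof (rule strict_increase_from_endpoint[where F = "\<lambda>x. - F x", OF c])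
      show "ap < y" using xy True by simp
    qed (use xy(3) 1 in \<open>simp_all\<close>)
    then show ?thesis using True by simp
  next
    case False
    then show ?thesis using xy by (intro 1) simp_all
  qed
qed

lemma F_am_less: "F bm < F ap" "0 < F bm"
  using F_left[of am ap] F_left[of 0 am] order Fam F0 by auto

lemma S1_less: assumes "r < F ap" shows "S1 F ap r < ap" "F (S1 F ap r) = r"
proof -
  have inj: "inj_on F {..<ap}"
    by (rule linorder_inj_onI') (use F_left in \<open>simp add: less_imp_neq\<close>)
  have "\<exists>x\<le>ap. F x = r"
  proof -
    have "filterlim F at_bot at_bot" using reaction unfolding reaction_function_def by blast
    then have "eventually (\<lambda>x. F x < r) at_bot" by (simp add: filterlim_at_bot_dense)
    then obtain x0 where "\<And>x. x \<le> x0 \<Longrightarrow> F x < r" by (auto simp: eventually_at_bot_linorder)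
    then have "F (min x0 ap) \<le> r" by (simp add: less_imp_le)
    from IVT'[OF this _ _ F_cont, of ap] show ?thesis using assms by auto
  qed
  then obtain x where x: "x \<le> ap" "F x = r" by blast
  then have "x \<in> {..<ap}" using assms by (cases "x = ap") auto
  then have "S1 F ap r = x" "x < ap"
    using the_inv_into_f_eq[OF inj x(2)] assms by (simp_all add: S1_def)
  then show "S1 F ap r < ap" "F (S1 F ap r) = r" using x(2) by simp_all
qed

text \<open>These two facts determine the extended inverse, because \<open>F\<close> is injective up
  to \<open>ap\<close>; the minimum encodes the constant extension. Analogous facts for the other
  branches let later arguments reason through \<open>F\<close>.\<close>

lemma S1_le: "S1 F ap r \<le> ap" and F_S1: "F (S1 F ap r) = min r (F ap)"
proof -
  have "S1 F ap r \<le> ap \<and> F (S1 F ap r) = min r (F ap)"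
  proof (cases "r < F ap")
    case True
    then show ?thesis using S1_less[OF True] by (simp add: min_def)
  qed (simp add: S1_def min_def)
  then show "S1 F ap r \<le> ap" "F (S1 F ap r) = min r (F ap)" by auto
qed

lemma S3_gt: assumes "F bm < r" shows "bm < S3 F bm r" "F (S3 F bm r) = r"
proof -
  have inj: "inj_on F {bm<..}"
    by (rule linorder_inj_onI') (use F_right in \<open>simp add: less_imp_neq\<close>)
  have "\<exists>x\<ge>bm. F x = r"
  proof -
    have "filterlim F at_top at_top" using reaction unfolding reaction_function_def by blast
    then have "eventually (\<lambda>x. F x > r) at_top" by (simp add: filterlim_at_top_dense)
    then obtain x0 where "\<And>x. x \<ge> x0 \<Longrightarrow> F x > r" by (auto simp: eventually_at_top_linorder)
    then have "F (max x0 bm) \<ge> r" by (simp add: less_imp_le)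
    from IVT'[OF _ this _ F_cont, of bm] show ?thesis using assms by auto
  qed
  then obtain x where x: "bm \<le> x" "F x = r" by blast
  then have "x \<in> {bm<..}" using assms by (cases "x = bm") auto
  then have "S3 F bm r = x" "bm < x"
    using the_inv_into_f_eq[OF inj x(2)] assms by (simp_all add: S3_def)
  then show "bm < S3 F bm r" "F (S3 F bm r) = r" using x(2) by simp_all
qed

lemma S3_ge: "bm \<le> S3 F bm r" and F_S3: "F (S3 F bm r) = max r (F bm)"
proof -
  have "bm \<le> S3 F bm r \<and> F (S3 F bm r) = max r (F bm)"
  proof (cases "F bm < r")
    case True
    then show ?thesis using S3_gt[OF True] by (simp add: max_def)
  qed (simp add: S3_def max_def)
  then show "bm \<le> S3 F bm r" "F (S3 F bm r) = max r (F bm)" by auto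
qed

lemma S2_bounds: "ap \<le> S2 F ap bm r" "S2 F ap bm r \<le> bm"
  and F_S2: "F (S2 F ap bm r) = max (F bm) (min r (F ap))"
proof -
  have "ap \<le> S2 F ap bm r \<and> S2 F ap bm r \<le> bm \<and> F (S2 F ap bm r) = max (F bm) (min r (F ap))"
  proof (cases "F bm < r \<and> r < F ap")
    case True
    have inj: "inj_on F {ap<..<bm}"
      by (rule linorder_inj_onI') (use F_mid in \<open>simp add: less_imp_neq[symmetric]\<close>)
    have "\<exists>x\<ge>ap. x \<le> bm \<and> F x = r"
      using IVT2'[OF _ _ _ F_cont, of bm r ap] True order by auto
    then obtain x where x: "ap \<le> x" "x \<le> bm" "F x = r" by blast
    then have "x \<in> {ap<..<bm}" using True by (cases "x = ap"; cases "x = bm") auto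
    then have "S2 F ap bm r = x"
      using the_inv_into_f_eq[OF inj x(3)] True by (simp add: S2_def)
    then show ?thesis using x True by (simp add: max_def min_def)
  qed (use order F_am_less in \<open>auto simp: S2_def\<close>)
  then show "ap \<le> S2 F ap bm r" "S2 F ap bm r \<le> bm" "F (S2 F ap bm r) = max (F bm) (min r (F ap))"
    by auto
qed

text \<open>If a branch inverse failed to be monotone, strict monotonicity of \<open>F\<close> on
  that branch would contradict the order of the clamped values. This covers the constant extensions
  as well, and monotone functions are Borel.\<close>

lemma S_measurable [measurable]:
  "S1 F ap \<in> borel_measurable borel" "S2 F ap bm \<in> borel_measurable borel" "S3 F bm \<in> borel_measurable borel"
proof -
  have "mono (S1 F ap)"
  proof (rule monoI, rule ccontr)
    fix r s :: real assume "r \<le> s" "\<not> S1 F ap r \<le> S1 F ap s"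
    then show False using F_left[of "S1 F ap s" "S1 F ap r"] S1_le[of r] F_S1[of r] F_S1[of s] by auto
  qed
  then show "S1 F ap \<in> borel_measurable borel" by (rule borel_measurable_mono)
  have "mono (S3 F bm)"
  proof (rule monoI, rule ccontr)
    fix r s :: real assume "r \<le> s" "\<not> S3 F bm r \<le> S3 F bm s"
    then show False using F_right[of "S3 F bm s" "S3 F bm r"] S3_ge[of s] F_S3[of r] F_S3[of s] by auto
  qed
  then show "S3 F bm \<in> borel_measurable borel" by (rule borel_measurable_mono)
  have "antimono (S2 F ap bm)"
  proof (rule antimonoI, rule ccontr)
    fix r s :: real assume "r \<le> s" "\<not> S2 F ap bm s \<le> S2 F ap bm r"
    then show False using F_mid[of "S2 F ap bm r" "S2 F ap bm s"] S2_bounds[of r] S2_bounds[of s] F_S2[of r] F_S2[of s]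
      by (auto simp: max_def min_def split: if_splits)
  qed
  then show "S2 F ap bm \<in> borel_measurable borel" by (rule borel_measurable_antimono)
qed

text \<open>Each of the two inner intervals contains a turning point, and the claim is split there:
  \<open>F\<close> rises from the level \<open>v\<close> up to \<open>ap\<close>, falls back to
  \<open>v\<close> at the second branch value, falls further to \<open>bm\<close> and returns to
  \<open>v\<close> at the third.\<close>

lemma F_sign:
  assumes v: "F bm < v" "v < F ap"
  shows "l < S1 F ap v \<Longrightarrow> F l < v" "S1 F ap v < l \<Longrightarrow> l < S2 F ap bm v \<Longrightarrow> v < F l"
    "S2 F ap bm v < l \<Longrightarrow> l < S3 F bm v \<Longrightarrow> F l < v" "S3 F bm v < l \<Longrightarrow> v < F l"
proof -
  have F: "F (S1 F ap v) = v" "F (S2 F ap bm v) = v" "F (S3 F bm v) = v"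
    using v F_S1 F_S2 F_S3 by auto
  note b = S1_le[of v] S2_bounds[of v] S3_ge[of v]
  show "F l < v" if "l < S1 F ap v" using F_left[of l "S1 F ap v"] that F b by auto
  show "v < F l" if "S3 F bm v < l" using F_right[of "S3 F bm v" l] that F b by auto
  show "v < F l" if "S1 F ap v < l" "l < S2 F ap bm v"
    using F_left[of "S1 F ap v" l] F_mid[of l "S2 F ap bm v"] that F b by (cases "l \<le> ap") auto
  show "F l < v" if "S2 F ap bm v < l" "l < S3 F bm v"
    using F_mid[of "S2 F ap bm v" l] F_right[of l "S3 F bm v"] that F b by (cases "l \<le> bm") auto
qed

lemma S_order: "S1 F ap v \<le> S2 F ap bm v" "S2 F ap bm v \<le> S3 F bm v" "F bm < v \<Longrightarrow> 0 < S1 F ap v"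
proof -
  show "S1 F ap v \<le> S2 F ap bm v" "S2 F ap bm v \<le> S3 F bm v"
    using S1_le[of v] S2_bounds[of v] S3_ge[of v] by auto
  show "0 < S1 F ap v" if "F bm < v"
    using F_S1[of v] F_left[of "S1 F ap v" 0] F0 F_am_less order that
    by (cases "S1 F ap v" "0::real" rule: linorder_cases) (auto simp: min_def split: if_splits)
qed

text \<open>\<open>am\<close> and \<open>bp\<close> are the outer preimages of the critical levels,
  hence enclose every point whose value lies between these levels. This is the source of compactness
  in the variable \<open>\<lambda>\<close>.\<close>

lemma F_range: "F l \<le> F ap \<Longrightarrow> l \<le> bp" "F bm \<le> F l \<Longrightarrow> am \<le> l"
  using F_right[of bp l] F_left[of l am] order Fam Fbp by (fastforce simp: not_le[symmetric])+

section \<open>Primitives of tents composed with \<open>F\<close>\<close>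

lemma F_mono_left: "x \<le> y \<Longrightarrow> y \<le> ap \<Longrightarrow> F x \<le> F y"
  using F_left[of x y] by (cases "x = y") auto

lemma F_mono_right: "bm \<le> x \<Longrightarrow> x \<le> y \<Longrightarrow> F x \<le> F y"
  using F_right[of x y] by (cases "x = y") auto

lemma F_anti_mid: "ap \<le> x \<Longrightarrow> x \<le> y \<Longrightarrow> y \<le> bm \<Longrightarrow> F y \<le> F x"
  using F_mid[of x y] by (cases "x = y") auto

text \<open>Left of \<open>am\<close> and right of \<open>bp\<close> the values of \<open>F\<close>
  are outside the critical interval, so the primitive is constant there; in between it is bounded by
  compactness. Boundedness is what admits \<open>A\<close> as a test of the Young measure.\<close>

lemma bounded_tent_primitive:
  assumes A: "\<And>w. (A has_real_derivative tent a b (F w)) (at w)" and ab: "F bm \<le> a" "b \<le> F ap"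
  shows "bounded (range A)"
proof -
  have "A w \<in> A ` {am..bp}" for w
  proof -
    have "A w = A am" if "w \<le> am"
    proof (rule antiderivative_const[OF A], rule tent_eq_0)
      fix z assume "min w am \<le> z" "z \<le> max w am"
      then show "F z \<le> a \<or> b \<le> F z" using F_mono_left[of z am] that ab Fam order by auto
    qed
    moreover have "A w = A bp" if "bp \<le> w"
    proof (rule antiderivative_const[OF A], rule tent_eq_0)
      fix z assume "min w bp \<le> z" "z \<le> max w bp"
      then show "F z \<le> a \<or> b \<le> F z" using F_mono_right[of bp z] that ab Fbp order by auto
    qed
    ultimately show ?thesis
      using order by (cases "w \<le> am"; cases "bp \<le> w") auto
  qed
  moreover have "bounded (A ` {am..bp})"
    by (intro compact_imp_bounded compact_continuous_image continuous_at_imp_continuous_on ballI DERIV_isCont[OF A]) auto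
  ultimately show ?thesis by (meson bounded_subset image_subsetI)
qed

text \<open>The tent lies above the level \<open>m\<close>. The segments from \<open>S1 r\<close> to
  \<open>S1 m\<close> and from \<open>S2 r\<close> through \<open>bm\<close> to \<open>S3 r\<close>
  stay at or below \<open>m\<close>, so \<open>A\<close> does not change on them. The constant
  \<open>c\<close> is the increase over the hump between \<open>S1 m\<close> and \<open>bm\<close>,
  positive because \<open>F\<close> crosses the whole tent on the way up to
  \<open>ap\<close>.\<close>

lemma tent_primitive_below:
  assumes m: "F bm \<le> m" "m < F ap"
    and A: "\<And>w. (A has_real_derivative tent m (F ap) (F w)) (at w)"
  obtains c a where "c > 0" "\<And>r. r \<le> m \<Longrightarrow> A (S1 F ap r) = a \<and> A (S2 F ap bm r) = a + c \<and> A (S3 F bm r) = a + c"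
proof -
  have S1: "A (S1 F ap r) = A (S1 F ap m)" if "r \<le> m" for r
  proof (rule antiderivative_const[OF A], rule tent_eq_0)
    fix z assume z: "min (S1 F ap r) (S1 F ap m) \<le> z" "z \<le> max (S1 F ap r) (S1 F ap m)"
    show "F z \<le> m \<or> F ap \<le> F z"
      using F_mono_left[of z "max (S1 F ap r) (S1 F ap m)"] z S1_le[of r] S1_le[of m] F_S1[of r] F_S1[of m] m that
      by (auto simp: max_def split: if_splits)
  qed
  have S2: "A (S2 F ap bm r) = A bm" if "r \<le> m" for r
  proof (rule antiderivative_const[OF A], rule tent_eq_0)
    fix z assume z: "min (S2 F ap bm r) bm \<le> z" "z \<le> max (S2 F ap bm r) bm"
    show "F z \<le> m \<or> F ap \<le> F z"
      using F_anti_mid[of "S2 F ap bm r" z] z S2_bounds[of r] F_S2[of r] m that by auto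
  qed
  have S3: "A (S3 F bm r) = A bm" if "r \<le> m" for r
  proof (rule antiderivative_const[OF A], rule tent_eq_0)
    fix z assume z: "min (S3 F bm r) bm \<le> z" "z \<le> max (S3 F bm r) bm"
    show "F z \<le> m \<or> F ap \<le> F z"
      using F_mono_right[of z "S3 F bm r"] z S3_ge[of r] F_S3[of r] m that by auto
  qed
  have "A (S1 F ap m) < A ap"
  proof (rule DERIV_pos_imp_increasing_open[where f = A])
    show "S1 F ap m < ap" using S1_less m by auto
    fix x assume x: "S1 F ap m < x" "x < ap"
    have "tent m (F ap) (F x) > 0"
      using F_left[of "S1 F ap m" x] F_left[of x ap] x S1_less[of m] m by (intro tent_pos) auto
    then show "\<exists>y. (A has_real_derivative y) (at x) \<and> 0 < y" using A by blast
  qed (use A in \<open>auto intro!: continuous_at_imp_continuous_on DERIV_isCont\<close>)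
  also have "A ap \<le> A bm"
    by (rule DERIV_nonneg_imp_nondecreasing[where f = A]) (use order in simp, use A tent_bounds(1) in blast)
  finally have pos: "A (S1 F ap m) < A bm" .
  show thesis
  proof (rule that)
    show "0 < A bm - A (S1 F ap m)" using pos by simp
    fix r assume "r \<le> m"
    from S1[OF this] S2[OF this] S3[OF this]
    show "A (S1 F ap r) = A (S1 F ap m) \<and> A (S2 F ap bm r) = A (S1 F ap m) + (A bm - A (S1 F ap m))
        \<and> A (S3 F bm r) = A (S1 F ap m) + (A bm - A (S1 F ap m))" by linarith
  qed
qed

text \<open>The reflected situation, with the tent below \<open>m\<close>. The segment from
  \<open>S1 r\<close> through \<open>ap\<close> to \<open>S2 r\<close> stays at or above
  \<open>m\<close>, which identifies the first two values; \<open>c\<close> is the increase over the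
  dip between \<open>S2 m\<close> and \<open>S3 m\<close>.\<close>

lemma tent_primitive_above:
  assumes m: "F bm < m" "m \<le> F ap"
    and A: "\<And>w. (A has_real_derivative tent (F bm) m (F w)) (at w)"
  obtains c a where "c > 0" "\<And>r. m \<le> r \<Longrightarrow> A (S1 F ap r) = a \<and> A (S2 F ap bm r) = a \<and> A (S3 F bm r) = a + c"
proof -
  have S1: "A (S1 F ap r) = A ap" if "m \<le> r" for r
  proof (rule antiderivative_const[OF A], rule tent_eq_0)
    fix z assume z: "min (S1 F ap r) ap \<le> z" "z \<le> max (S1 F ap r) ap"
    show "F z \<le> F bm \<or> m \<le> F z"
      using F_mono_left[of "S1 F ap r" z] z S1_le[of r] F_S1[of r] m that by auto
  qed
  have S2: "A (S2 F ap bm r) = A ap" if "m \<le> r" for r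
  proof (rule antiderivative_const[OF A], rule tent_eq_0)
    fix z assume z: "min (S2 F ap bm r) ap \<le> z" "z \<le> max (S2 F ap bm r) ap"
    show "F z \<le> F bm \<or> m \<le> F z"
      using F_anti_mid[of z "S2 F ap bm r"] z S2_bounds[of r] F_S2[of r] m that by auto
  qed
  have S3: "A (S3 F bm r) = A (S3 F bm m)" if "m \<le> r" for r
  proof (rule antiderivative_const[OF A], rule tent_eq_0)
    fix z assume z: "min (S3 F bm r) (S3 F bm m) \<le> z" "z \<le> max (S3 F bm r) (S3 F bm m)"
    show "F z \<le> F bm \<or> m \<le> F z"
      using F_mono_right[of "min (S3 F bm r) (S3 F bm m)" z] z S3_ge[of r] S3_ge[of m] F_S3[of r] F_S3[of m] m that
      by (auto simp: min_def split: if_splits)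
  qed
  have FS2: "F (S2 F ap bm m) = m" using F_S2[of m] m by auto
  have "A (S2 F ap bm m) < A bm"
  proof (rule DERIV_pos_imp_increasing_open[where f = A])
    show "S2 F ap bm m < bm" using S2_bounds[of m] FS2 m by (cases "S2 F ap bm m = bm") auto
    fix x assume x: "S2 F ap bm m < x" "x < bm"
    have "tent (F bm) m (F x) > 0"
      using F_mid[of "S2 F ap bm m" x] F_mid[of x bm] x S2_bounds[of m] FS2 by (intro tent_pos) auto
    then show "\<exists>y. (A has_real_derivative y) (at x) \<and> 0 < y" using A by blast
  qed (use A in \<open>auto intro!: continuous_at_imp_continuous_on DERIV_isCont\<close>)
  also have "A bm \<le> A (S3 F bm m)"
    by (rule DERIV_nonneg_imp_nondecreasing[where f = A]) (use S3_ge in simp, use A tent_bounds(1) in blast)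
  finally have pos: "A ap < A (S3 F bm m)" using S2[of m] by simp
  show thesis
  proof (rule that)
    show "0 < A (S3 F bm m) - A ap" using pos by simp
    fix r assume "m \<le> r"
    from S1[OF this] S2[OF this] S3[OF this]
    show "A (S1 F ap r) = A ap \<and> A (S2 F ap bm r) = A ap
        \<and> A (S3 F bm r) = A ap + (A (S3 F bm m) - A ap)" by linarith
  qed
qed

end

section \<open>Weak limits\<close>

lemma integral_three_atoms:
  assumes P: "prob_space \<mu>" "sets \<mu> = sets borel" and G: "G \<in> borel_measurable borel"
    and \<mu>: "\<forall>A\<in>sets borel. measure \<mu> A = l1 * indicator A s1 + l2 * indicator A s2 + l3 * indicator A (s3 :: real)"
  shows "(\<integral>s. G s \<partial>\<mu>) = l1 * G s1 + l2 * G s2 + l3 * (G s3 :: real)"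
proof -
  interpret prob_space \<mu> by (rule P(1))
  \<comment> \<open>A set of points, because atoms coincide at and beyond the critical levels.
    Summing over distinct points and letting the indicators in \<open>\<mu>\<close> split the mass
    again covers these cases uniformly.\<close>
  define X where "X = {s1, s2, s3}"
  have X: "X \<in> sets borel" "finite X" by (auto simp: X_def)
  have sp: "space \<mu> = UNIV" using sets_eq_imp_space_eq[OF P(2)] by simp
  have "measure \<mu> (- X) = 0" using \<mu> X by (auto simp: X_def)
  then have "AE s in \<mu>. s \<notin> - X"
    using X P(2) by (intro AE_not_in) (simp add: null_sets_def emeasure_eq_measure)
  moreover have "G s = (\<Sum>x\<in>X. G x * indicator {x} s)" if "s \<notin> - X" for s
  proof -
    have "(\<Sum>x\<in>X. G x * indicator {x} s) = (\<Sum>x\<in>X. if s = x then G x else 0)"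
      by (intro sum.cong) (auto simp: indicator_def)
    then show ?thesis using that X(2) by simp
  qed
  ultimately have "AE s in \<mu>. G s = (\<Sum>x\<in>X. G x * indicator {x} s)"
    by (auto elim: eventually_mono)
  moreover have "G \<in> borel_measurable \<mu>"
    using G by (simp add: measurable_cong_sets[OF P(2) refl])
  moreover have i: "indicator {x} \<in> borel_measurable \<mu>" for x
    by (intro borel_measurable_indicator) (simp add: P(2))
  ultimately have "(\<integral>s. G s \<partial>\<mu>) = (\<integral>s. (\<Sum>x\<in>X. G x * indicator {x} s) \<partial>\<mu>)"
    by (intro integral_cong_AE borel_measurable_sum borel_measurable_times borel_measurable_const)
  also have "\<dots> = (\<Sum>x\<in>X. \<integral>s. G x * indicator {x} s \<partial>\<mu>)"
    by (intro Bochner_Integration.integral_sum integrable_mult_right integrable_real_indicator)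
       (simp_all add: P(2) less_top[symmetric])
  also have "\<dots> = (\<Sum>x\<in>X. G x * measure \<mu> {x})"
    by (intro sum.cong refl) (simp add: P(2) sp)
  also have "\<dots> = (\<Sum>x\<in>X. l1 * (if s1 = x then G x else 0) + l2 * (if s2 = x then G x else 0)
      + l3 * (if s3 = x then G x else 0))"
  proof (intro sum.cong refl)
    fix x
    have "measure \<mu> {x} = l1 * indicator {x} s1 + l2 * indicator {x} s2 + l3 * indicator {x} s3"
      using \<mu> by simp
    then show "G x * measure \<mu> {x} = l1 * (if s1 = x then G x else 0) + l2 * (if s2 = x then G x else 0)
      + l3 * (if s3 = x then G x else 0)" by (simp add: indicator_def algebra_simps)
  qed
  also have "\<dots> = l1 * G s1 + l2 * G s2 + l3 * G s3"
    unfolding sum.distrib sum_distrib_left[symmetric] sum.delta'[OF X(2)] by (simp add: X_def)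
  finally show ?thesis .
qed

text \<open>Cauchy-Schwarz in squared form, carried out in the extended nonnegative reals, where it
  applies before anything is known to be integrable. A nonintegrable \<open>f k\<close> contributes
  the default value 0.\<close>

lemma integral_tendsto_0_L2:
  fixes f w g :: "nat \<Rightarrow> 'a \<Rightarrow> real"
  assumes [measurable]: "\<And>k. w k \<in> borel_measurable M" "\<And>k. g k \<in> borel_measurable M"
    and w: "(\<lambda>k. \<integral>\<^sup>+ z. ennreal ((w k z)\<^sup>2) \<partial>M) \<longlonglongrightarrow> 0"
    and g: "\<And>k. (\<integral>\<^sup>+ z. ennreal ((g k z)\<^sup>2) \<partial>M) \<le> ennreal C"
    and f: "\<And>k. AE z in M. \<bar>f k z\<bar> \<le> B * (\<bar>w k z\<bar> * \<bar>g k z\<bar>)" and B: "0 \<le> B"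
  shows "(\<lambda>k. \<integral>z. f k z \<partial>M) \<longlonglongrightarrow> 0"
proof -
  have bd: "ennreal ((\<integral>z. f k z \<partial>M)\<^sup>2) \<le> ennreal (B\<^sup>2) * ennreal C * (\<integral>\<^sup>+ z. ennreal ((w k z)\<^sup>2) \<partial>M)" for k
  proof -
    have "ennreal \<bar>\<integral>z. f k z \<partial>M\<bar> \<le> (\<integral>\<^sup>+ z. ennreal \<bar>f k z\<bar> \<partial>M)"
      using integral_norm_bound_ennreal[of M "f k"] by (cases "integrable M (f k)") (auto simp: not_integrable_integral_eq)
    also have "\<dots> \<le> (\<integral>\<^sup>+ z. ennreal B * (ennreal \<bar>w k z\<bar> * ennreal \<bar>g k z\<bar>) \<partial>M)"
      using f[of k] B by (intro nn_integral_mono_AE) (auto simp: ennreal_mult[symmetric] intro!: ennreal_leI)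
    also have "\<dots> = ennreal B * (\<integral>\<^sup>+ z. ennreal \<bar>w k z\<bar> * ennreal \<bar>g k z\<bar> \<partial>M)"
      by (intro nn_integral_cmult) auto
    finally have "(ennreal \<bar>\<integral>z. f k z \<partial>M\<bar>)\<^sup>2 \<le> (ennreal B * (\<integral>\<^sup>+ z. ennreal \<bar>w k z\<bar> * ennreal \<bar>g k z\<bar> \<partial>M))\<^sup>2"
      by (intro power_mono) auto
    also have "\<dots> = (ennreal B)\<^sup>2 * (\<integral>\<^sup>+ z. ennreal \<bar>w k z\<bar> * ennreal \<bar>g k z\<bar> \<partial>M)\<^sup>2"
      by (simp add: power_mult_distrib)
    also have "\<dots> \<le> (ennreal B)\<^sup>2 * ((\<integral>\<^sup>+ z. (ennreal \<bar>w k z\<bar>)\<^sup>2 \<partial>M) * (\<integral>\<^sup>+ z. (ennreal \<bar>g k z\<bar>)\<^sup>2 \<partial>M))"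
      by (intro mult_left_mono Cauchy_Schwarz_nn_integral) auto
    also have "\<dots> = (ennreal B)\<^sup>2 * ((\<integral>\<^sup>+ z. ennreal ((w k z)\<^sup>2) \<partial>M) * (\<integral>\<^sup>+ z. ennreal ((g k z)\<^sup>2) \<partial>M))"
      by (simp add: ennreal_power)
    also have "\<dots> \<le> (ennreal B)\<^sup>2 * ((\<integral>\<^sup>+ z. ennreal ((w k z)\<^sup>2) \<partial>M) * ennreal C)"
      by (intro mult_left_mono g) auto
    finally show ?thesis using B by (simp add: ennreal_power ac_simps)
  qed
  have "(\<lambda>k. ennreal (B\<^sup>2) * ennreal C * (\<integral>\<^sup>+ z. ennreal ((w k z)\<^sup>2) \<partial>M)) \<longlonglongrightarrow> ennreal (B\<^sup>2) * ennreal C * 0"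
    by (intro ennreal_tendsto_cmult w) (simp add: ennreal_mult_less_top)
  then have lim: "(\<lambda>k. ennreal (B\<^sup>2) * ennreal C * (\<integral>\<^sup>+ z. ennreal ((w k z)\<^sup>2) \<partial>M)) \<longlonglongrightarrow> 0"
    by simp
  have "(\<lambda>k. ennreal ((\<integral>z. f k z \<partial>M)\<^sup>2)) \<longlonglongrightarrow> ennreal 0"
    unfolding ennreal_0
    by (rule tendsto_sandwich[OF always_eventually always_eventually tendsto_const lim]) (simp_all only: bd zero_le simp_thms)
  then have "(\<lambda>k. (\<integral>z. f k z \<partial>M)\<^sup>2) \<longlonglongrightarrow> 0" by (subst (asm) tendsto_ennreal_iff) auto
  then show ?thesis by simp
qed

lemma
  fixes f :: "'a::euclidean_space \<Rightarrow> real"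
  assumes S: "S \<in> sets lebesgue" and f: "(\<lambda>z. indicator S z * f z) \<in> borel_measurable borel"
  shows integral_lebesgue_on_eq_lborel: "integral\<^sup>L (lebesgue_on S) f = (\<integral>z. indicator S z * f z \<partial>lborel)"
    and integrable_lebesgue_on_iff_lborel:
      "integrable (lebesgue_on S) f \<longleftrightarrow> integrable lborel (\<lambda>z. indicator S z * f z)"
  using assms
  by (simp_all add: integral_restrict_space integrable_restrict_space integral_completion integrable_completion)

lemma
  fixes f :: "'a::euclidean_space \<Rightarrow> real"
  assumes S: "open S" and K: "compact K" "K \<subseteq> S" and f: "continuous_on S f"
    and f0: "\<And>z. z \<in> S - K \<Longrightarrow> f z = 0"
  shows integrable_lebesgue_on_compact_support: "integrable (lebesgue_on S) f"
    and integral_lebesgue_on_compact_support: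
      "integral\<^sup>L (lebesgue_on S) f = (\<integral>z. indicator S z * f z \<partial>lborel)"
proof -
  have c: "continuous_on UNIV (\<lambda>z. indicator S z * f z)"
    by (rule continuous_on_indicator_mult[OF S compact_imp_closed[OF K(1)] K(2) f0 f])
  have S': "S \<in> sets lebesgue" using S by simp
  note m = borel_measurable_continuous_onI[OF c]
  have "integrable lborel (\<lambda>z. indicator S z * f z)"
    by (rule integrable_compact_support[OF K(1) c]) (use f0 in \<open>auto simp: indicator_def\<close>)
  then show "integrable (lebesgue_on S) f"
    unfolding integrable_lebesgue_on_iff_lborel[OF S' m] .
  show "integral\<^sup>L (lebesgue_on S) f = (\<integral>z. indicator S z * f z \<partial>lborel)"
    by (rule integral_lebesgue_on_eq_lborel[OF S' m])
qed

text \<open>Because of the vanishing integral, a constant added to a coefficient of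
  \<open>D_t \<phi>\<close> leaves no trace; this removes the offsets of the primitives
  \<open>A\<close> and \<open>B\<close>.\<close>

lemma integral_D_t_test_function:
  fixes f :: "real \<times> 'b::euclidean_space \<Rightarrow> real"
  assumes f: "test_function W f" and W: "W \<subseteq> S" "open S"
  shows "integrable (lebesgue_on S) (D_t f)" "(\<integral>z. D_t f z \<partial>lebesgue_on S) = 0"
proof -
  have t: "test_function S (D_t f)"
    using D_t_test_function(2)[OF f] test_function_mono W by blast
  then obtain K where K: "compact K" "K \<subseteq> S" "\<And>z. z \<notin> K \<Longrightarrow> D_t f z = 0"
    by (auto simp: test_function_def)
  have c: "continuous_on S (D_t f)" using test_function_cont[OF t] continuous_on_subset by blast
  show "integrable (lebesgue_on S) (D_t f)"
    by (rule integrable_lebesgue_on_compact_support[OF W(2) K(1,2) c]) (use K in auto)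
  have "(\<integral>z. D_t f z \<partial>lebesgue_on S) = (\<integral>z. indicator S z * D_t f z \<partial>lborel)"
    by (rule integral_lebesgue_on_compact_support[OF W(2) K(1,2) c]) (use K in auto)
  also have "(\<lambda>z. indicator S z * D_t f z) = D_t f"
    using K by (auto simp: fun_eq_iff indicator_def)
  finally show "(\<integral>z. D_t f z \<partial>lebesgue_on S) = 0"
    using D_t_test_function(3)[OF f] by simp
qed

lemma test_function_bounded:
  assumes "test_function W f"
  obtains M where "M \<ge> 0" "\<And>z. \<bar>f z\<bar> \<le> M"
proof -
  obtain K where "compact K" "\<And>z. z \<notin> K \<Longrightarrow> f z = 0"
    using assms by (auto simp: test_function_def)
  from bounded_compact_support[OF this(1) test_function_cont[OF assms] this(2)] show thesis
    using that by blast
qed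

section \<open>The limit along the subsequence\<close>

text \<open>Holds what both parts share; the uniform bounds, available only in part (1), are added
  by an extension.\<close>

locale limit_system = reaction F am ap bm bp
  for F :: "real \<Rightarrow> real" and am ap bm bp :: real +
  fixes \<Omega> :: "'a::euclidean_space set" and T :: real and u0 v0 :: "'a \<Rightarrow> real"
    and u v :: "real \<Rightarrow> real \<times> 'a \<Rightarrow> real" and e :: "nat \<Rightarrow> real"
    and vlim :: "real \<times> 'a \<Rightarrow> real" and \<mu> :: "real \<times> 'a \<Rightarrow> real measure"
    and lam1 lam2 lam3 :: "real \<times> 'a \<Rightarrow> real" and D :: "(real \<times> 'a) set"
  assumes domain: "open \<Omega>" "bounded \<Omega>"
    and D_def: "D = {0<..<T} \<times> \<Omega>"
    and solution: "\<And>\<epsilon>. \<epsilon> \<in> {0<..<1} \<Longrightarrow> classical_solution F \<Omega> u0 v0 \<epsilon> (u \<epsilon>) (v \<epsilon>)"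
    and subseq: "\<And>k. e k \<in> {0<..<1}" "e \<longlonglongrightarrow> 0"
    and v_lim: "strong_L2_limit D (\<lambda>k. v (e k)) vlim"
    and young: "young_measure D (\<lambda>k. u (e k)) \<mu>"
    and lam_measurable [measurable]: "lam1 \<in> borel_measurable (lebesgue_on D)"
      "lam2 \<in> borel_measurable (lebesgue_on D)" "lam3 \<in> borel_measurable (lebesgue_on D)"
    and weights: "AE z in lebesgue_on D.
        lam1 z \<ge> 0 \<and> lam2 z \<ge> 0 \<and> lam3 z \<ge> 0 \<and> lam1 z + lam2 z + lam3 z = 1 \<and>
        (\<forall>A\<in>sets borel. measure (\<mu> z) A =
            lam1 z * indicator A (S1 F ap (vlim z))
          + lam2 z * indicator A (S2 F ap bm (vlim z))
          + lam3 z * indicator A (S3 F bm (vlim z)))"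
begin

text \<open>The integral of \<open>G\<close> against the Young measure in closed form. Its
  measurability in \<open>z\<close> can be read off, and it agrees with the integral almost
  everywhere, namely where the atoms are known.\<close>

definition young_mean :: "(real \<Rightarrow> real) \<Rightarrow> real \<times> 'a \<Rightarrow> real" where
  "young_mean G z = lam1 z * G (S1 F ap (vlim z)) + lam2 z * G (S2 F ap bm (vlim z))
      + lam3 z * G (S3 F bm (vlim z))"

lemma open_D: "open D"
  unfolding D_def using domain by (intro open_Times) auto

lemma D_lebesgue [measurable]: "D \<in> sets lebesgue"
  using borel_open[OF open_D] by simp

lemma space_D [simp]: "space (lebesgue_on D) = D"
  by (simp add: space_restrict_space)

lemma complete_D: "complete_measure (lebesgue_on D)"
  by (rule complete_measure_lebesgue_on) (rule D_lebesgue)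

lemma D_finite: "emeasure (lebesgue_on D) D < \<infinity>"
proof -
  have "bounded D" unfolding D_def using domain by (intro bounded_Times) auto
  then have "emeasure lborel D < \<infinity>" by (rule emeasure_bounded_finite)
  moreover have "D \<in> sets borel" using open_D by (rule borel_open)
  ultimately show ?thesis by (simp add: emeasure_restrict_space)
qed

sublocale D: finite_measure "lebesgue_on D"
  by standard (use D_finite in simp)

lemma vlim_measurable [measurable]: "vlim \<in> borel_measurable (lebesgue_on D)"
  using v_lim by (simp add: strong_L2_limit_def)

lemma weights_bounded: "AE z in lebesgue_on D. \<bar>lam1 z\<bar> \<le> 1 \<and> \<bar>lam2 z\<bar> \<le> 1 \<and> \<bar>lam3 z\<bar> \<le> 1"
  using weights by eventually_elim auto

lemma young_mean_measurable [measurable]: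
  assumes [measurable]: "G \<in> borel_measurable borel"
  shows "young_mean G \<in> borel_measurable (lebesgue_on D)"
  unfolding young_mean_def by measurable

lemma young_mean_bounded:
  assumes "\<And>s. \<bar>G s\<bar> \<le> C"
  shows "AE z in lebesgue_on D. \<bar>young_mean G z\<bar> \<le> C"
  using weights
proof eventually_elim
  case (elim z)
  let ?a = "G (S1 F ap (vlim z))" and ?b = "G (S2 F ap bm (vlim z))" and ?c = "G (S3 F bm (vlim z))"
  have "\<bar>young_mean G z\<bar> \<le> \<bar>lam1 z * ?a\<bar> + \<bar>lam2 z * ?b\<bar> + \<bar>lam3 z * ?c\<bar>"
    unfolding young_mean_def by linarith
  also have "\<dots> = lam1 z * \<bar>?a\<bar> + lam2 z * \<bar>?b\<bar> + lam3 z * \<bar>?c\<bar>"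
    using elim by (simp add: abs_mult)
  also have "\<dots> \<le> lam1 z * C + lam2 z * C + lam3 z * C"
    using elim assms by (intro add_mono mult_left_mono) auto
  also have "\<dots> = C" using elim by (simp add: distrib_right[symmetric])
  finally show ?case .
qed

lemma young_mean_AE:
  assumes G: "G \<in> borel_measurable borel"
  shows "AE z in lebesgue_on D. (\<integral>s. G s \<partial>\<mu> z) = young_mean G z"
  using weights AE_space
proof eventually_elim
  case (elim z)
  then have "prob_space (\<mu> z)" "sets (\<mu> z) = sets borel"
    using young by (auto simp: young_measure_def)
  from integral_three_atoms[OF this G] elim show ?case unfolding young_mean_def by blast
qed

lemma young_limit:
  assumes G: "continuous_on UNIV G" "bounded (range G)" and \<phi>: "integrable (lebesgue_on D) \<phi>"
  shows "(\<lambda>k. \<integral>z. G (u (e k) z) * \<phi> z \<partial>lebesgue_on D) \<longlonglongrightarrow> (\<integral>z. young_mean G z * \<phi> z \<partial>lebesgue_on D)"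
proof -
  have "(\<lambda>k. \<integral>z. G (u (e k) z) * \<phi> z \<partial>lebesgue_on D) \<longlonglongrightarrow> (\<integral>z. (\<integral>s. G s \<partial>\<mu> z) * \<phi> z \<partial>lebesgue_on D)"
    using young G \<phi> unfolding young_measure_def weak_star_limit_def by blast
  moreover have "(\<integral>z. (\<integral>s. G s \<partial>\<mu> z) * \<phi> z \<partial>lebesgue_on D) = (\<integral>z. young_mean G z * \<phi> z \<partial>lebesgue_on D)"
    by (rule integral_cong_AE_complete[OF complete_D])
       (use young_mean_AE[OF borel_measurable_continuous_onI[OF G(1)]] in \<open>eventually_elim, simp\<close>)
  ultimately show ?thesis by simp
qed

lemma solution_continuous:
  assumes "\<epsilon> \<in> {0<..<1}"
  shows "continuous_on D (u \<epsilon>)" "continuous_on D (v \<epsilon>)" "continuous_on D (Lap_x2 (v \<epsilon>))"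
proof -
  note sol = solution[OF assms, unfolded classical_solution_def]
  have sub: "D \<subseteq> {0..} \<times> closure \<Omega>" "D \<subseteq> {0<..} \<times> \<Omega>"
    using closure_subset[of \<Omega>] by (auto simp: D_def)
  show "continuous_on D (u \<epsilon>)" "continuous_on D (v \<epsilon>)"
    using sol sub(1) continuous_on_subset by blast+
  have "continuous_on ({0<..} \<times> \<Omega>)
      (\<lambda>z. \<Sum>b\<in>Basis. (\<lambda>(t, x). partial_deriv b (partial_deriv b (\<lambda>y. v \<epsilon> (t, y))) x) z)"
    by (intro continuous_on_sum) (use sol in blast)
  moreover have "Lap_x2 (v \<epsilon>) = (\<lambda>z. \<Sum>b\<in>Basis. (\<lambda>(t, x). partial_deriv b (partial_deriv b (\<lambda>y. v \<epsilon> (t, y))) x) z)"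
    by (auto simp: Lap_x2_def laplacian_def fun_eq_iff)
  ultimately show "continuous_on D (Lap_x2 (v \<epsilon>))"
    using sub(2) continuous_on_subset by metis
qed

lemma solution_measurable [measurable]:
  "u (e k) \<in> borel_measurable (lebesgue_on D)" "v (e k) \<in> borel_measurable (lebesgue_on D)"
  "Lap_x2 (v (e k)) \<in> borel_measurable (lebesgue_on D)"
  using solution_continuous[OF subseq(1)[of k]] D_lebesgue
  by (auto intro: continuous_imp_measurable_on_sets_lebesgue)

section \<open>The weak identity for the primitives along a solution\<close>

definition flux :: "real \<Rightarrow> real \<times> 'a \<Rightarrow> real" where
  "flux \<epsilon> z = (F (u \<epsilon> z) - v \<epsilon> z) / \<epsilon>"

lemma solution_derivative:
  assumes "\<epsilon> \<in> {0<..<1}" "(t, x) \<in> D"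
  shows "((\<lambda>s. u \<epsilon> (s, x)) has_real_derivative - flux \<epsilon> (t, x)) (at t)"
    "((\<lambda>s. v \<epsilon> (s, x)) has_real_derivative Lap_x2 (v \<epsilon>) (t, x) + flux \<epsilon> (t, x)) (at t)"
proof -
  have "t > 0" "x \<in> \<Omega>" using assms by (auto simp: D_def)
  then have "((\<lambda>s. u \<epsilon> (s, x)) has_real_derivative (v \<epsilon> (t, x) - F (u \<epsilon> (t, x))) / \<epsilon>) (at t)"
     "((\<lambda>s. v \<epsilon> (s, x)) has_real_derivative
            laplacian (\<lambda>y. v \<epsilon> (t, y)) x + (F (u \<epsilon> (t, x)) - v \<epsilon> (t, x)) / \<epsilon>) (at t)"
    using solution[OF assms(1), unfolded classical_solution_def] by blast+
  then show "((\<lambda>s. u \<epsilon> (s, x)) has_real_derivative - flux \<epsilon> (t, x)) (at t)"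
    "((\<lambda>s. v \<epsilon> (s, x)) has_real_derivative Lap_x2 (v \<epsilon>) (t, x) + flux \<epsilon> (t, x)) (at t)"
    by (simp_all add: flux_def Lap_x2_def diff_divide_distrib)
qed

lemma flux_eq: "\<epsilon> \<in> {0<..<1} \<Longrightarrow> z \<in> D \<Longrightarrow> flux \<epsilon> z = D_t (v \<epsilon>) z - Lap_x2 (v \<epsilon>) z"
  using DERIV_imp_deriv[OF solution_derivative(2)] by (cases z) (simp add: D_t_def)

lemma flux_continuous: "\<epsilon> \<in> {0<..<1} \<Longrightarrow> continuous_on D (flux \<epsilon>)"
  unfolding flux_def
  by (intro continuous_intros solution_continuous continuous_on_compose2[OF F_cont]) auto

text \<open>The product \<open>(A u + B v) \<phi>\<close> is extended by 0 outside \<open>D\<close>,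
  and its derivative in direction \<open>(1, 0)\<close> integrates to 0. The flux leaves
  \<open>u\<close> with density \<open>\<theta> (F u)\<close> and enters \<open>v\<close> with
  density \<open>\<theta> v\<close>; the two contributions form the last integral.\<close>

lemma kinetic_identity:
  assumes \<epsilon>: "\<epsilon> \<in> {0<..<1}" and \<phi>: "test_function D \<phi>" and \<theta>: "continuous_on UNIV \<theta>"
    and A: "\<And>w. (A has_real_derivative \<theta> (F w)) (at w)"
    and B: "\<And>w. (B has_real_derivative \<theta> w) (at w)"
  shows "(\<integral>z. A (u \<epsilon> z) * D_t \<phi> z \<partial>lebesgue_on D) + (\<integral>z. B (v \<epsilon> z) * D_t \<phi> z \<partial>lebesgue_on D)
    + (\<integral>z. \<theta> (v \<epsilon> z) * Lap_x2 (v \<epsilon>) z * \<phi> z \<partial>lebesgue_on D)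
    + (\<integral>z. (\<theta> (v \<epsilon> z) - \<theta> (F (u \<epsilon> z))) * flux \<epsilon> z * \<phi> z \<partial>lebesgue_on D) = 0"
proof -
  obtain K where K: "compact K" "K \<subseteq> D" "\<And>z. z \<notin> K \<Longrightarrow> \<phi> z = 0"
    using \<phi> by (auto simp: test_function_def)
  have \<phi>0: "D_t \<phi> z = 0" if "z \<notin> K" for z
    unfolding D_t_test_function(1)[OF \<phi>] using partial_deriv_eq_0[OF compact_imp_closed[OF K(1)] K(3) that] .
  note uv = solution_continuous[OF \<epsilon>] flux_continuous[OF \<epsilon>]
  have cA: "continuous_on UNIV A" and cB: "continuous_on UNIV B"
    using A B by (auto intro!: continuous_at_imp_continuous_on DERIV_isCont)
  have c\<phi>: "continuous_on D \<phi>" and c\<phi>': "continuous_on D (D_t \<phi>)"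
    using test_function_cont[OF \<phi>] test_function_cont[OF D_t_test_function(2)[OF \<phi>]]
    by (auto intro: continuous_on_subset)
  have c\<theta>: "continuous_on D (\<lambda>z. \<theta> (v \<epsilon> z))" "continuous_on D (\<lambda>z. \<theta> (F (u \<epsilon> z)))"
    and cAB: "continuous_on D (\<lambda>z. A (u \<epsilon> z))" "continuous_on D (\<lambda>z. B (v \<epsilon> z))"
    by (auto intro!: continuous_on_compose2[OF \<theta>] continuous_on_compose2[OF cA] continuous_on_compose2[OF cB]
        continuous_on_compose2[OF F_cont] uv)
  define H where "H z = (A (u \<epsilon> z) + B (v \<epsilon> z)) * \<phi> z" for z
  define H1 where "H1 z = A (u \<epsilon> z) * D_t \<phi> z" for z
  define H2 where "H2 z = B (v \<epsilon> z) * D_t \<phi> z" for z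
  define H3 where "H3 z = \<theta> (v \<epsilon> z) * Lap_x2 (v \<epsilon>) z * \<phi> z" for z
  define H4 where "H4 z = (\<theta> (v \<epsilon> z) - \<theta> (F (u \<epsilon> z))) * flux \<epsilon> z * \<phi> z" for z
  define H' where "H' z = H1 z + H2 z + H3 z + H4 z" for z
  have c: "continuous_on D H1" "continuous_on D H2" "continuous_on D H3" "continuous_on D H4"
      "continuous_on D H" "continuous_on D H'"
    unfolding H'_def unfolding H1_def H2_def H3_def H4_def H_def by (intro continuous_intros c\<theta> cAB c\<phi> c\<phi>' uv)+
  have z: "H1 z = 0" "H2 z = 0" "H3 z = 0" "H4 z = 0" "H z = 0" "H' z = 0" if "z \<in> D - K" for z
    using that K(3)[of z] \<phi>0[of z] by (simp_all add: H'_def H1_def H2_def H3_def H4_def H_def)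
  note I = integrable_lebesgue_on_compact_support[OF open_D K(1,2)]
  have int: "integrable (lebesgue_on D) H1" "integrable (lebesgue_on D) H2"
      "integrable (lebesgue_on D) H3" "integrable (lebesgue_on D) H4"
    by (rule I[OF c(1) z(1)] I[OF c(2) z(2)] I[OF c(3) z(3)] I[OF c(4) z(4)]; assumption)+
  have "(\<integral>z. indicator D z * H' z \<partial>lborel) = 0"
  proof (rule integral_directional_derivative_eq_0[where b = "(1, 0)", OF K(1)])
    show "continuous_on UNIV (\<lambda>z. indicator D z * H z)" "continuous_on UNIV (\<lambda>z. indicator D z * H' z)"
      by (rule continuous_on_indicator_mult[OF open_D compact_imp_closed[OF K(1)] K(2) z(5) c(5)]
          continuous_on_indicator_mult[OF open_D compact_imp_closed[OF K(1)] K(2) z(6) c(6)]; assumption)+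
    show "indicator D z * H z = 0" if "z \<notin> K" for z
      using that K(3) by (simp add: H_def)
    fix z :: "real \<times> 'a"
    obtain t x where tx: "z = (t, x)" by (cases z)
    let ?l = "\<lambda>s. z + s *\<^sub>R (1, 0)"
    show "((\<lambda>s. indicator D (?l s) * H (?l s)) has_real_derivative indicator D z * H' z) (at 0)"
    proof (cases "z \<in> D")
      case True
      have "open (?l -` D)" by (intro open_vimage open_D continuous_intros)
      then have "eventually (\<lambda>s. s \<in> ?l -` D) (nhds 0)"
        by (rule eventually_nhds_in_open) (use True in \<open>auto simp: zero_prod_def[symmetric]\<close>)
      then have ev: "eventually (\<lambda>s. indicator D (?l s) * H (?l s) = H (?l s)) (nhds 0)"
        by eventually_elim auto
      have D\<phi>: "((\<lambda>s. \<phi> (s, x)) has_real_derivative D_t \<phi> (t, x)) (at t)"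
      proof -
        have "((\<lambda>s. \<phi> (s + t, x)) has_real_derivative D_t \<phi> (t, x)) (at 0)"
          using partial_deriv_has_derivative[OF test_function_differentiable[OF \<phi>], of z "(1, 0)"]
          unfolding D_t_test_function(1)[OF \<phi>] by (simp add: tx add.commute)
        then show ?thesis using DERIV_shift[of "\<lambda>s. \<phi> (s, x)" _ 0 t] by simp
      qed
      note d = solution_derivative[OF \<epsilon> True[unfolded tx]]
      have "((\<lambda>s. H (s, x)) has_real_derivative
          (\<theta> (F (u \<epsilon> (t, x))) * (- flux \<epsilon> (t, x)) + \<theta> (v \<epsilon> (t, x)) * (Lap_x2 (v \<epsilon>) (t, x) + flux \<epsilon> (t, x))) * \<phi> (t, x)
          + D_t \<phi> (t, x) * (A (u \<epsilon> (t, x)) + B (v \<epsilon> (t, x)))) (at t)"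
        unfolding H_def by (intro DERIV_mult DERIV_add DERIV_chain2[OF A d(1)] DERIV_chain2[OF B d(2)] D\<phi>)
      then have "((\<lambda>s. H (s, x)) has_real_derivative H' (t, x)) (at t)"
        by (simp add: H'_def H1_def H2_def H3_def H4_def algebra_simps)
      then have "((\<lambda>s. H (?l s)) has_real_derivative H' z) (at 0)"
        using DERIV_shift[of "\<lambda>s. H (s, x)" "H' (t, x)" 0 t] by (simp add: tx add.commute)
      then show ?thesis using DERIV_cong_ev[OF refl ev refl] True by simp
    next
      \<comment> \<open>A point outside \<open>D\<close> is outside the compact set \<open>K\<close>
        as well, hence the extended product vanishes along the line near it.\<close>
      case False
      have "open (?l -` (- K))"
        by (intro open_vimage continuous_intros) (use K compact_imp_closed in auto)
      then have "eventually (\<lambda>s. s \<in> ?l -` (- K)) (nhds 0)"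
        by (rule eventually_nhds_in_open) (use False K in \<open>auto simp: zero_prod_def[symmetric]\<close>)
      then have ev: "eventually (\<lambda>s. indicator D (?l s) * H (?l s) = 0) (nhds 0)"
        by eventually_elim (use K(3) in \<open>auto simp: H_def\<close>)
      show ?thesis using DERIV_cong_ev[OF refl ev refl] False by simp
    qed
  qed
  then have "integral\<^sup>L (lebesgue_on D) H' = 0"
    using integral_lebesgue_on_compact_support[OF open_D K(1,2) c(6) z(6)] by simp
  then show ?thesis
    unfolding H'_def using int by (simp add: H1_def[symmetric] H2_def[symmetric] H3_def[symmetric] H4_def[symmetric])
qed

lemma nn_integral_v_tendsto: "(\<lambda>k. \<integral>\<^sup>+ z. ennreal ((v (e k) z - vlim z)\<^sup>2) \<partial>lebesgue_on D) \<longlonglongrightarrow> 0"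
  using v_lim by (simp add: strong_L2_limit_def)

lemma integrable_bounded_mult:
  fixes f g :: "real \<times> 'a \<Rightarrow> real"
  assumes [measurable]: "f \<in> borel_measurable (lebesgue_on D)" and f: "AE z in lebesgue_on D. \<bar>f z\<bar> \<le> C"
    and g: "integrable (lebesgue_on D) g"
  shows "integrable (lebesgue_on D) (\<lambda>z. f z * g z)"
proof (rule Bochner_Integration.integrable_bound[of _ "\<lambda>z. C * g z"])
  show "integrable (lebesgue_on D) (\<lambda>z. C * g z)" using g by simp
  show "(\<lambda>z. f z * g z) \<in> borel_measurable (lebesgue_on D)"
    using borel_measurable_integrable[OF g] by measurable
  show "AE z in lebesgue_on D. norm (f z * g z) \<le> norm (C * g z)"
    using f
  proof eventually_elim
    case (elim z)
    then have "\<bar>f z\<bar> * \<bar>g z\<bar> \<le> \<bar>C\<bar> * \<bar>g z\<bar>" by (intro mult_right_mono) auto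
    then show ?case by (simp add: abs_mult)
  qed
qed

text \<open>Cauchy-Schwarz against the constant 1, available because \<open>D\<close> has finite
  measure.\<close>

lemma tendsto_bounded_mult:
  assumes [measurable]: "\<And>k. w k \<in> borel_measurable (lebesgue_on D)"
    and w: "(\<lambda>k. \<integral>\<^sup>+ z. ennreal ((w k z)\<^sup>2) \<partial>lebesgue_on D) \<longlonglongrightarrow> 0"
    and f: "\<And>k. AE z in lebesgue_on D. \<bar>f k z\<bar> \<le> C * \<bar>w k z\<bar>" and C: "0 \<le> C"
  shows "(\<lambda>k. \<integral>z. f k z \<partial>lebesgue_on D) \<longlonglongrightarrow> 0"
proof (rule integral_tendsto_0_L2[where g = "\<lambda>_ _. 1" and B = C and C = "measure (lebesgue_on D) D", OF _ _ w])
  show "(\<integral>\<^sup>+ z. ennreal (1\<^sup>2) \<partial>lebesgue_on D) \<le> ennreal (measure (lebesgue_on D) D)" for k :: nat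
    by (simp add: D.emeasure_eq_measure)
qed (use f C in simp_all)

text \<open>Stated for the difference, which is what the Lipschitz bound controls; the two terms are
  separated later, once each is known to be integrable.\<close>

lemma strong_limit:
  assumes B: "\<And>r s. \<bar>B r - B s\<bar> \<le> L * \<bar>r - s\<bar>" "L \<ge> 0" "B \<in> borel_measurable borel"
    and \<eta>: "\<eta> \<in> borel_measurable (lebesgue_on D)" "AE z in lebesgue_on D. \<bar>\<eta> z\<bar> \<le> C"
  shows "(\<lambda>k. \<integral>z. (B (v (e k) z) - B (vlim z)) * \<eta> z \<partial>lebesgue_on D) \<longlonglongrightarrow> 0"
proof (rule tendsto_bounded_mult[OF _ nn_integral_v_tendsto])
  show "AE z in lebesgue_on D. \<bar>(B (v (e k) z) - B (vlim z)) * \<eta> z\<bar> \<le> (L * \<bar>C\<bar>) * \<bar>v (e k) z - vlim z\<bar>" for k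
    using \<eta>(2)
  proof eventually_elim
    case (elim z)
    have "\<bar>(B (v (e k) z) - B (vlim z)) * \<eta> z\<bar> \<le> (L * \<bar>v (e k) z - vlim z\<bar>) * \<bar>C\<bar>"
      unfolding abs_mult by (intro mult_mono B) (use elim B in auto)
    then show ?case by (simp add: ac_simps)
  qed
qed (use B in auto)

end

section \<open>The weights under uniform bounds in L2\<close>

locale L2_bounded_system = limit_system +
  assumes bounded: "bounded_in_L2 D (\<lambda>\<epsilon>. D_t (v \<epsilon>))" "bounded_in_L2 D (\<lambda>\<epsilon>. Lap_x2 (v \<epsilon>))"
begin

lemma ex_Lap_bound:
  obtains C where "C \<ge> 0" "\<And>k. (\<integral>\<^sup>+ z. ennreal ((Lap_x2 (v (e k)) z)\<^sup>2) \<partial>lebesgue_on D) \<le> ennreal C"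
proof -
  obtain C where "\<And>\<epsilon>. \<epsilon> \<in> {0<..<1} \<Longrightarrow> (\<integral>\<^sup>+ z. ennreal ((Lap_x2 (v \<epsilon>) z)\<^sup>2) \<partial>lebesgue_on D) \<le> ennreal C"
    using bounded(2) unfolding bounded_in_L2_def by blast
  \<comment> \<open>The bounding constant may be negative, in which case \<open>ennreal\<close>
    sends it to 0; passing to \<open>max 0 C\<close> keeps the bound and fixes the sign.\<close>
  then have "(\<integral>\<^sup>+ z. ennreal ((Lap_x2 (v (e k)) z)\<^sup>2) \<partial>lebesgue_on D) \<le> ennreal (max 0 C)" for k
    using subseq(1) by (meson ennreal_leI max.cobounded2 order_trans)
  then show thesis by (intro that[of "max 0 C"]) auto
qed

lemma flux_measurable [measurable]: "flux (e k) \<in> borel_measurable (lebesgue_on D)"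
  by (intro continuous_imp_measurable_on_sets_lebesgue flux_continuous subseq D_lebesgue)

lemma ex_flux_bound:
  obtains C where "C \<ge> 0" "\<And>k. (\<integral>\<^sup>+ z. ennreal ((flux (e k) z)\<^sup>2) \<partial>lebesgue_on D) \<le> ennreal C"
proof -
  obtain C where C: "C \<ge> 0" "\<And>k. (\<integral>\<^sup>+ z. ennreal ((Lap_x2 (v (e k)) z)\<^sup>2) \<partial>lebesgue_on D) \<le> ennreal C"
    using ex_Lap_bound by blast
  obtain C' where C': "\<And>\<epsilon>. \<epsilon> \<in> {0<..<1} \<Longrightarrow> D_t (v \<epsilon>) \<in> borel_measurable (lebesgue_on D)"
      "\<And>\<epsilon>. \<epsilon> \<in> {0<..<1} \<Longrightarrow> (\<integral>\<^sup>+ z. ennreal ((D_t (v \<epsilon>) z)\<^sup>2) \<partial>lebesgue_on D) \<le> ennreal C'"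
    using bounded(1) unfolding bounded_in_L2_def by blast
  have "(\<integral>\<^sup>+ z. ennreal ((flux (e k) z)\<^sup>2) \<partial>lebesgue_on D) \<le> ennreal (2 * max 0 C' + 2 * C)" for k
  proof -
    have [measurable]: "D_t (v (e k)) \<in> borel_measurable (lebesgue_on D)" by (rule C'(1)[OF subseq(1)])
    have "(\<integral>\<^sup>+ z. ennreal ((flux (e k) z)\<^sup>2) \<partial>lebesgue_on D)
      \<le> (\<integral>\<^sup>+ z. 2 * ennreal ((D_t (v (e k)) z)\<^sup>2) + 2 * ennreal ((Lap_x2 (v (e k)) z)\<^sup>2) \<partial>lebesgue_on D)"
    proof (rule nn_integral_mono)
      fix z assume "z \<in> space (lebesgue_on D)"
      then have f: "flux (e k) z = D_t (v (e k)) z - Lap_x2 (v (e k)) z"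
        using flux_eq[OF subseq(1)] by simp
      have "(a - b)\<^sup>2 \<le> 2 * a\<^sup>2 + 2 * b\<^sup>2" for a b :: real
        using zero_le_power2[of "a + b"] by (simp add: power2_eq_square algebra_simps)
      from ennreal_leI[OF this]
      have "ennreal ((flux (e k) z)\<^sup>2) \<le> ennreal (2 * (D_t (v (e k)) z)\<^sup>2 + 2 * (Lap_x2 (v (e k)) z)\<^sup>2)"
        unfolding f .
      also have "\<dots> = 2 * ennreal ((D_t (v (e k)) z)\<^sup>2) + 2 * ennreal ((Lap_x2 (v (e k)) z)\<^sup>2)"
        by (simp add: ennreal_plus ennreal_mult)
      finally show "ennreal ((flux (e k) z)\<^sup>2) \<le> 2 * ennreal ((D_t (v (e k)) z)\<^sup>2) + 2 * ennreal ((Lap_x2 (v (e k)) z)\<^sup>2)" .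
    qed
    also have "\<dots> = 2 * (\<integral>\<^sup>+ z. ennreal ((D_t (v (e k)) z)\<^sup>2) \<partial>lebesgue_on D)
        + 2 * (\<integral>\<^sup>+ z. ennreal ((Lap_x2 (v (e k)) z)\<^sup>2) \<partial>lebesgue_on D)"
      by (subst nn_integral_add) (auto simp: nn_integral_cmult)
    also have "\<dots> \<le> 2 * ennreal (max 0 C') + 2 * ennreal C"
      using C'(2)[OF subseq(1), of k] C(2)[of k]
      by (intro add_mono mult_left_mono) (auto intro: order_trans ennreal_leI)
    also have "\<dots> = ennreal (2 * max 0 C' + 2 * C)" using C(1) by (simp add: ennreal_plus ennreal_mult)
    finally show ?thesis .
  qed
  then show thesis using C(1) by (intro that[of "2 * max 0 C' + 2 * C"]) auto
qed

lemma nn_integral_defect_tendsto: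
  "(\<lambda>k. \<integral>\<^sup>+ z. ennreal ((F (u (e k) z) - v (e k) z)\<^sup>2) \<partial>lebesgue_on D) \<longlonglongrightarrow> 0"
proof -
  obtain C where C: "C \<ge> 0" "\<And>k. (\<integral>\<^sup>+ z. ennreal ((flux (e k) z)\<^sup>2) \<partial>lebesgue_on D) \<le> ennreal C"
    using ex_flux_bound by blast
  have "(\<integral>\<^sup>+ z. ennreal ((F (u (e k) z) - v (e k) z)\<^sup>2) \<partial>lebesgue_on D) \<le> ennreal ((e k)\<^sup>2 * C)" for k
  proof -
    have "e k \<noteq> 0" using subseq(1)[of k] by auto
    then have "(\<integral>\<^sup>+ z. ennreal ((F (u (e k) z) - v (e k) z)\<^sup>2) \<partial>lebesgue_on D)
      = (\<integral>\<^sup>+ z. ennreal ((e k)\<^sup>2) * ennreal ((flux (e k) z)\<^sup>2) \<partial>lebesgue_on D)"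
      by (intro nn_integral_cong) (simp add: flux_def power_divide flip: ennreal_mult)
    also have "\<dots> = ennreal ((e k)\<^sup>2) * (\<integral>\<^sup>+ z. ennreal ((flux (e k) z)\<^sup>2) \<partial>lebesgue_on D)"
      by (rule nn_integral_cmult) measurable
    also have "\<dots> \<le> ennreal ((e k)\<^sup>2) * ennreal C" by (intro mult_left_mono C(2)) simp
    finally show ?thesis using C(1) by (simp add: ennreal_mult)
  qed
  note bd = this
  have "(\<lambda>k. (e k)\<^sup>2 * C) \<longlonglongrightarrow> 0\<^sup>2 * C" by (intro tendsto_intros subseq(2))
  then have lim: "(\<lambda>k. ennreal ((e k)\<^sup>2 * C)) \<longlonglongrightarrow> 0" using tendsto_ennrealI by fastforce
  show ?thesis
    by (rule tendsto_sandwich[OF always_eventually always_eventually tendsto_const lim]) (simp_all only: bd zero_le simp_thms)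
qed

text \<open>The Young measure lives on the set where \<open>F\<close> takes the value \<open>vlim\<close>; the bounded injective
  function \<open>arctan\<close> detects this.\<close>
lemma young_mean_arctan: "AE z in lebesgue_on D. young_mean (\<lambda>s. arctan (F s)) z = arctan (vlim z)"
proof -
  let ?G = "\<lambda>s. arctan (F s)"
  have [measurable]: "F \<in> borel_measurable borel" by (rule F_measurable)
  have Gc: "continuous_on UNIV ?G" by (intro continuous_intros F_cont)
  then have [measurable]: "?G \<in> borel_measurable borel" by (rule borel_measurable_continuous_onI)
  have ab: "\<bar>arctan x\<bar> \<le> 2" for x using arctan_bounded[of x] pi_less_4 by auto
  have lip: "\<bar>arctan r - arctan s\<bar> \<le> 1 * \<bar>r - s\<bar>" for r s
  proof -
    have "norm (arctan r - arctan s) \<le> 1 * norm (r - s)"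
    proof (rule field_differentiable_bound[of UNIV arctan "\<lambda>x. inverse (1 + x\<^sup>2)"])
      show "norm (inverse (1 + x\<^sup>2)) \<le> 1" for x :: real
        by (simp add: inverse_le_1_iff add_pos_nonneg)
    qed (auto intro: DERIV_arctan has_field_derivative_at_within)
    then show ?thesis by simp
  qed
  \<comment> \<open>The defect is tested against itself. It is bounded, hence admissible in both
    limits, and the outcome is that the integral of its square vanishes.\<close>
  define \<eta> where "\<eta> z = young_mean ?G z - arctan (vlim z)" for z
  have \<eta>m [measurable]: "\<eta> \<in> borel_measurable (lebesgue_on D)" unfolding \<eta>_def by measurable
  have \<eta>b: "AE z in lebesgue_on D. \<bar>\<eta> z\<bar> \<le> 4"
    using young_mean_bounded[of ?G 2, OF ab]
  proof eventually_elim
    case (elim z)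
    then show ?case using ab[of "vlim z"] unfolding \<eta>_def by linarith
  qed
  have one: "integrable (lebesgue_on D) (\<lambda>_. 1 :: real)" by simp
  have \<eta>i: "integrable (lebesgue_on D) \<eta>" using integrable_bounded_mult[OF \<eta>m \<eta>b one] by simp
  have ym: "(\<lambda>k. \<integral>z. ?G (u (e k) z) * \<eta> z \<partial>lebesgue_on D) \<longlonglongrightarrow> (\<integral>z. young_mean ?G z * \<eta> z \<partial>lebesgue_on D)"
  proof (rule young_limit[OF Gc _ \<eta>i])
    show "bounded (range ?G)" unfolding bounded_iff using ab by auto
  qed
  have l1: "(\<lambda>k. \<integral>z. (arctan (v (e k) z) - arctan (vlim z)) * \<eta> z \<partial>lebesgue_on D) \<longlonglongrightarrow> 0"
    by (rule strong_limit[OF lip _ _ \<eta>m \<eta>b]) auto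
  have l2: "(\<lambda>k. \<integral>z. (?G (u (e k) z) - arctan (v (e k) z)) * \<eta> z \<partial>lebesgue_on D) \<longlonglongrightarrow> 0"
  proof (rule tendsto_bounded_mult[OF _ nn_integral_defect_tendsto])
    show "AE z in lebesgue_on D. \<bar>(?G (u (e k) z) - arctan (v (e k) z)) * \<eta> z\<bar> \<le> 4 * \<bar>F (u (e k) z) - v (e k) z\<bar>" for k
      using \<eta>b
    proof eventually_elim
      case (elim z)
      have "\<bar>(?G (u (e k) z) - arctan (v (e k) z)) * \<eta> z\<bar> \<le> (1 * \<bar>F (u (e k) z) - v (e k) z\<bar>) * 4"
        unfolding abs_mult by (intro mult_mono lip) (use elim in auto)
      then show ?case by simp
    qed
  qed auto
  have int: "integrable (lebesgue_on D) (\<lambda>z. arctan (w z) * \<eta> z)" if "w \<in> borel_measurable (lebesgue_on D)" for w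
    using that ab by (intro integrable_bounded_mult[OF _ _ \<eta>i, of _ 2]) auto
  have meas: "(\<lambda>z. F (u (e k) z)) \<in> borel_measurable (lebesgue_on D)" for k by measurable
  have "(\<integral>z. (arctan (v (e k) z) - arctan (vlim z)) * \<eta> z \<partial>lebesgue_on D)
      + (\<integral>z. (?G (u (e k) z) - arctan (v (e k) z)) * \<eta> z \<partial>lebesgue_on D)
      = (\<integral>z. ?G (u (e k) z) * \<eta> z \<partial>lebesgue_on D) - (\<integral>z. arctan (vlim z) * \<eta> z \<partial>lebesgue_on D)" for k
    using int[OF meas[of k]] int[OF solution_measurable(2)[of k]] int[OF vlim_measurable]
    by (simp add: left_diff_distrib)
  then have "(\<lambda>k. (\<integral>z. ?G (u (e k) z) * \<eta> z \<partial>lebesgue_on D) - (\<integral>z. arctan (vlim z) * \<eta> z \<partial>lebesgue_on D)) \<longlonglongrightarrow> 0"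
    using tendsto_add[OF l1 l2] by simp
  then have "(\<lambda>k. \<integral>z. ?G (u (e k) z) * \<eta> z \<partial>lebesgue_on D) \<longlonglongrightarrow> (\<integral>z. arctan (vlim z) * \<eta> z \<partial>lebesgue_on D)"
    by (rule LIM_zero_cancel)
  then have "(\<integral>z. young_mean ?G z * \<eta> z \<partial>lebesgue_on D) = (\<integral>z. arctan (vlim z) * \<eta> z \<partial>lebesgue_on D)"
    by (rule LIMSEQ_unique[OF ym])
  moreover have "integrable (lebesgue_on D) (\<lambda>z. young_mean ?G z * \<eta> z)"
    by (rule integrable_bounded_mult[OF _ young_mean_bounded[of ?G 2, OF ab] \<eta>i]) measurable
  moreover have eq: "\<eta> z * \<eta> z = young_mean ?G z * \<eta> z - arctan (vlim z) * \<eta> z" for z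
    using left_diff_distrib[of "young_mean ?G z" "arctan (vlim z)" "\<eta> z"] by (simp only: \<eta>_def)
  ultimately have z: "(\<integral>z. \<eta> z * \<eta> z \<partial>lebesgue_on D) = 0" and i: "integrable (lebesgue_on D) (\<lambda>z. \<eta> z * \<eta> z)"
    unfolding eq using int[OF vlim_measurable] by simp_all
  have "AE z in lebesgue_on D. \<eta> z * \<eta> z = 0"
    using z by (subst (asm) integral_nonneg_eq_0_iff_AE[OF i]) auto
  then show ?thesis by eventually_elim (simp add: \<eta>_def)
qed

text \<open>Above the upper level the first two atoms lie at \<open>ap\<close>, where
  \<open>F\<close> has the value \<open>F ap\<close> and not \<open>vlim\<close>. Since
  \<open>arctan\<close> is strictly increasing, the mean can equal \<open>arctan (vlim z)\<close>
  only if these atoms carry no mass.\<close>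

lemma weights_above: "AE z in lebesgue_on D. F ap < vlim z \<longrightarrow> lam1 z = 0"
  using young_mean_arctan weights
proof eventually_elim
  case (elim z)
  show ?case
  proof
    assume v: "F ap < vlim z"
    then have F: "F (S1 F ap (vlim z)) = F ap" "F (S2 F ap bm (vlim z)) = F ap" "F (S3 F bm (vlim z)) = vlim z"
      using F_S1 F_S2 F_S3 F_am_less by auto
    have "(lam1 z + lam2 z) * (arctan (vlim z) - arctan (F ap)) = 0"
    proof -
      have l: "lam3 z = 1 - lam1 z - lam2 z" using elim(2) by simp
      show ?thesis using elim(1) unfolding young_mean_def F l by (simp add: algebra_simps)
    qed
    moreover have "arctan (F ap) < arctan (vlim z)" using v by (simp add: arctan_less_iff)
    ultimately have "lam1 z + lam2 z = 0" by simp
    then show "lam1 z = 0" using elim(2) by linarith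
  qed
qed

text \<open>Mirror image: below the lower level the last two atoms lie at \<open>bm\<close>.\<close>

lemma weights_below: "AE z in lebesgue_on D. vlim z < F bm \<longrightarrow> lam3 z = 0"
  using young_mean_arctan weights
proof eventually_elim
  case (elim z)
  show ?case
  proof
    assume v: "vlim z < F bm"
    then have F: "F (S1 F ap (vlim z)) = vlim z" "F (S2 F ap bm (vlim z)) = F bm" "F (S3 F bm (vlim z)) = F bm"
      using F_S1 F_S2 F_S3 F_am_less by auto
    have "(lam2 z + lam3 z) * (arctan (F bm) - arctan (vlim z)) = 0"
    proof -
      have l: "lam1 z = 1 - lam2 z - lam3 z" using elim(2) by simp
      show ?thesis using elim(1) unfolding young_mean_def F l by (simp add: algebra_simps)
    qed
    moreover have "arctan (vlim z) < arctan (F bm)" using v by (simp add: arctan_less_iff)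
    ultimately have "lam2 z + lam3 z = 0" by simp
    then show "lam3 z = 0" using elim(2) by linarith
  qed
qed

text \<open>In the kinetic identity, the Laplacian of \<open>v\<close> is multiplied by \<open>tent a b v\<close>, which tends to \<open>0\<close> in
  \<open>L\<^sup>2\<close> on \<open>K\<close>; since \<open>F u - v = \<epsilon> * flux\<close>, the reaction term is of order \<open>\<epsilon> * flux\<^sup>2\<close>.\<close>
lemma time_derivative_young_mean_tent:
  assumes \<phi>: "test_function U \<phi>" "U \<subseteq> D" and ab: "F bm \<le> a" "b \<le> F ap"
    and A: "\<And>w. (A has_real_derivative tent a b (F w)) (at w)"
    and B: "\<And>w. (B has_real_derivative tent a b w) (at w)"
    and K: "compact K" "K \<subseteq> U" "\<And>z. z \<notin> K \<Longrightarrow> \<phi> z = 0"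
    and vK: "\<And>z. z \<in> K \<Longrightarrow> tent a b (vlim z) = 0 \<and> B (vlim z) = b0"
  shows "(\<integral>z. young_mean A z * D_t \<phi> z \<partial>lebesgue_on D) = 0"
proof -
  have \<phi>D: "test_function D \<phi>" using \<phi> by (rule test_function_mono)
  have \<phi>0: "D_t \<phi> z = 0" if "z \<notin> K" for z
    unfolding D_t_test_function(1)[OF \<phi>D] using partial_deriv_eq_0[OF compact_imp_closed[OF K(1)] K(3) that] .
  obtain M where M: "M \<ge> 0" "\<And>z. \<bar>\<phi> z\<bar> \<le> M" using test_function_bounded[OF \<phi>D] by blast
  obtain M' where M': "\<And>z. \<bar>D_t \<phi> z\<bar> \<le> M'"
    using test_function_bounded[OF D_t_test_function(2)[OF \<phi>D]] by blast
  note \<phi>' = integral_D_t_test_function[OF \<phi>D subset_refl open_D]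
  have cA: "continuous_on UNIV A" and cB: "continuous_on UNIV B"
    using A B by (auto intro!: continuous_at_imp_continuous_on DERIV_isCont)
  have lipB: "\<bar>B r - B s\<bar> \<le> \<bar>b - a\<bar> * \<bar>r - s\<bar>" for r s
  proof -
    have "norm (B r - B s) \<le> \<bar>b - a\<bar> * norm (r - s)"
      by (rule field_differentiable_bound[of UNIV B "tent a b"])
         (use B tent_bounds(2) in \<open>simp_all\<close>)
    then show ?thesis by simp
  qed
  define I1 where "I1 k = (\<integral>z. A (u (e k) z) * D_t \<phi> z \<partial>lebesgue_on D)" for k
  define I2 where "I2 k = (\<integral>z. B (v (e k) z) * D_t \<phi> z \<partial>lebesgue_on D)" for k
  define I3 where "I3 k = (\<integral>z. tent a b (v (e k) z) * Lap_x2 (v (e k)) z * \<phi> z \<partial>lebesgue_on D)" for k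
  define I4 where "I4 k = (\<integral>z. (tent a b (v (e k) z) - tent a b (F (u (e k) z))) * flux (e k) z * \<phi> z \<partial>lebesgue_on D)" for k
  have sum0: "I1 k + I2 k + I3 k + I4 k = 0" for k
    unfolding I1_def I2_def I3_def I4_def
    by (rule kinetic_identity[OF subseq(1) \<phi>D continuous_tent A B])
  have 1: "I1 \<longlonglongrightarrow> (\<integral>z. young_mean A z * D_t \<phi> z \<partial>lebesgue_on D)"
    unfolding I1_def by (rule young_limit[OF cA bounded_tent_primitive[OF A ab] \<phi>'(1)])
  have 2: "I2 \<longlonglongrightarrow> 0"
  proof -
    \<comment> \<open>On \<open>K\<close> the value \<open>B (vlim z)\<close> is the constant
      \<open>b0\<close>, and a constant times \<open>D_t \<phi>\<close> integrates to 0. Subtracting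
      the limit thus costs nothing, and \<open>strong_limit\<close> applies to the
      difference.\<close>
    have eq: "(\<integral>z. (B (v (e k) z) - B (vlim z)) * D_t \<phi> z \<partial>lebesgue_on D) = I2 k" for k
    proof -
      have int: "integrable (lebesgue_on D) (\<lambda>z. B (v (e k) z) * D_t \<phi> z)"
      proof (rule integrable_lebesgue_on_compact_support[OF open_D K(1)])
        show "continuous_on D (\<lambda>z. B (v (e k) z) * D_t \<phi> z)"
          by (intro continuous_intros continuous_on_compose2[OF cB] solution_continuous subseq
              continuous_on_subset[OF test_function_cont[OF D_t_test_function(2)[OF \<phi>D]]]) auto
      qed (use K \<phi>(2) \<phi>0 in auto)
      have "(\<integral>z. (B (v (e k) z) - B (vlim z)) * D_t \<phi> z \<partial>lebesgue_on D)
          = (\<integral>z. B (v (e k) z) * D_t \<phi> z - b0 * D_t \<phi> z \<partial>lebesgue_on D)"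
      proof (rule Bochner_Integration.integral_cong[OF refl])
        fix z show "(B (v (e k) z) - B (vlim z)) * D_t \<phi> z = B (v (e k) z) * D_t \<phi> z - b0 * D_t \<phi> z"
          using vK[of z] \<phi>0[of z] by (cases "z \<in> K") (simp_all add: left_diff_distrib)
      qed
      also have "\<dots> = I2 k" unfolding I2_def using int \<phi>' by simp
      finally show ?thesis .
    qed
    have "(\<lambda>k. \<integral>z. (B (v (e k) z) - B (vlim z)) * D_t \<phi> z \<partial>lebesgue_on D) \<longlonglongrightarrow> 0"
      by (rule strong_limit[OF lipB _ borel_measurable_continuous_onI[OF cB] borel_measurable_integrable[OF \<phi>'(1)] AE_I2[OF M']]) simp
    then show ?thesis unfolding eq .
  qed
  have 3: "I3 \<longlonglongrightarrow> 0"
  proof -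
    obtain C where C: "C \<ge> 0" "\<And>k. (\<integral>\<^sup>+ z. ennreal ((Lap_x2 (v (e k)) z)\<^sup>2) \<partial>lebesgue_on D) \<le> ennreal C"
      using ex_Lap_bound by blast
    show ?thesis unfolding I3_def
    proof (rule integral_tendsto_0_L2[OF _ _ nn_integral_v_tendsto C(2) AE_I2 M(1)])
      fix k and z :: "real \<times> 'a"
      have "\<bar>tent a b (v (e k) z)\<bar> * \<bar>\<phi> z\<bar> \<le> \<bar>v (e k) z - vlim z\<bar> * M"
      proof (cases "z \<in> K")
        case True
        then have "\<bar>tent a b (v (e k) z)\<bar> \<le> \<bar>v (e k) z - vlim z\<bar>"
          using tent_lipschitz[of a b "v (e k) z" "vlim z"] vK[of z] by simp
        then show ?thesis using M by (intro mult_mono) auto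
      qed (use K M in simp)
      then have "\<bar>tent a b (v (e k) z)\<bar> * \<bar>\<phi> z\<bar> * \<bar>Lap_x2 (v (e k)) z\<bar> \<le> \<bar>v (e k) z - vlim z\<bar> * M * \<bar>Lap_x2 (v (e k)) z\<bar>"
        by (rule mult_right_mono) simp
      then show "\<bar>tent a b (v (e k) z) * Lap_x2 (v (e k)) z * \<phi> z\<bar> \<le> M * (\<bar>v (e k) z - vlim z\<bar> * \<bar>Lap_x2 (v (e k)) z\<bar>)"
        by (simp add: abs_mult ac_simps)
    qed measurable
  qed
  have 4: "I4 \<longlonglongrightarrow> 0"
  proof -
    obtain C where C: "C \<ge> 0" "\<And>k. (\<integral>\<^sup>+ z. ennreal ((flux (e k) z)\<^sup>2) \<partial>lebesgue_on D) \<le> ennreal C"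
      using ex_flux_bound by blast
    have [measurable]: "F \<in> borel_measurable borel" by (rule F_measurable)
    show ?thesis unfolding I4_def
    proof (rule integral_tendsto_0_L2[OF _ _ nn_integral_defect_tendsto C(2) AE_I2 M(1)])
      fix k and z :: "real \<times> 'a"
      have "\<bar>tent a b (v (e k) z) - tent a b (F (u (e k) z))\<bar> * \<bar>\<phi> z\<bar> \<le> \<bar>F (u (e k) z) - v (e k) z\<bar> * M"
        using tent_lipschitz[of a b "v (e k) z" "F (u (e k) z)"] M by (intro mult_mono) auto
      then have "\<bar>tent a b (v (e k) z) - tent a b (F (u (e k) z))\<bar> * \<bar>\<phi> z\<bar> * \<bar>flux (e k) z\<bar>
          \<le> \<bar>F (u (e k) z) - v (e k) z\<bar> * M * \<bar>flux (e k) z\<bar>"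
        by (rule mult_right_mono) simp
      then show "\<bar>(tent a b (v (e k) z) - tent a b (F (u (e k) z))) * flux (e k) z * \<phi> z\<bar>
          \<le> M * (\<bar>F (u (e k) z) - v (e k) z\<bar> * \<bar>flux (e k) z\<bar>)"
        by (simp add: abs_mult ac_simps)
    qed measurable
  qed
  have "(\<lambda>k. I1 k + I2 k + I3 k + I4 k) \<longlonglongrightarrow> (\<integral>z. young_mean A z * D_t \<phi> z \<partial>lebesgue_on D) + 0 + 0 + 0"
    by (intro tendsto_add 1 2 3 4)
  then show ?thesis unfolding sum0 by (simp add: LIMSEQ_const_iff)
qed

text \<open>The offset \<open>a\<close> disappears on integrating against \<open>D_t \<phi>\<close>,
  and division by \<open>c\<close> isolates \<open>l\<close>. The affine form is demanded only where
  \<open>D_t \<phi>\<close> is nonzero, because only there are the values of \<open>vlim\<close>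
  controlled.\<close>

lemma young_mean_affine:
  assumes \<phi>: "test_function U \<phi>" "U \<subseteq> D" and c: "c \<noteq> 0"
    and l: "l \<in> borel_measurable (lebesgue_on D)" "AE z in lebesgue_on D. \<bar>l z\<bar> \<le> 1"
    and eq: "AE z in lebesgue_on D. D_t \<phi> z \<noteq> 0 \<longrightarrow> young_mean A z = a + c * l z"
    and zero: "(\<integral>z. young_mean A z * D_t \<phi> z \<partial>lebesgue_on D) = 0"
  shows "(\<integral>z. l z * D_t \<phi> z \<partial>lebesgue_on D) = 0"
proof -
  note \<phi>' = integral_D_t_test_function[OF \<phi> open_D]
  have int: "integrable (lebesgue_on D) (\<lambda>z. l z * D_t \<phi> z)"
    by (rule integrable_bounded_mult[OF l \<phi>'(1)])
  have "0 = (\<integral>z. a * D_t \<phi> z + c * (l z * D_t \<phi> z) \<partial>lebesgue_on D)"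
    unfolding zero[symmetric]
    by (rule integral_cong_AE_complete[OF complete_D])
       (use eq in \<open>eventually_elim, auto simp: algebra_simps\<close>)
  also have "\<dots> = c * (\<integral>z. l z * D_t \<phi> z \<partial>lebesgue_on D)"
    using int \<phi>' by simp
  finally show ?thesis using c by simp
qed

text \<open>Below the upper level the Young mean of the primitive is
  \<open>a + c * (lam2 z + lam3 z)\<close>, and the weights add up to 1.\<close>

lemma lam1_constant_below:
  assumes \<phi>: "test_function U \<phi>" "U \<subseteq> D" and U: "continuous_on U vlim" "\<And>z. z \<in> U \<Longrightarrow> vlim z < F ap"
  shows "(\<integral>z. lam1 z * D_t \<phi> z \<partial>lebesgue_on D) = 0"
proof -
  obtain K where K: "compact K" "K \<subseteq> U" "\<And>z. z \<notin> K \<Longrightarrow> \<phi> z = 0"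
    using \<phi>(1) by (auto simp: test_function_def)
  have \<phi>0: "D_t \<phi> z = 0" if "z \<notin> K" for z
    unfolding D_t_test_function(1)[OF \<phi>(1)] using partial_deriv_eq_0[OF compact_imp_closed[OF K(1)] K(3) that] .
  \<comment> \<open>On the compact set \<open>K\<close> the continuous \<open>vlim\<close> attains a
    maximum below \<open>F ap\<close>, so a tent fits between \<open>m\<close> and
    \<open>F ap\<close>. The maximum with \<open>F bm\<close> keeps the tent inside the critical
    interval, where its primitive is bounded.\<close>
  obtain m where m: "F bm \<le> m" "m < F ap" "\<And>z. z \<in> K \<Longrightarrow> vlim z \<le> m"
  proof (cases "K = {}")
    case True
    then show thesis using that[of "F bm"] F_am_less by auto
  next
    case False
    then obtain y where y: "y \<in> K" "\<And>z. z \<in> K \<Longrightarrow> vlim z \<le> vlim y"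
      using continuous_attains_sup[OF K(1) _ continuous_on_subset[OF U(1) K(2)]] by blast
    have "vlim y < F ap" using U(2) y(1) K(2) by blast
    then show thesis using that[of "max (F bm) (vlim y)"] F_am_less y(2) by (auto simp: le_max_iff_disj)
  qed
  obtain A where A: "\<And>w. (A has_real_derivative tent m (F ap) (F w)) (at w)"
    using ex_antiderivative[of "\<lambda>w. tent m (F ap) (F w)"] continuous_on_compose2[OF continuous_tent F_cont] by blast
  obtain B where B: "\<And>w. (B has_real_derivative tent m (F ap) w) (at w)"
    using ex_antiderivative[OF continuous_tent] by blast
  obtain c a where c: "c > 0" and val: "\<And>r. r \<le> m \<Longrightarrow> A (S1 F ap r) = a \<and> A (S2 F ap bm r) = a + c \<and> A (S3 F bm r) = a + c"
    using tent_primitive_below[OF m(1,2) A] by blast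
  have Bm: "B r = B m" if "r \<le> m" for r
    by (rule antiderivative_const[OF B], rule tent_eq_0) (use that in auto)
  have "(\<integral>z. young_mean A z * D_t \<phi> z \<partial>lebesgue_on D) = 0"
  proof (rule time_derivative_young_mean_tent[OF \<phi> m(1) order_refl A B K])
    fix z assume "z \<in> K"
    then have "vlim z \<le> m" by (rule m(3))
    then show "tent m (F ap) (vlim z) = 0 \<and> B (vlim z) = B m" using Bm tent_eq_0 by blast
  qed
  then show ?thesis
  proof (rule young_mean_affine[OF \<phi>, of "- c" lam1 A "a + c", rotated 4])
    show "AE z in lebesgue_on D. \<bar>lam1 z\<bar> \<le> 1" using weights_bounded by eventually_elim simp
    show "AE z in lebesgue_on D. D_t \<phi> z \<noteq> 0 \<longrightarrow> young_mean A z = a + c + - c * lam1 z"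
      using weights
    proof eventually_elim
      case (elim z)
      show ?case
      proof
        assume "D_t \<phi> z \<noteq> 0"
        then have "vlim z \<le> m" using \<phi>0 m(3) by blast
        from val[OF this] have v: "A (S1 F ap (vlim z)) = a" "A (S2 F ap bm (vlim z)) = a + c" "A (S3 F bm (vlim z)) = a + c"
          by auto
        have l: "lam3 z = 1 - lam1 z - lam2 z" using elim by simp
        show "young_mean A z = a + c + - c * lam1 z"
          unfolding young_mean_def v l by (simp add: algebra_simps)
      qed
    qed
  qed (use c in simp_all)
qed

text \<open>The gap now lies between \<open>F bm\<close> and the minimum of \<open>vlim\<close> on
  \<open>K\<close>, capped at \<open>F ap\<close>, and only the third atom sees the increase
  \<open>c\<close>.\<close>

lemma lam3_constant_above:
  assumes \<phi>: "test_function U \<phi>" "U \<subseteq> D" and U: "continuous_on U vlim" "\<And>z. z \<in> U \<Longrightarrow> F bm < vlim z"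
  shows "(\<integral>z. lam3 z * D_t \<phi> z \<partial>lebesgue_on D) = 0"
proof -
  obtain K where K: "compact K" "K \<subseteq> U" "\<And>z. z \<notin> K \<Longrightarrow> \<phi> z = 0"
    using \<phi>(1) by (auto simp: test_function_def)
  have \<phi>0: "D_t \<phi> z = 0" if "z \<notin> K" for z
    unfolding D_t_test_function(1)[OF \<phi>(1)] using partial_deriv_eq_0[OF compact_imp_closed[OF K(1)] K(3) that] .
  obtain m where m: "F bm < m" "m \<le> F ap" "\<And>z. z \<in> K \<Longrightarrow> m \<le> vlim z"
  proof (cases "K = {}")
    case True
    then show thesis using that[of "F ap"] F_am_less by auto
  next
    case False
    then obtain y where y: "y \<in> K" "\<And>z. z \<in> K \<Longrightarrow> vlim y \<le> vlim z"
      using continuous_attains_inf[OF K(1) _ continuous_on_subset[OF U(1) K(2)]] by blast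
    have "F bm < vlim y" using U(2) y(1) K(2) by blast
    then show thesis using that[of "min (F ap) (vlim y)"] F_am_less y(2) by (auto simp: min_le_iff_disj)
  qed
  obtain A where A: "\<And>w. (A has_real_derivative tent (F bm) m (F w)) (at w)"
    using ex_antiderivative[of "\<lambda>w. tent (F bm) m (F w)"] continuous_on_compose2[OF continuous_tent F_cont] by blast
  obtain B where B: "\<And>w. (B has_real_derivative tent (F bm) m w) (at w)"
    using ex_antiderivative[OF continuous_tent] by blast
  obtain c a where c: "c > 0" and val: "\<And>r. m \<le> r \<Longrightarrow> A (S1 F ap r) = a \<and> A (S2 F ap bm r) = a \<and> A (S3 F bm r) = a + c"
    using tent_primitive_above[OF m(1,2) A] by blast
  have Bm: "B r = B m" if "m \<le> r" for r
    by (rule antiderivative_const[OF B], rule tent_eq_0) (use that in auto)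
  have "(\<integral>z. young_mean A z * D_t \<phi> z \<partial>lebesgue_on D) = 0"
  proof (rule time_derivative_young_mean_tent[OF \<phi> order_refl m(2) A B K])
    fix z assume "z \<in> K"
    then have "m \<le> vlim z" by (rule m(3))
    then show "tent (F bm) m (vlim z) = 0 \<and> B (vlim z) = B m" using Bm tent_eq_0 by blast
  qed
  then show ?thesis
  proof (rule young_mean_affine[OF \<phi>, of c lam3 A a, rotated 4])
    show "AE z in lebesgue_on D. \<bar>lam3 z\<bar> \<le> 1" using weights_bounded by eventually_elim simp
    show "AE z in lebesgue_on D. D_t \<phi> z \<noteq> 0 \<longrightarrow> young_mean A z = a + c * lam3 z"
      using weights
    proof eventually_elim
      case (elim z)
      show ?case
      proof
        assume "D_t \<phi> z \<noteq> 0"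
        then have "m \<le> vlim z" using \<phi>0 m(3) by blast
        from val[OF this] have v: "A (S1 F ap (vlim z)) = a" "A (S2 F ap bm (vlim z)) = a" "A (S3 F bm (vlim z)) = a + c"
          by auto
        have l: "lam1 z = 1 - lam2 z - lam3 z" using elim by simp
        show "young_mean A z = a + c * lam3 z"
          unfolding young_mean_def v l by (simp add: algebra_simps)
      qed
    qed
  qed (use c in simp_all)
qed

text \<open>For \<open>l = lam1\<close>, \<open>V\<close> is the part above \<open>f\<^sub>+\<close>; for \<open>l = lam3\<close>, it is the part below \<open>f\<^sub>-\<close>.\<close>
lemma integral_mult_D_t_split:
  assumes \<phi>: "test_function W' \<phi>" and UV: "W' = U \<union> V" "open U" "open V" "U \<inter> V = {}"
    and l: "AE z in lebesgue_on D. z \<in> V \<longrightarrow> l z = 0"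
  shows "test_function U (\<lambda>z. indicator U z * \<phi> z)"
    "(\<integral>z. l z * D_t \<phi> z \<partial>lebesgue_on D) = (\<integral>z. l z * D_t (\<lambda>z. indicator U z * \<phi> z) z \<partial>lebesgue_on D)"
proof -
  note s = test_function_disjoint_Un[OF \<phi>[unfolded UV(1)] UV(2-4)]
  show "test_function U (\<lambda>z. indicator U z * \<phi> z)" by (rule s(1))
  have \<phi>0: "D_t \<phi> z = 0" if "z \<notin> U \<union> V" for z
    using test_function_eq_0[OF D_t_test_function(2)[OF \<phi>]] that UV(1) by blast
  show "(\<integral>z. l z * D_t \<phi> z \<partial>lebesgue_on D) = (\<integral>z. l z * D_t (\<lambda>z. indicator U z * \<phi> z) z \<partial>lebesgue_on D)"
    unfolding s(2)
  proof (rule integral_cong_AE_complete[OF complete_D])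
    show "AE z in lebesgue_on D. l z * D_t \<phi> z = l z * (indicator U z * D_t \<phi> z)"
      using l
    proof eventually_elim
      case (elim z)
      then show ?case using \<phi>0[of z] by (cases "z \<in> U") auto
    qed
  qed
qed

text \<open>The excluded level cuts the support into two open pieces: on one the weight is 0 almost
  everywhere, on the other a tent fits. The claim for \<open>lam2\<close> follows from the sum of
  the weights and so excludes both levels.\<close>

lemma weights_time_derivative:
  assumes W: "open W" "W \<subseteq> D" "continuous_on W vlim"
  shows "test_function {z\<in>W. vlim z \<noteq> F ap} \<phi> \<Longrightarrow> (\<integral>z. lam1 z * D_t \<phi> z \<partial>lebesgue_on D) = 0"
    and "test_function {z\<in>W. vlim z \<noteq> F bm} \<phi> \<Longrightarrow> (\<integral>z. lam3 z * D_t \<phi> z \<partial>lebesgue_on D) = 0"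
    and "test_function {z\<in>W. vlim z \<noteq> F bm \<and> vlim z \<noteq> F ap} \<phi> \<Longrightarrow> (\<integral>z. lam2 z * D_t \<phi> z \<partial>lebesgue_on D) = 0"
proof -
  have opn: "open (W \<inter> vlim -` {..<r})" "open (W \<inter> vlim -` {r<..})" for r
    by (intro continuous_open_preimage[OF W(3,1)]; simp)+
  have cont: "continuous_on (W \<inter> S) vlim" for S using W(3) continuous_on_subset by blast
  show 1: "(\<integral>z. lam1 z * D_t \<phi> z \<partial>lebesgue_on D) = 0" if \<phi>: "test_function {z\<in>W. vlim z \<noteq> F ap} \<phi>" for \<phi>
  proof -
    let ?U = "W \<inter> vlim -` {..<F ap}" and ?V = "W \<inter> vlim -` {F ap<..}"
    have l: "AE z in lebesgue_on D. z \<in> ?V \<longrightarrow> lam1 z = 0" using weights_above by eventually_elim auto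
    have Un: "{z\<in>W. vlim z \<noteq> F ap} = ?U \<union> ?V" by auto
    note s = integral_mult_D_t_split[OF \<phi> Un opn _ l]
    have "(\<integral>z. lam1 z * D_t (\<lambda>z. indicator ?U z * \<phi> z) z \<partial>lebesgue_on D) = 0"
      by (rule lam1_constant_below[OF s(1) _ cont]) (use W in auto)
    then show ?thesis using s(2) by fastforce
  qed
  show 3: "(\<integral>z. lam3 z * D_t \<phi> z \<partial>lebesgue_on D) = 0" if \<phi>: "test_function {z\<in>W. vlim z \<noteq> F bm} \<phi>" for \<phi>
  proof -
    let ?U = "W \<inter> vlim -` {F bm<..}" and ?V = "W \<inter> vlim -` {..<F bm}"
    have l: "AE z in lebesgue_on D. z \<in> ?V \<longrightarrow> lam3 z = 0" using weights_below by eventually_elim auto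
    have Un: "{z\<in>W. vlim z \<noteq> F bm} = ?U \<union> ?V" by auto
    note s = integral_mult_D_t_split[OF \<phi> Un opn(2) opn(1) _ l]
    have "(\<integral>z. lam3 z * D_t (\<lambda>z. indicator ?U z * \<phi> z) z \<partial>lebesgue_on D) = 0"
      by (rule lam3_constant_above[OF s(1) _ cont]) (use W in auto)
    then show ?thesis using s(2) by fastforce
  qed
  show "(\<integral>z. lam2 z * D_t \<phi> z \<partial>lebesgue_on D) = 0"
    if \<phi>: "test_function {z\<in>W. vlim z \<noteq> F bm \<and> vlim z \<noteq> F ap} \<phi>" for \<phi>
  proof -
    have \<phi>1: "test_function {z\<in>W. vlim z \<noteq> F ap} \<phi>" and \<phi>3: "test_function {z\<in>W. vlim z \<noteq> F bm} \<phi>"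
      and \<phi>D: "test_function D \<phi>"
      using \<phi> W(2) by (auto elim!: test_function_mono)
    note \<phi>' = integral_D_t_test_function[OF \<phi>D subset_refl open_D]
    have int: "integrable (lebesgue_on D) (\<lambda>z. lam1 z * D_t \<phi> z)" "integrable (lebesgue_on D) (\<lambda>z. lam3 z * D_t \<phi> z)"
      by (rule integrable_bounded_mult[OF _ _ \<phi>'(1), of _ 1], measurable,
          use weights_bounded in \<open>eventually_elim, simp\<close>)+
    have "(\<integral>z. lam2 z * D_t \<phi> z \<partial>lebesgue_on D)
        = (\<integral>z. D_t \<phi> z - lam1 z * D_t \<phi> z - lam3 z * D_t \<phi> z \<partial>lebesgue_on D)"
    proof (rule integral_cong_AE_complete[OF complete_D])
      show "AE z in lebesgue_on D. lam2 z * D_t \<phi> z = D_t \<phi> z - lam1 z * D_t \<phi> z - lam3 z * D_t \<phi> z"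
        using weights
      proof eventually_elim
        case (elim z)
        then have l: "lam2 z = 1 - lam1 z - lam3 z" by simp
        show ?case unfolding l by (simp add: algebra_simps)
      qed
    qed
    also have "\<dots> = 0" using int \<phi>' 1[OF \<phi>1] 3[OF \<phi>3] by simp
    finally show ?thesis .
  qed
qed

end

section \<open>Functions of \<open>(t, x, \<xi>)\<close>\<close>

lemma box_Pair_eq: "box (a, c) (b, d) = box a b \<times> box c d"
  by (auto simp: mem_box Basis_prod_def ball_Un)

lemma emeasure_lborel_Times:
  fixes A :: "'a::euclidean_space set" and B :: "'b::euclidean_space set"
  assumes "A \<in> sets borel" "B \<in> sets borel"
  shows "emeasure lborel (A \<times> B) = emeasure lborel A * emeasure lborel B"
proof -
  have "emeasure lborel (A \<times> B) = emeasure (lborel \<Otimes>\<^sub>M lborel) (A \<times> B)"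
    by (simp add: lborel_prod)
  also have "\<dots> = emeasure lborel A * emeasure lborel B"
    using assms by (intro lborel.emeasure_pair_measure_Times) auto
  finally show ?thesis .
qed

text \<open>Triples are nested to the right, whereas Fubini has to separate \<open>\<xi>\<close>
  from the pair \<open>(t, x)\<close>. Agreement on boxes identifies Lebesgue measure with the image
  of the left-nested product under reassociation.\<close>

lemma lborel_triple:
  "(lborel :: (real \<times> 'a::euclidean_space \<times> real) measure)
    = distr (lborel \<Otimes>\<^sub>M lborel) borel (\<lambda>w. (fst (fst w), snd (fst w), snd w))"
proof (rule lborel_eqI)
  let ?a = "\<lambda>w :: (real \<times> 'a) \<times> real. (fst (fst w), snd (fst w), snd w)"
  have a: "?a \<in> (lborel \<Otimes>\<^sub>M lborel) \<rightarrow>\<^sub>M borel"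
    unfolding lborel_prod by (simp add: borel_measurable_continuous_onI continuous_intros)
  fix l u :: "real \<times> 'a \<times> real" assume lu: "\<And>b. b \<in> Basis \<Longrightarrow> l \<bullet> b \<le> u \<bullet> b"
  obtain l1 l2 l3 where l: "l = (l1, l2, l3)" by (cases l) auto
  obtain u1 u2 u3 where u: "u = (u1, u2, u3)" by (cases u) auto
  have pre: "?a -` box l u = box (l1, l2) (u1, u2) \<times> box l3 u3"
    by (auto simp: l u box_Pair_eq)
  have "emeasure (distr (lborel \<Otimes>\<^sub>M lborel) borel ?a) (box l u)
      = emeasure (lborel \<Otimes>\<^sub>M lborel) (box (l1, l2) (u1, u2) \<times> box l3 u3)"
    by (subst emeasure_distr[OF a]) (simp_all add: pre space_pair_measure del: box_real)
  also have "\<dots> = emeasure lborel (box l1 u1) * emeasure lborel (box l2 u2) * emeasure lborel (box l3 u3)"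
    unfolding lborel_prod box_Pair_eq[of l1 l2] by (simp add: emeasure_lborel_Times borel_Times del: box_real)
  also have "\<dots> = emeasure lborel (box l u)"
    unfolding l u box_Pair_eq by (simp add: emeasure_lborel_Times borel_Times ac_simps del: box_real)
  also have "\<dots> = (\<Prod>b\<in>Basis. (u - l) \<bullet> b)" by (rule emeasure_lborel_box[OF lu])
  finally show "emeasure (distr (lborel \<Otimes>\<^sub>M lborel) borel ?a) (box l u) = (\<Prod>b\<in>Basis. (u - l) \<bullet> b)" .
qed simp

lemma assoc3_measurable:
  "(\<lambda>w :: (real \<times> 'a::euclidean_space) \<times> real. (fst (fst w), snd (fst w), snd w)) \<in> (lborel \<Otimes>\<^sub>M lborel) \<rightarrow>\<^sub>M borel"
  unfolding lborel_prod by (simp add: borel_measurable_continuous_onI continuous_intros)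

lemma AE_lborel_triple_section:
  fixes P :: "real \<times> 'a::euclidean_space \<times> real \<Rightarrow> bool"
  assumes "AE w in lborel. P w"
  shows "AE z in lborel. AE l in lborel. P (fst z, snd z, l)"
proof -
  have "AE w in lborel \<Otimes>\<^sub>M lborel. P (fst (fst w), snd (fst w), snd w)"
    by (rule AE_distrD[OF assoc3_measurable assms[unfolded lborel_triple]])
  from lborel_pair.AE_pair[OF this] show ?thesis by simp
qed

lemma AE_lborel_triple_cylinder:
  fixes P :: "real \<times> 'a::euclidean_space \<Rightarrow> bool"
  assumes "AE z in lborel. P z"
  shows "AE w in (lborel :: (real \<times> 'a \<times> real) measure). P (fst w, fst (snd w))"
proof -
  \<comment> \<open>The exceptional set itself may fail to be measurable; the product criterion is
    applied to a Borel null set that contains it.\<close>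
  obtain N where N: "N \<in> null_sets lborel" "{z. \<not> P z} \<subseteq> N"
    using assms by (auto simp: eventually_ae_filter)
  then have Nb: "N \<in> sets borel" by (auto simp: null_sets_def)
  have m: "(\<lambda>w :: real \<times> 'a \<times> real. (fst w, fst (snd w))) \<in> borel_measurable borel"
    by (intro borel_measurable_continuous_onI continuous_intros)
  have set: "{w \<in> space borel. (fst w, fst (snd w)) \<notin> N} \<in> sets (borel :: (real \<times> 'a \<times> real) measure)"
    using measurable_sets[OF m, of "- N"] Nb by (simp add: vimage_def)
  have "AE w in distr (lborel \<Otimes>\<^sub>M lborel) borel (\<lambda>w :: (real \<times> 'a) \<times> real. (fst (fst w), snd (fst w), snd w)).
      (fst w, fst (snd w)) \<notin> N"
  proof (subst AE_distr_iff[OF assoc3_measurable set])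
    have "{w \<in> space (lborel \<Otimes>\<^sub>M lborel). fst w \<notin> N} \<in> sets (lborel \<Otimes>\<^sub>M (lborel :: real measure))"
      using measurable_sets[OF measurable_fst, of "- N" lborel lborel] Nb
      by (simp add: vimage_def space_pair_measure)
    moreover have "AE z in lborel. AE l in (lborel :: real measure). fst (z, l) \<notin> N"
      using AE_not_in[OF N(1)] by eventually_elim simp
    ultimately have "AE w in lborel \<Otimes>\<^sub>M (lborel :: real measure). fst w \<notin> N"
      by (rule lborel_pair.AE_pair_measure)
    then show "AE w in lborel \<Otimes>\<^sub>M lborel.
        (fst (fst (fst w), snd (fst w), snd w), fst (snd (fst (fst w), snd (fst w), snd (w :: (real \<times> 'a) \<times> real)))) \<notin> N"
      by simp
  qed
  then show ?thesis unfolding lborel_triple[symmetric] by eventually_elim (use N in auto)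
qed

lemma
  fixes g :: "real \<times> 'a::euclidean_space \<times> real \<Rightarrow> real"
  assumes g: "integrable lborel g"
  shows AE_integrable_section: "AE z in lborel. integrable lborel (\<lambda>l. g (fst z, snd z, l))"
    and integrable_integral_section: "integrable lborel (\<lambda>z. \<integral>l. g (fst z, snd z, l) \<partial>lborel)"
    and integral_integral_section: "(\<integral>z. (\<integral>l. g (fst z, snd z, l) \<partial>lborel) \<partial>lborel) = (\<integral>w. g w \<partial>lborel)"
proof -
  have gm: "g \<in> borel_measurable borel" using borel_measurable_integrable[OF g] by simp
  have i: "integrable (lborel \<Otimes>\<^sub>M lborel) (\<lambda>w. g (fst (fst w), snd (fst w), snd w))"
    using g unfolding lborel_triple by (subst (asm) integrable_distr_eq[OF assoc3_measurable gm])
  show "AE z in lborel. integrable lborel (\<lambda>l. g (fst z, snd z, l))"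
    using lborel_pair.AE_integrable_fst'[OF i] by simp
  show "integrable lborel (\<lambda>z. \<integral>l. g (fst z, snd z, l) \<partial>lborel)"
    using lborel_pair.integrable_fst'[OF i] by simp
  show "(\<integral>z. (\<integral>l. g (fst z, snd z, l) \<partial>lborel) \<partial>lborel) = (\<integral>w. g w \<partial>lborel)"
  proof -
    have "(\<integral>w. g w \<partial>lborel) = (\<integral>w. g (fst (fst w), snd (fst w), snd w) \<partial>(lborel \<Otimes>\<^sub>M lborel))"
      unfolding lborel_triple by (rule integral_distr[OF assoc3_measurable gm])
    then show ?thesis using lborel_pair.integral_fst'[OF i] by simp
  qed
qed

text \<open>The weights and limits are Lebesgue measurable, while the product measure behind Fubini
  lives on Borel sets. Setting the function to 0 outside \<open>S\<close> gives a version on the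
  whole space.\<close>

lemma ex_borel_version:
  fixes f :: "'a::euclidean_space \<Rightarrow> real"
  assumes S: "S \<in> sets lebesgue" and f: "f \<in> borel_measurable (lebesgue_on S)"
  obtains f' where "f' \<in> borel_measurable borel" "AE z in lborel. indicator S z * f z = f' z"
proof -
  have "(\<lambda>z. indicator S z * f z) \<in> borel_measurable lebesgue"
    using f S by (simp add: borel_measurable_restrict_space_iff)
  from completion_ex_borel_measurable_real[OF this] show thesis using that by auto
qed

lemma AE_lebesgue_on_iff:
  assumes "S \<in> sets lebesgue"
  shows "(AE z in lebesgue_on S. P z) \<longleftrightarrow> (AE z in lborel. z \<in> S \<longrightarrow> P z)"
  using assms by (simp add: AE_restrict_space_iff AE_completion_iff)

lemma integrable_cong_AE_complete:
  fixes f g :: "'a \<Rightarrow> 'b::{banach, second_countable_topology}"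
  assumes M: "complete_measure M" and ae: "AE x in M. f x = g x" and f: "integrable M f"
  shows "integrable M g"
  using integrable_cong_AE[OF _ _ ae] borel_measurable_cong_AE_complete[OF M ae] f
    borel_measurable_integrable[OF f] by blast

text \<open>All four facts are proved for a Borel version \<open>g'\<close>, in which the
  coefficient and both endpoints of the layer are replaced almost everywhere, and carried back
  through completion. The bound on \<open>c\<close> lets \<open>\<zeta>\<close> dominate.\<close>

lemma
  fixes D :: "(real \<times> 'a::euclidean_space) set" and c a b :: "real \<times> 'a \<Rightarrow> real" and Q :: "(real \<times> 'a \<times> real) set"
    and \<zeta> :: "real \<times> 'a \<times> real \<Rightarrow> real"
  assumes D: "D \<in> sets borel" and Q: "Q = {(t, x, \<xi>). (t, x) \<in> D}"
    and meas: "c \<in> borel_measurable (lebesgue_on D)" "a \<in> borel_measurable (lebesgue_on D)"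
      "b \<in> borel_measurable (lebesgue_on D)"
    and c: "AE z in lebesgue_on D. \<bar>c z\<bar> \<le> 1"
    and \<zeta>: "integrable lborel \<zeta>"
  defines "g \<equiv> \<lambda>(t, x, l). c (t, x) * indicator {a (t, x)..b (t, x)} l * \<zeta> (t, x, l)"
  shows layer_integrable: "integrable (lebesgue_on Q) g"
    and layer_section_integrable: "AE z in lebesgue_on D. integrable lborel (\<lambda>l. g (fst z, snd z, l))"
    and layer_integral_integrable: "integrable (lebesgue_on D) (\<lambda>z. \<integral>l. g (fst z, snd z, l) \<partial>lborel)"
    and layer_Fubini: "(\<integral>w. g w \<partial>lebesgue_on Q) = (\<integral>z. (\<integral>l. g (fst z, snd z, l) \<partial>lborel) \<partial>lebesgue_on D)"
proof -
  have DL: "D \<in> sets lebesgue" using D by simp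
  have \<zeta>m [measurable]: "\<zeta> \<in> borel_measurable borel" using borel_measurable_integrable[OF \<zeta>] by simp
  obtain c' where c': "c' \<in> borel_measurable borel" "AE z in lborel. indicator D z * c z = c' z"
    using ex_borel_version[OF DL meas(1)] by blast
  obtain a' where a': "a' \<in> borel_measurable borel" "AE z in lborel. indicator D z * a z = a' z"
    using ex_borel_version[OF DL meas(2)] by blast
  obtain b' where b': "b' \<in> borel_measurable borel" "AE z in lborel. indicator D z * b z = b' z"
    using ex_borel_version[OF DL meas(3)] by blast
  define pr where "pr = (\<lambda>w :: real \<times> 'a \<times> real. (fst w, fst (snd w)))"
  have pr [measurable]: "pr \<in> borel_measurable borel"
    unfolding pr_def by (intro borel_measurable_continuous_onI continuous_intros)
  have ht [measurable]: "(\<lambda>w :: real \<times> 'a \<times> real. snd (snd w)) \<in> borel_measurable borel"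
    by (intro borel_measurable_continuous_onI continuous_intros)
  note [measurable] = measurable_compose[OF pr c'(1)] measurable_compose[OF pr a'(1)] measurable_compose[OF pr b'(1)]
  have [measurable]: "(\<lambda>w. indicator D (pr w) :: real) \<in> borel_measurable borel"
    by (rule measurable_compose[OF pr]) (use D in auto)
  define g' where "g' w = indicator D (pr w) * (c' (pr w) * (if a' (pr w) \<le> snd (snd w) \<and> snd (snd w) \<le> b' (pr w) then 1 else 0) * \<zeta> w)" for w
  have g'm [measurable]: "g' \<in> borel_measurable borel" unfolding g'_def by measurable
  have coef: "AE z in lborel. z \<in> D \<longrightarrow> c z = c' z \<and> a z = a' z \<and> b z = b' z \<and> \<bar>c' z\<bar> \<le> 1"
    using c'(2) a'(2) b'(2) c[unfolded AE_lebesgue_on_iff[OF DL]] by eventually_elim auto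
  have sec: "g (fst z, snd z, l) = g' (fst z, snd z, l)"
    if "z \<in> D" "c z = c' z \<and> a z = a' z \<and> b z = b' z \<and> \<bar>c' z\<bar> \<le> 1" for z l
    using that by (cases z) (auto simp: g_def g'_def pr_def indicator_def)
  have AEw: "AE w in lborel. pr w \<in> D \<longrightarrow> c (pr w) = c' (pr w) \<and> a (pr w) = a' (pr w) \<and> b (pr w) = b' (pr w) \<and> \<bar>c' (pr w)\<bar> \<le> 1"
    using AE_lborel_triple_cylinder[OF coef] by (simp add: pr_def)
  have QD: "w \<in> Q \<longleftrightarrow> pr w \<in> D" for w by (cases w) (auto simp: Q pr_def)
  have Qb: "Q \<in> sets borel"
  proof -
    have "Q = pr -` D \<inter> space borel" using QD by auto
    then show ?thesis using measurable_sets[OF pr D] by simp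
  qed
  then have QL: "Q \<in> sets lebesgue" by simp
  have eq: "AE w in lborel. indicator Q w * g w = g' w"
    using AEw
  proof eventually_elim
    case (elim w)
    obtain t x l where w: "w = (t, x, l)" by (cases w) auto
    show ?case
    proof (cases "w \<in> Q")
      case True
      then show ?thesis using sec[of "(t, x)" l] elim QD[of w] by (simp add: w pr_def)
    qed (use QD[of w] in \<open>simp add: g'_def\<close>)
  qed
  have g'i: "integrable lborel g'"
  proof (rule Bochner_Integration.integrable_bound[OF \<zeta>])
    show "AE w in lborel. norm (g' w) \<le> norm (\<zeta> w)"
      using AEw
    proof eventually_elim
      case (elim w)
      show ?case
      proof (cases "pr w \<in> D")
        case True
        then have "\<bar>c' (pr w)\<bar> * \<bar>\<zeta> w\<bar> \<le> 1 * \<bar>\<zeta> w\<bar>" using elim by (intro mult_right_mono) auto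
        then show ?thesis using True by (simp add: g'_def abs_mult)
      qed (simp add: g'_def)
    qed
  qed simp
  have g'L: "integrable lebesgue g'" using g'i by (simp add: integrable_completion)
  have eqL: "AE w in lebesgue. g' w = indicator Q w * g w"
    using AE_completion[OF eq] by eventually_elim simp
  have "integrable lebesgue (\<lambda>w. indicator Q w * g w)"
    by (rule integrable_cong_AE_complete[OF completion.complete_measure_axioms eqL g'L])
  then show gi: "integrable (lebesgue_on Q) g" using QL by (simp add: integrable_restrict_space)
  have I: "(\<integral>w. g w \<partial>lebesgue_on Q) = (\<integral>w. g' w \<partial>lborel)"
  proof -
    have "(\<integral>w. g w \<partial>lebesgue_on Q) = (\<integral>w. indicator Q w * g w \<partial>lebesgue)"
      using QL by (simp add: integral_restrict_space)
    also have "\<dots> = (\<integral>w. g' w \<partial>lebesgue)"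
      by (rule integral_cong_AE_complete[OF completion.complete_measure_axioms])
         (use eqL in \<open>eventually_elim, simp\<close>)
    finally show ?thesis by (simp add: integral_completion)
  qed
  show "AE z in lebesgue_on D. integrable lborel (\<lambda>l. g (fst z, snd z, l))"
    unfolding AE_lebesgue_on_iff[OF DL]
    using AE_integrable_section[OF g'i] coef
    by eventually_elim (simp add: sec)
  have J: "AE z in lborel. (\<integral>l. g' (fst z, snd z, l) \<partial>lborel) = indicator D z * (\<integral>l. g (fst z, snd z, l) \<partial>lborel)"
    using coef
  proof eventually_elim
    case (elim z)
    show ?case
    proof (cases "z \<in> D")
      case True
      then show ?thesis using elim by (simp add: sec)
    qed (simp add: g'_def pr_def)
  qed
  note JL = AE_completion[OF J]
  have i2: "integrable lebesgue (\<lambda>z. \<integral>l. g' (fst z, snd z, l) \<partial>lborel)"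
    and e2: "(\<integral>z. (\<integral>l. g' (fst z, snd z, l) \<partial>lborel) \<partial>lebesgue) = (\<integral>w. g' w \<partial>lborel)"
    using integrable_integral_section[OF g'i] integral_integral_section[OF g'i]
      borel_measurable_integrable[OF integrable_integral_section[OF g'i]]
    by (simp_all add: integrable_completion integral_completion)
  have "integrable lebesgue (\<lambda>z. indicator D z * (\<integral>l. g (fst z, snd z, l) \<partial>lborel))"
    by (rule integrable_cong_AE_complete[OF completion.complete_measure_axioms JL i2])
  then show "integrable (lebesgue_on D) (\<lambda>z. \<integral>l. g (fst z, snd z, l) \<partial>lborel)"
    using DL by (simp add: integrable_restrict_space)
  have "(\<integral>z. (\<integral>l. g (fst z, snd z, l) \<partial>lborel) \<partial>lebesgue_on D)
      = (\<integral>z. indicator D z * (\<integral>l. g (fst z, snd z, l) \<partial>lborel) \<partial>lebesgue)"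
    using DL by (simp add: integral_restrict_space)
  also have "\<dots> = (\<integral>z. (\<integral>l. g' (fst z, snd z, l) \<partial>lborel) \<partial>lebesgue)"
    by (rule integral_cong_AE_complete[OF completion.complete_measure_axioms])
       (use JL in \<open>eventually_elim, simp\<close>)
  finally show "(\<integral>w. g w \<partial>lebesgue_on Q) = (\<integral>z. (\<integral>l. g (fst z, snd z, l) \<partial>lborel) \<partial>lebesgue_on D)"
    using I e2 by simp
qed

text \<open>The density \<open>1 + f / (1 + C)\<close> reproduces Lebesgue measure on boxes, hence equals \<open>1\<close>.\<close>
lemma AE_eq_0_if_box_integrals_0:
  fixes f :: "'a::euclidean_space \<Rightarrow> real"
  assumes f: "f \<in> borel_measurable borel" "\<And>z. \<bar>f z\<bar> \<le> C"
    and box: "\<And>l u. (\<integral>z. indicator (box l u) z * f z \<partial>lborel) = 0"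
  shows "AE z in lborel. f z = 0"
proof -
  note [measurable] = f(1)
  have C: "C \<ge> 0" using f(2) abs_ge_zero order_trans by blast
  \<comment> \<open>Since \<open>\<bar>f z\<bar> \<le> C < 1 + C\<close>, this density is
    nonnegative, also for \<open>C = 0\<close>.\<close>
  define r where "r z = 1 + f z / (1 + C)" for z
  have [measurable]: "r \<in> borel_measurable borel" unfolding r_def by measurable
  have r0: "0 \<le> r z" "r z \<le> 2" for z
    using f(2)[of z] C by (auto simp: r_def field_simps abs_le_iff)
  have "lborel = density lborel r"
  proof (rule lborel_eqI)
    fix l u :: 'a assume lu: "\<And>b. b \<in> Basis \<Longrightarrow> l \<bullet> b \<le> u \<bullet> b"
    have fin: "emeasure lborel (box l u) < \<infinity>" by (intro emeasure_bounded_finite bounded_box)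
    have i1: "integrable lborel (indicator (box l u) :: 'a \<Rightarrow> real)"
      using fin by (intro integrable_real_indicator) auto
    have i2: "integrable lborel (\<lambda>z. indicator (box l u) z * f z)"
    proof (rule Bochner_Integration.integrable_bound)
      show "integrable lborel (\<lambda>z. C * indicator (box l u) z)" using i1 by (rule integrable_mult_right)
      show "AE z in lborel. norm (indicator (box l u) z * f z) \<le> norm (C * indicator (box l u) z)"
        using f(2) C by (auto simp: indicator_def)
    qed simp
    have eq: "r z * indicator (box l u) z = indicator (box l u) z + (indicator (box l u) z * f z) / (1 + C)" for z
      by (simp add: r_def algebra_simps)
    have "emeasure (density lborel r) (box l u) = (\<integral>\<^sup>+ z. ennreal (r z * indicator (box l u) z) \<partial>lborel)"
      by (subst emeasure_density) (auto simp: ennreal_mult' r0 intro!: nn_integral_cong split: split_indicator)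
    also have "\<dots> = ennreal (\<integral>z. r z * indicator (box l u) z \<partial>lborel)"
    proof (rule nn_integral_eq_integral)
      show "integrable lborel (\<lambda>z. r z * indicator (box l u) z)" unfolding eq using i1 i2 by simp
    qed (use r0 in simp)
    also have "(\<integral>z. r z * indicator (box l u) z \<partial>lborel) = measure lborel (box l u)"
      unfolding eq using i1 i2 box by simp
    also have "ennreal (measure lborel (box l u)) = emeasure lborel (box l u)"
      using fin by (simp add: emeasure_eq_ennreal_measure)
    also have "\<dots> = (\<Prod>b\<in>Basis. (u - l) \<bullet> b)" by (rule emeasure_lborel_box[OF lu])
    finally show "emeasure (density lborel r) (box l u) = (\<Prod>b\<in>Basis. (u - l) \<bullet> b)" .
  qed simp
  then have "density lborel (\<lambda>z. ennreal (r z)) = density lborel (\<lambda>_. 1)" by (simp add: density_1)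
  then have "AE z in lborel. ennreal (r z) = 1"
    by (intro sigma_finite_measure.density_unique[OF sigma_finite_lborel]) auto
  then show ?thesis
  proof eventually_elim
    case (elim z)
    then have "r z = 1" using r0 by (simp add: ennreal_eq_1)
    then show ?case using C by (simp add: r_def)
  qed
qed

section \<open>Identification of \<open>p\<close> and \<open>q\<close>\<close>

text \<open>The length of \<open>{0..w}\<close> inside \<open>{c<..<d}\<close>. In \<open>w\<close>
  it is continuous and bounded, so a Young measure can be tested with it, and 1-Lipschitz, so strong
  convergence passes through it.\<close>

definition layer_measure :: "real \<Rightarrow> real \<Rightarrow> real \<Rightarrow> real" where
  "layer_measure c d w = max 0 (min w d - max 0 c)"

lemma integral_layer:
  "(\<integral>l. indicator {0..w} l * indicator {c<..<d} l \<partial>lborel) = layer_measure c d w"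
proof -
  have "(\<integral>l. indicator {0..w} l * indicator {c<..<d} l \<partial>lborel) = (\<integral>l. indicator {max 0 c..min w d} l \<partial>(lborel :: real measure) :: real)"
  proof (rule integral_cong_AE)
    show "AE l in lborel. indicator {0..w} l * indicator {c<..<d} l = (indicator {max 0 c..min w d} l :: real)"
      using AE_lborel_singleton[of c] AE_lborel_singleton[of d]
      by eventually_elim (auto simp: indicator_def)
  qed auto
  also have "\<dots> = layer_measure c d w"
  proof (cases "max 0 c \<le> min w d")
    case False
    have "layer_measure c d w = 0"
      using False unfolding layer_measure_def by (intro max_absorb1) linarith
    then show ?thesis using False by simp
  qed (simp add: layer_measure_def)
  finally show ?thesis .
qed

lemma layer_measure_lipschitz: "\<bar>layer_measure c d r - layer_measure c d s\<bar> \<le> 1 * \<bar>r - s\<bar>"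
proof -
  have "\<bar>max 0 x - max 0 y\<bar> \<le> \<bar>x - y\<bar>" for x y :: real by linarith
  from this[of "min r d - max 0 c" "min s d - max 0 c"]
  have "\<bar>layer_measure c d r - layer_measure c d s\<bar> \<le> \<bar>min r d - min s d\<bar>"
    by (simp add: layer_measure_def)
  also have "\<dots> \<le> \<bar>r - s\<bar>" by linarith
  finally show ?thesis by simp
qed

lemma layer_measure_bounded: "bounded (range (layer_measure c d))"
proof -
  have "\<bar>layer_measure c d w\<bar> \<le> \<bar>d - max 0 c\<bar>" for w unfolding layer_measure_def by linarith
  then show ?thesis unfolding bounded_iff by auto
qed

lemma layer_measure_continuous: "continuous_on UNIV (layer_measure c d)"
  unfolding layer_measure_def by (intro continuous_intros)

section \<open>Box tests for the weak limits\<close>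

context limit_system
begin

definition Q :: "(real \<times> 'a \<times> real) set" where "Q = {(t, x, \<xi>). (t, x) \<in> D}"

lemma Q_eq: "Q = {0<..<T} \<times> \<Omega> \<times> UNIV"
  by (subst Q_def) (auto simp: D_def)

lemma D_borel: "D \<in> sets borel" using open_D by (rule borel_open)

lemma Q_open: "open Q"
  unfolding Q_eq using domain by (intro open_Times) auto

lemma Q_lebesgue: "Q \<in> sets lebesgue"
  using borel_open[OF Q_open] by simp

lemmas layer = layer_integrable[OF D_borel Q_def] layer_section_integrable[OF D_borel Q_def]
  layer_integral_integrable[OF D_borel Q_def] layer_Fubini[OF D_borel Q_def]

lemma integrable_box: "integrable lborel (indicator (box l r) :: 'b::euclidean_space \<Rightarrow> real)"
  by (intro integrable_real_indicator emeasure_bounded_finite bounded_box) auto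

lemma integrable_box_on:
  "S \<in> sets lebesgue \<Longrightarrow> integrable (lebesgue_on S) (indicator (box l r) :: 'b::euclidean_space \<Rightarrow> real)"
proof -
  assume S: "S \<in> sets lebesgue"
  have "integrable lebesgue (indicator (box l r) :: 'b \<Rightarrow> real)"
    using integrable_box by (simp add: integrable_completion)
  then show ?thesis using integrable_restrict_UNIV S
    by (metis (no_types, lifting) integrable_mult_indicator integrable_restrict_space sets.Int_space_eq2 space_completion space_lborel inf_top.right_neutral)
qed

text \<open>A box factorises, so integrating out \<open>\<xi>\<close> leaves a box in
  \<open>(t, x)\<close> weighted by the length of the layer. Weak limits in
  \<open>(t, x, \<xi>)\<close> thus become limits of functions of \<open>u\<close> or of
  \<open>v\<close> alone.\<close>

lemma integral_layer_box:
  fixes c b :: "real \<times> 'a \<Rightarrow> real"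
  assumes meas: "c \<in> borel_measurable (lebesgue_on D)" "b \<in> borel_measurable (lebesgue_on D)"
    and c: "AE z in lebesgue_on D. \<bar>c z\<bar> \<le> 1"
  shows "integrable (lebesgue_on Q) (\<lambda>(t, x, \<xi>). c (t, x) * indicator {0..b (t, x)} \<xi> * indicator (box (l1, l2, l3) (u1, u2, u3)) (t, x, \<xi>))"
    "(\<integral>w. (case w of (t, x, \<xi>) \<Rightarrow> c (t, x) * indicator {0..b (t, x)} \<xi> * indicator (box (l1, l2, l3) (u1, u2, u3)) (t, x, \<xi>)) \<partial>lebesgue_on Q)
     = (\<integral>z. c z * layer_measure l3 u3 (b z) * indicator (box (l1, l2) (u1, u2)) z \<partial>lebesgue_on D)"
proof -
  note L = layer[OF meas(1) _ meas(2) c integrable_box, of "\<lambda>_. 0" "(l1, l2, l3)" "(u1, u2, u3)"]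
  show "integrable (lebesgue_on Q) (\<lambda>(t, x, \<xi>). c (t, x) * indicator {0..b (t, x)} \<xi> * indicator (box (l1, l2, l3) (u1, u2, u3)) (t, x, \<xi>))"
    using L(1) by simp
  have "(\<integral>l. c z * indicator {0..b z} l * indicator (box (l1, l2, l3) (u1, u2, u3)) (fst z, snd z, l) \<partial>lborel)
     = c z * layer_measure l3 u3 (b z) * indicator (box (l1, l2) (u1, u2)) z" for z
  proof -
    have "c z * indicator {0..b z} l * indicator (box (l1, l2, l3) (u1, u2, u3)) (fst z, snd z, l)
        = (c z * indicator (box (l1, l2) (u1, u2)) z) * (indicator {0..b z} l * indicator {l3<..<u3} l)" for l
      by (cases z) (auto simp: box_Pair_eq indicator_def)
    then have "(\<integral>l. c z * indicator {0..b z} l * indicator (box (l1, l2, l3) (u1, u2, u3)) (fst z, snd z, l) \<partial>lborel)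
        = (\<integral>l. (c z * indicator (box (l1, l2) (u1, u2)) z) * (indicator {0..b z} l * indicator {l3<..<u3} l) \<partial>lborel)"
      by (simp only:)
    also have "\<dots> = (c z * indicator (box (l1, l2) (u1, u2)) z) * layer_measure l3 u3 (b z)"
      by (simp only: integral_mult_right_zero integral_layer)
    finally show ?thesis by (simp only: ac_simps)
  qed
  then show "(\<integral>w. (case w of (t, x, \<xi>) \<Rightarrow> c (t, x) * indicator {0..b (t, x)} \<xi> * indicator (box (l1, l2, l3) (u1, u2, u3)) (t, x, \<xi>)) \<partial>lebesgue_on Q)
     = (\<integral>z. c z * layer_measure l3 u3 (b z) * indicator (box (l1, l2) (u1, u2)) z \<partial>lebesgue_on D)"
    using L(4) by simp
qed

text \<open>The difference of the two candidates has vanishing box integrals. It is bounded only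
  almost everywhere, so it is truncated, first as given and then again in its Borel version, because
  the box criterion asks for a bound at every point.\<close>

lemma weak_star_limit_unique:
  assumes p: "weak_star_limit Q w p" and P: "P \<in> borel_measurable (lebesgue_on Q)" "AE z in lebesgue_on Q. \<bar>P z\<bar> \<le> C"
    and lim: "\<And>l r. (\<lambda>k. \<integral>z. w k z * indicator (box l r) z \<partial>lebesgue_on Q) \<longlonglongrightarrow> (\<integral>z. P z * indicator (box l r) z \<partial>lebesgue_on Q)"
  shows "AE z in lebesgue_on Q. p z = P z"
proof -
  obtain C' where pm: "p \<in> borel_measurable (lebesgue_on Q)" and pC: "AE z in lebesgue_on Q. \<bar>p z\<bar> \<le> C'"
    using p by (auto simp: weak_star_limit_def)
  have box: "(\<integral>z. p z * indicator (box l r) z \<partial>lebesgue_on Q) = (\<integral>z. P z * indicator (box l r) z \<partial>lebesgue_on Q)" for l r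
    using p integrable_box_on[OF Q_lebesgue] unfolding weak_star_limit_def
    by (intro LIMSEQ_unique[OF _ lim]) blast
  have int: "integrable (lebesgue_on Q) (\<lambda>z. h z * indicator (box l r) z)"
    if h: "h \<in> borel_measurable (lebesgue_on Q)" "AE z in lebesgue_on Q. \<bar>h z\<bar> \<le> C" for h :: "real \<times> 'a \<times> real \<Rightarrow> real" and C l r
  proof (rule Bochner_Integration.integrable_bound)
    show "integrable (lebesgue_on Q) (\<lambda>z. C * indicator (box l r) z)"
      using integrable_box_on[OF Q_lebesgue] by (rule integrable_mult_right)
    show "(\<lambda>z. h z * indicator (box l r) z) \<in> borel_measurable (lebesgue_on Q)"
      using h(1) borel_measurable_integrable[OF integrable_box_on[OF Q_lebesgue]] by (rule borel_measurable_times)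
    show "AE z in lebesgue_on Q. norm (h z * indicator (box l r) z) \<le> norm (C * indicator (box l r) z)"
      using h(2) by eventually_elim (auto simp: indicator_def)
  qed
  define g where "g z = max (- (C + C')) (min (C + C') (p z - P z))" for z
  have gm: "g \<in> borel_measurable (lebesgue_on Q)" unfolding g_def using pm P(1) by measurable
  have gb: "AE z in lebesgue_on Q. g z = p z - P z \<and> \<bar>g z\<bar> \<le> C + C'"
    using pC P(2) by eventually_elim (auto simp: g_def)
  obtain f where f: "f \<in> borel_measurable borel" "AE z in lborel. indicator Q z * g z = f z"
    using ex_borel_version[OF Q_lebesgue gm] by blast
  define f' where "f' z = max (- \<bar>C + C'\<bar>) (min \<bar>C + C'\<bar> (f z))" for z
  have f'm [measurable]: "f' \<in> borel_measurable borel" unfolding f'_def using f(1) by measurable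
  have f'g: "AE z in lborel. f' z = indicator Q z * g z"
    using f(2) gb[unfolded AE_lebesgue_on_iff[OF Q_lebesgue]]
  proof eventually_elim
    case (elim z)
    then show ?case unfolding f'_def by (cases "z \<in> Q") (auto simp: abs_le_iff)
  qed
  have "AE z in lborel. f' z = 0"
  proof (rule AE_eq_0_if_box_integrals_0[OF f'm])
    show "\<bar>f' z\<bar> \<le> \<bar>C + C'\<bar>" for z unfolding f'_def by linarith
    fix l r
    have "(\<integral>z. indicator (box l r) z * f' z \<partial>lborel) = (\<integral>z. indicator (box l r) z * f' z \<partial>lebesgue)"
      by (rule integral_completion[symmetric]) measurable
    also have "\<dots> = (\<integral>z. indicator Q z * (g z * indicator (box l r) z) \<partial>lebesgue)"
      by (rule integral_cong_AE_complete[OF completion.complete_measure_axioms])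
         (use AE_completion[OF f'g] in \<open>eventually_elim, simp\<close>)
    also have "\<dots> = (\<integral>z. g z * indicator (box l r) z \<partial>lebesgue_on Q)"
      using Q_lebesgue by (simp add: integral_restrict_space)
    also have "\<dots> = (\<integral>z. p z * indicator (box l r) z - P z * indicator (box l r) z \<partial>lebesgue_on Q)"
      by (rule integral_cong_AE_complete[OF complete_measure_lebesgue_on[OF Q_lebesgue]])
         (use gb in \<open>eventually_elim, simp add: left_diff_distrib\<close>)
    also have "\<dots> = 0" using int[OF pm pC] int[OF P] box by simp
    finally show "(\<integral>z. indicator (box l r) z * f' z \<partial>lborel) = 0" .
  qed
  then show ?thesis
    using f'g gb[unfolded AE_lebesgue_on_iff[OF Q_lebesgue]] unfolding AE_lebesgue_on_iff[OF Q_lebesgue]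
    by eventually_elim (auto simp: indicator_def)
qed

lemma AE_cylinder: "AE z in lebesgue_on D. P z \<Longrightarrow> AE w in lebesgue_on Q. P (fst w, fst (snd w))"
  unfolding AE_lebesgue_on_iff[OF Q_lebesgue] AE_lebesgue_on_iff[OF D_lebesgue]
  by (drule AE_lborel_triple_cylinder, erule eventually_mono) (auto simp: Q_def)

lemma layer_measurable:
  fixes c b :: "real \<times> 'a \<Rightarrow> real"
  assumes meas: "c \<in> borel_measurable (lebesgue_on D)" "b \<in> borel_measurable (lebesgue_on D)"
  shows "(\<lambda>(t, x, \<xi>). c (t, x) * indicator {0..b (t, x)} \<xi>) \<in> borel_measurable (lebesgue_on Q)"
proof -
  obtain c' where c': "c' \<in> borel_measurable borel" "AE z in lborel. indicator D z * c z = c' z"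
    using ex_borel_version[OF D_lebesgue meas(1)] by blast
  obtain b' where b': "b' \<in> borel_measurable borel" "AE z in lborel. indicator D z * b z = b' z"
    using ex_borel_version[OF D_lebesgue meas(2)] by blast
  have pr: "(\<lambda>w :: real \<times> 'a \<times> real. (fst w, fst (snd w))) \<in> borel_measurable borel"
    by (intro borel_measurable_continuous_onI continuous_intros)
  have [measurable]: "(\<lambda>w :: real \<times> 'a \<times> real. snd (snd w)) \<in> borel_measurable borel"
    by (intro borel_measurable_continuous_onI continuous_intros)
  note [measurable] = measurable_compose[OF pr c'(1)] measurable_compose[OF pr b'(1)]
  let ?g = "\<lambda>w. c' (fst w, fst (snd w)) * (if 0 \<le> snd (snd w) \<and> snd (snd w) \<le> b' (fst w, fst (snd w)) then 1 else 0)"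
  have "?g \<in> borel_measurable borel" by measurable
  then have gm: "?g \<in> borel_measurable (lebesgue_on Q)"
    by (intro measurable_restrict_space1 measurable_completion) simp
  have "AE z in lebesgue_on D. c z = c' z \<and> b z = b' z"
    unfolding AE_lebesgue_on_iff[OF D_lebesgue] using c'(2) b'(2) by eventually_elim auto
  from AE_cylinder[OF this]
  have "AE w in lebesgue_on Q. ?g w = (\<lambda>(t, x, \<xi>). c (t, x) * indicator {0..b (t, x)} \<xi>) w"
    by eventually_elim (auto simp: indicator_def)
  from borel_measurable_cong_AE_complete[OF complete_measure_lebesgue_on[OF Q_lebesgue] this gm] show ?thesis .
qed

lemma S_vlim_measurable [measurable]:
  "(\<lambda>z. S1 F ap (vlim z)) \<in> borel_measurable (lebesgue_on D)"
  "(\<lambda>z. S2 F ap bm (vlim z)) \<in> borel_measurable (lebesgue_on D)"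
  "(\<lambda>z. S3 F bm (vlim z)) \<in> borel_measurable (lebesgue_on D)"
  by measurable

definition p_limit :: "real \<times> 'a \<times> real \<Rightarrow> real" where
  "p_limit = (\<lambda>(t, x, \<xi>). lam1 (t, x) * indicator {0..S1 F ap (vlim (t, x))} \<xi>
     + lam2 (t, x) * indicator {0..S2 F ap bm (vlim (t, x))} \<xi>
     + lam3 (t, x) * indicator {0..S3 F bm (vlim (t, x))} \<xi>)"

text \<open>Tested with a box, the indicator of \<open>{0..u}\<close> becomes
  \<open>layer_measure\<close> of \<open>u\<close>, which converges weakly to its Young mean; the
  same box applied to \<open>p_limit\<close> produces that mean layer by layer.\<close>

lemma p_eq:
  assumes p: "weak_star_limit Q (\<lambda>k (t, x, \<xi>). indicator {0..u (e k) (t, x)} \<xi>) p"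
  shows "AE w in lebesgue_on Q. p w = p_limit w"
proof (rule weak_star_limit_unique[OF p])
  have b: "AE z in lebesgue_on D. \<bar>lam1 z\<bar> \<le> 1" "AE z in lebesgue_on D. \<bar>lam2 z\<bar> \<le> 1" "AE z in lebesgue_on D. \<bar>lam3 z\<bar> \<le> 1"
    using weights_bounded by (eventually_elim, simp)+
  have one: "AE z in lebesgue_on D. \<bar>1 :: real\<bar> \<le> 1" by simp
  have eq: "p_limit = (\<lambda>w. (\<lambda>(t, x, \<xi>). lam1 (t, x) * indicator {0..S1 F ap (vlim (t, x))} \<xi>) w
     + (\<lambda>(t, x, \<xi>). lam2 (t, x) * indicator {0..S2 F ap bm (vlim (t, x))} \<xi>) w
     + (\<lambda>(t, x, \<xi>). lam3 (t, x) * indicator {0..S3 F bm (vlim (t, x))} \<xi>) w)"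
    by (auto simp: p_limit_def fun_eq_iff)
  show "p_limit \<in> borel_measurable (lebesgue_on Q)"
    unfolding eq by (intro borel_measurable_add layer_measurable lam_measurable S_vlim_measurable)
  \<comment> \<open>A crude bound: each of the three layers is at most 1 in absolute value.\<close>
  show "AE w in lebesgue_on Q. \<bar>p_limit w\<bar> \<le> 3"
    using AE_cylinder[OF weights_bounded]
  proof eventually_elim
    case (elim w)
    obtain t x \<xi> where w: "w = (t, x, \<xi>)" by (cases w) auto
    have i: "\<bar>a * indicator X \<xi>\<bar> \<le> 1" if "\<bar>a\<bar> \<le> 1" for a :: real and X using that by (auto simp: indicator_def)
    show ?case
      unfolding w p_limit_def prod.case
      using i[of "lam1 (t, x)" "{0..S1 F ap (vlim (t, x))}"] i[of "lam2 (t, x)" "{0..S2 F ap bm (vlim (t, x))}"]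
        i[of "lam3 (t, x)" "{0..S3 F bm (vlim (t, x))}"] elim[unfolded w fst_conv snd_conv]
      by linarith
  qed
  fix l u' :: "real \<times> 'a \<times> real"
  obtain l1 l2 l3 where l: "l = (l1, l2, l3)" by (cases l) auto
  obtain u1 u2 u3 where u': "u' = (u1, u2, u3)" by (cases u') auto
  let ?R = "layer_measure l3 u3" and ?B = "box (l1, l2) (u1, u2)"
  have "(\<integral>z. (case z of (t, x, \<xi>) \<Rightarrow> indicator {0..u (e k) (t, x)} \<xi>) * indicator (box l u') z \<partial>lebesgue_on Q)
      = (\<integral>z. ?R (u (e k) z) * indicator ?B z \<partial>lebesgue_on D)" for k
    using integral_layer_box(2)[OF _ solution_measurable(1)[of k] one, of l1 l2 l3 u1 u2 u3]
    by (simp add: l u' case_prod_unfold)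
  moreover have "(\<integral>z. p_limit z * indicator (box l u') z \<partial>lebesgue_on Q)
      = (\<integral>z. young_mean ?R z * indicator ?B z \<partial>lebesgue_on D)"
  proof -
    note I1 = integral_layer_box[OF lam_measurable(1) S_vlim_measurable(1) b(1), of l1 l2 l3 u1 u2 u3]
    note I2 = integral_layer_box[OF lam_measurable(2) S_vlim_measurable(2) b(2), of l1 l2 l3 u1 u2 u3]
    note I3 = integral_layer_box[OF lam_measurable(3) S_vlim_measurable(3) b(3), of l1 l2 l3 u1 u2 u3]
    have Rm [measurable]: "?R \<in> borel_measurable borel"
      by (rule borel_measurable_continuous_onI) (rule layer_measure_continuous)
    obtain M where M: "\<And>w. \<bar>?R w\<bar> \<le> M"
      using layer_measure_bounded[of l3 u3] by (auto simp: bounded_iff)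
    have J: "integrable (lebesgue_on D) (\<lambda>z. c z * ?R (s z) * indicator ?B z)"
      if [measurable]: "c \<in> borel_measurable (lebesgue_on D)" "s \<in> borel_measurable (lebesgue_on D)"
        and cb: "AE z in lebesgue_on D. \<bar>c z\<bar> \<le> 1" for c s
    proof (rule integrable_bounded_mult[OF _ _ integrable_box_on[OF D_lebesgue]])
      show "AE z in lebesgue_on D. \<bar>c z * ?R (s z)\<bar> \<le> 1 * M"
        using cb
      proof eventually_elim
        case (elim z)
        show ?case unfolding abs_mult by (intro mult_mono M) (use elim in auto)
      qed
    qed measurable
    have "(\<integral>z. p_limit z * indicator (box l u') z \<partial>lebesgue_on Q)
      = (\<integral>w. (case w of (t, x, \<xi>) \<Rightarrow> lam1 (t, x) * indicator {0..S1 F ap (vlim (t, x))} \<xi> * indicator (box (l1, l2, l3) (u1, u2, u3)) (t, x, \<xi>))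
        + (case w of (t, x, \<xi>) \<Rightarrow> lam2 (t, x) * indicator {0..S2 F ap bm (vlim (t, x))} \<xi> * indicator (box (l1, l2, l3) (u1, u2, u3)) (t, x, \<xi>))
        + (case w of (t, x, \<xi>) \<Rightarrow> lam3 (t, x) * indicator {0..S3 F bm (vlim (t, x))} \<xi> * indicator (box (l1, l2, l3) (u1, u2, u3)) (t, x, \<xi>)) \<partial>lebesgue_on Q)"
      by (intro Bochner_Integration.integral_cong refl) (auto simp: p_limit_def l u' algebra_simps)
    also have "\<dots> = (\<integral>z. lam1 z * ?R (S1 F ap (vlim z)) * indicator ?B z \<partial>lebesgue_on D)
        + (\<integral>z. lam2 z * ?R (S2 F ap bm (vlim z)) * indicator ?B z \<partial>lebesgue_on D)
        + (\<integral>z. lam3 z * ?R (S3 F bm (vlim z)) * indicator ?B z \<partial>lebesgue_on D)"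
      unfolding I1(2)[symmetric] I2(2)[symmetric] I3(2)[symmetric]
      using I1(1) I2(1) I3(1) by (subst Bochner_Integration.integral_add; simp)+
    also have "\<dots> = (\<integral>z. lam1 z * ?R (S1 F ap (vlim z)) * indicator ?B z + lam2 z * ?R (S2 F ap bm (vlim z)) * indicator ?B z
        + lam3 z * ?R (S3 F bm (vlim z)) * indicator ?B z \<partial>lebesgue_on D)"
      using J[OF lam_measurable(1) S_vlim_measurable(1) b(1)] J[OF lam_measurable(2) S_vlim_measurable(2) b(2)]
        J[OF lam_measurable(3) S_vlim_measurable(3) b(3)] by simp
    finally show ?thesis by (simp add: young_mean_def distrib_right)
  qed
  ultimately show "(\<lambda>k. \<integral>z. (case z of (t, x, \<xi>) \<Rightarrow> indicator {0..u (e k) (t, x)} \<xi>) * indicator (box l u') z \<partial>lebesgue_on Q)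
      \<longlonglongrightarrow> (\<integral>z. p_limit z * indicator (box l u') z \<partial>lebesgue_on Q)"
    using young_limit[OF layer_measure_continuous layer_measure_bounded integrable_box_on[OF D_lebesgue], of l3 u3 "(l1, l2)" "(u1, u2)"]
    by simp
qed

text \<open>Strong convergence of \<open>v\<close> leaves no mixture of layers: the Lipschitz
  function \<open>layer_measure\<close> carries it over to every box test.\<close>

lemma q_eq:
  assumes q: "weak_star_limit Q (\<lambda>k (t, x, \<xi>). indicator {0..v (e k) (t, x)} \<xi>) q"
  shows "AE w in lebesgue_on Q. q w = (case w of (t, x, \<xi>) \<Rightarrow> indicator {0..vlim (t, x)} \<xi>)"
proof (rule weak_star_limit_unique[OF q, of _ 1])
  have one: "AE z in lebesgue_on D. \<bar>1 :: real\<bar> \<le> 1" by simp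
  show "(\<lambda>(t, x, \<xi>). indicator {0..vlim (t, x)} \<xi> :: real) \<in> borel_measurable (lebesgue_on Q)"
    using layer_measurable[OF borel_measurable_const[of 1] vlim_measurable] by simp
  show "AE w in lebesgue_on Q. \<bar>case w of (t, x, \<xi>) \<Rightarrow> indicator {0..vlim (t, x)} \<xi>\<bar> \<le> (1::real)"
    by (auto simp: indicator_def)
  fix l u' :: "real \<times> 'a \<times> real"
  obtain l1 l2 l3 where l: "l = (l1, l2, l3)" by (cases l) auto
  obtain u1 u2 u3 where u': "u' = (u1, u2, u3)" by (cases u') auto
  let ?R = "layer_measure l3 u3" and ?B = "box (l1, l2) (u1, u2)"
  have eq: "(\<integral>z. (case z of (t, x, \<xi>) \<Rightarrow> (indicator {0..w (t, x)} \<xi> :: real)) * indicator (box l u') z \<partial>lebesgue_on Q)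
      = (\<integral>z. ?R (w z) * indicator ?B z \<partial>lebesgue_on D)" if "w \<in> borel_measurable (lebesgue_on D)" for w
    using integral_layer_box(2)[OF _ that one, of l1 l2 l3 u1 u2 u3]
    by (simp add: l u' case_prod_unfold)
  have Rm [measurable]: "?R \<in> borel_measurable borel"
    by (rule borel_measurable_continuous_onI) (rule layer_measure_continuous)
  obtain M where M: "\<And>w. \<bar>?R w\<bar> \<le> M"
    using layer_measure_bounded[of l3 u3] by (auto simp: bounded_iff)
  have J: "integrable (lebesgue_on D) (\<lambda>z. ?R (w z) * indicator ?B z)" if [measurable]: "w \<in> borel_measurable (lebesgue_on D)" for w
    by (rule integrable_bounded_mult[OF _ AE_I2[OF M] integrable_box_on[OF D_lebesgue]]) measurable
  have "(\<lambda>k. \<integral>z. (?R (v (e k) z) - ?R (vlim z)) * indicator ?B z \<partial>lebesgue_on D) \<longlonglongrightarrow> 0"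
    by (rule strong_limit[OF layer_measure_lipschitz _ Rm borel_measurable_integrable[OF integrable_box_on[OF D_lebesgue]], of _ _ 1])
       (auto simp: indicator_def)
  then have "(\<lambda>k. (\<integral>z. ?R (v (e k) z) * indicator ?B z \<partial>lebesgue_on D) - (\<integral>z. ?R (vlim z) * indicator ?B z \<partial>lebesgue_on D)) \<longlonglongrightarrow> 0"
    using J[OF solution_measurable(2)] J[OF vlim_measurable] by (simp add: left_diff_distrib)
  then show "(\<lambda>k. \<integral>z. (case z of (t, x, \<xi>) \<Rightarrow> (indicator {0..v (e k) (t, x)} \<xi> :: real)) * indicator (box l u') z \<partial>lebesgue_on Q)
      \<longlonglongrightarrow> (\<integral>z. (case z of (t, x, \<xi>) \<Rightarrow> (indicator {0..vlim (t, x)} \<xi> :: real)) * indicator (box l u') z \<partial>lebesgue_on Q)"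
    unfolding eq[OF solution_measurable(2)] eq[OF vlim_measurable] by (rule LIM_zero_cancel)
qed

end

lemma Lap_x3_continuous:
  fixes f :: "real \<times> 'a::euclidean_space \<times> real \<Rightarrow> real"
  assumes f: "test_function W f"
  shows "continuous_on UNIV (Lap_x3 f)"
proof -
  have "continuous_on UNIV (\<lambda>z. \<Sum>b\<in>Basis. partial_deriv (0, b, 0) (partial_deriv (0, b, 0) f) z)"
  proof (rule continuous_on_sum)
    fix b :: 'a assume "b \<in> Basis"
    then have "(0, b, 0) \<in> (Basis :: (real \<times> 'a \<times> real) set)" by (auto simp: Basis_prod_def)
    then show "continuous_on UNIV (partial_deriv (0, b, 0) (partial_deriv (0, b, 0) f))"
      using f by (intro test_function_cont[of W] test_function_partial_deriv)
  qed
  then show ?thesis by (simp add: Lap_x3_test_function[OF f, abs_def])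
qed

section \<open>Localisation of the kinetic equation\<close>

context limit_system
begin

text \<open>To be used with \<open>f\<close> the time derivative or the Laplacian of a test function
  on \<open>W\<close>. Where \<open>q\<close> is the constant \<open>c\<close>, the pairing is
  \<open>c\<close> times the integral of \<open>f\<close>.\<close>

lemma fun_distr_eq_0:
  assumes q: "AE w in lebesgue_on Q. w \<in> W \<longrightarrow> q w = c" and W: "W \<subseteq> Q"
    and f: "continuous_on UNIV f" "\<And>w. w \<notin> W \<Longrightarrow> f w = 0" "(\<integral>w. f w \<partial>lborel) = 0"
  shows "fun_distr Q q f = 0"
proof -
  have "fun_distr Q q f = (\<integral>w. c * f w \<partial>lebesgue_on Q)"
    unfolding fun_distr_def
  proof (rule integral_cong_AE_complete[OF complete_measure_lebesgue_on[OF Q_lebesgue]])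
    show "AE w in lebesgue_on Q. q w * f w = c * f w"
      using q
    proof eventually_elim
      case (elim w)
      then show ?case using f(2)[of w] by (cases "w \<in> W") auto
    qed
  qed
  also have "\<dots> = c * (\<integral>w. f w \<partial>lebesgue_on Q)" by simp
  also have "(\<integral>w. f w \<partial>lebesgue_on Q) = (\<integral>w. f w \<partial>lborel)"
  proof -
    have eq: "(\<lambda>w. indicator Q w * f w) = f"
      using f(2) W by (auto simp: fun_eq_iff indicator_def)
    have "(\<lambda>w. indicator Q w * f w) \<in> borel_measurable borel"
      unfolding eq using f(1) by (rule borel_measurable_continuous_onI)
    from integral_lebesgue_on_eq_lborel[OF Q_lebesgue this] show ?thesis unfolding eq .
  qed
  finally show ?thesis using f(3) by simp
qed

lemma delta_distr_cong_AE:
  assumes "AE z in lebesgue_on D. AE l in lborel.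
    h (fst z, snd z, l) * \<psi> (fst z, snd z, F l) = h' (fst z, snd z, l) * \<psi> (fst z, snd z, F l)"
  shows "delta_distr D F h \<psi> = delta_distr D F h' \<psi>"
  unfolding delta_distr_def
proof (rule integral_cong_AE_complete[OF complete_D])
  show "AE z in lebesgue_on D. (case z of (t, x) \<Rightarrow> \<integral>l. h (t, x, l) * \<psi> (t, x, F l) \<partial>lebesgue)
      = (case z of (t, x) \<Rightarrow> \<integral>l. h' (t, x, l) * \<psi> (t, x, F l) \<partial>lebesgue)"
    using assms
  proof eventually_elim
    case (elim z)
    show ?case unfolding case_prod_unfold
      by (rule integral_cong_AE_complete[OF completion.complete_measure_axioms AE_completion[OF elim]])
  qed
qed

text \<open>The value of \<open>p\<close> at \<open>l\<close> acts on \<open>\<psi>\<close> at the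
  level \<open>F l\<close>, so \<open>p_limit\<close> is compared with \<open>h\<close> only where
  \<open>(t, x, F l)\<close> lies in \<open>W\<close>. The sum of the weights is handed to the
  comparison as a premise because it holds only almost everywhere.\<close>

lemma delta_distr_p:
  assumes p: "AE w in lebesgue_on Q. p w = p_limit w"
    and h: "\<And>t x l. (t, x) \<in> D \<Longrightarrow> (t, x, F l) \<in> W \<Longrightarrow> lam1 (t, x) + lam2 (t, x) + lam3 (t, x) = 1 \<Longrightarrow>
      p_limit (t, x, l) = h (t, x, l)"
    and \<psi>: "\<And>w. w \<notin> W \<Longrightarrow> \<psi> w = 0"
  shows "delta_distr D F p \<psi> = delta_distr D F h \<psi>"
proof (rule delta_distr_cong_AE)
  have "AE z in lborel. AE l in lborel. (fst z, snd z, l) \<in> Q \<longrightarrow> p (fst z, snd z, l) = p_limit (fst z, snd z, l)"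
    using p[unfolded AE_lebesgue_on_iff[OF Q_lebesgue]] by (rule AE_lborel_triple_section)
  then have "AE z in lebesgue_on D. AE l in lborel. (fst z, snd z, l) \<in> Q \<longrightarrow> p (fst z, snd z, l) = p_limit (fst z, snd z, l)"
    unfolding AE_lebesgue_on_iff[OF D_lebesgue] by eventually_elim simp
  then show "AE z in lebesgue_on D. AE l in lborel.
    p (fst z, snd z, l) * \<psi> (fst z, snd z, F l) = h (fst z, snd z, l) * \<psi> (fst z, snd z, F l)"
    using weights AE_space
  proof eventually_elim
    case (elim z)
    obtain t x where z: "z = (t, x)" by (cases z)
    have w: "lam1 (t, x) + lam2 (t, x) + lam3 (t, x) = 1" and D: "(t, x) \<in> D"
      using elim(2,3) by (auto simp: z)
    show ?case
      using elim(1)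
    proof eventually_elim
      case (elim l)
      then have "p (t, x, l) = p_limit (t, x, l)" using D by (simp add: z Q_def)
      then show ?case using h[OF D _ w, of l] \<psi>[of "(t, x, F l)"]
        by (cases "(t, x, F l) \<in> W") (simp_all add: z)
    qed
  qed
qed

text \<open>Additivity of the nested integrals rests on integrability, of almost every section first
  and then of the section integrals; both come from the Fubini facts for a single layer.\<close>

lemma delta_distr_add:
  fixes c1 a1 b1 c2 a2 b2 :: "real \<times> 'a \<Rightarrow> real"
  assumes m1: "c1 \<in> borel_measurable (lebesgue_on D)" "a1 \<in> borel_measurable (lebesgue_on D)"
      "b1 \<in> borel_measurable (lebesgue_on D)" "AE z in lebesgue_on D. \<bar>c1 z\<bar> \<le> 1"
    and m2: "c2 \<in> borel_measurable (lebesgue_on D)" "a2 \<in> borel_measurable (lebesgue_on D)"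
      "b2 \<in> borel_measurable (lebesgue_on D)" "AE z in lebesgue_on D. \<bar>c2 z\<bar> \<le> 1"
    and \<psi>: "continuous_on UNIV \<psi>" "integrable lborel (\<lambda>(t, x, l). \<psi> (t, x, F l))"
  shows "delta_distr D F (\<lambda>(t, x, l). c1 (t, x) * indicator {a1 (t, x)..b1 (t, x)} l) \<psi>
      + delta_distr D F (\<lambda>(t, x, l). c2 (t, x) * indicator {a2 (t, x)..b2 (t, x)} l) \<psi>
    = delta_distr D F (\<lambda>(t, x, l). c1 (t, x) * indicator {a1 (t, x)..b1 (t, x)} l
        + c2 (t, x) * indicator {a2 (t, x)..b2 (t, x)} l) \<psi>"
proof -
  define g where "g c a b z l = c z * indicator {a z..b z} l * \<psi> (fst z, snd z, F l)"
    for c a b :: "real \<times> 'a \<Rightarrow> real" and z l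
  have sec: "(\<lambda>l. \<psi> (fst z, snd z, F l)) \<in> borel_measurable borel" for z
    by (intro borel_measurable_continuous_onI continuous_on_compose2[OF \<psi>(1)] continuous_intros F_cont) auto
  have gm: "g c a b z \<in> borel_measurable lborel" for c a b z
    unfolding g_def using sec[of z] by measurable
  have \<delta>: "delta_distr D F (\<lambda>(t, x, l). c (t, x) * indicator {a (t, x)..b (t, x)} l) \<psi>
      = (\<integral>z. (\<integral>l. g c a b z l \<partial>lborel) \<partial>lebesgue_on D)" for c a b
    unfolding delta_distr_def
    by (intro Bochner_Integration.integral_cong refl)
       (simp add: case_prod_unfold g_def[symmetric] integral_completion[OF gm])
  note L1 = layer(2,3)[OF m1 \<psi>(2)] and L2 = layer(2,3)[OF m2 \<psi>(2)]
  have s: "AE z in lebesgue_on D. integrable lborel (g c1 a1 b1 z)" "AE z in lebesgue_on D. integrable lborel (g c2 a2 b2 z)"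
    and i: "integrable (lebesgue_on D) (\<lambda>z. \<integral>l. g c1 a1 b1 z l \<partial>lborel)" "integrable (lebesgue_on D) (\<lambda>z. \<integral>l. g c2 a2 b2 z l \<partial>lborel)"
    using L1 L2 by (simp_all add: g_def[abs_def])
  have "(\<integral>z. (\<integral>l. g c1 a1 b1 z l \<partial>lborel) \<partial>lebesgue_on D) + (\<integral>z. (\<integral>l. g c2 a2 b2 z l \<partial>lborel) \<partial>lebesgue_on D)
      = (\<integral>z. (\<integral>l. g c1 a1 b1 z l \<partial>lborel) + (\<integral>l. g c2 a2 b2 z l \<partial>lborel) \<partial>lebesgue_on D)"
    using i by simp
  also have "\<dots> = (\<integral>z. (\<integral>l. g c1 a1 b1 z l + g c2 a2 b2 z l \<partial>lborel) \<partial>lebesgue_on D)"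
    by (rule integral_cong_AE_complete[OF complete_D]) (use s in \<open>eventually_elim, simp\<close>)
  also have "\<dots> = delta_distr D F (\<lambda>(t, x, l). c1 (t, x) * indicator {a1 (t, x)..b1 (t, x)} l
        + c2 (t, x) * indicator {a2 (t, x)..b2 (t, x)} l) \<psi>"
    unfolding delta_distr_def
  proof (intro Bochner_Integration.integral_cong refl)
    fix z
    have "(\<integral>l. g c1 a1 b1 z l + g c2 a2 b2 z l \<partial>lborel) = (\<integral>l. g c1 a1 b1 z l + g c2 a2 b2 z l \<partial>lebesgue)"
      by (rule integral_completion[symmetric]) (intro borel_measurable_add gm)
    then show "(\<integral>l. g c1 a1 b1 z l + g c2 a2 b2 z l \<partial>lborel) = (case z of (t, x) \<Rightarrow>
        \<integral>l. (case (t, x, l) of (t, x, l) \<Rightarrow> c1 (t, x) * indicator {a1 (t, x)..b1 (t, x)} l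
        + c2 (t, x) * indicator {a2 (t, x)..b2 (t, x)} l) * \<psi> (t, x, F l) \<partial>lebesgue)"
      by (simp add: case_prod_unfold g_def distrib_right)
  qed
  finally show ?thesis unfolding \<delta> .
qed

text \<open>The preimage of the support under \<open>(t, x, l) \<mapsto> (t, x, F l)\<close> is
  closed by continuity, and bounded because values of \<open>F\<close> between the critical levels
  force \<open>l\<close> into \<open>{am..bp}\<close>.\<close>

lemma integrable_test_function_F:
  assumes \<psi>: "test_function W \<psi>" and W: "W \<subseteq> {(t, x, \<xi>). F bm < \<xi> \<and> \<xi> < F ap}"
  shows "integrable lborel (\<lambda>(t :: real, x :: 'a, l). \<psi> (t, x, F l))"
proof -
  obtain K where K: "compact K" "K \<subseteq> W" "\<And>w. w \<notin> K \<Longrightarrow> \<psi> w = 0"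
    using \<psi> by (auto simp: test_function_def)
  let ?f = "\<lambda>w :: real \<times> 'a \<times> real. (fst w, fst (snd w), F (snd (snd w)))"
  have f: "continuous_on UNIV ?f"
    by (intro continuous_intros continuous_on_compose2[OF F_cont[of UNIV]]) auto
  have cl: "closed (?f -` K)"
    using continuous_closed_preimage[OF f closed_UNIV compact_imp_closed[OF K(1)]] by simp
  have sub: "?f -` K \<subseteq> fst ` K \<times> (fst \<circ> snd) ` K \<times> {am..bp}"
  proof
    fix w assume "w \<in> ?f -` K"
    then have w: "?f w \<in> K" by simp
    then have "?f w \<in> {(t, x, \<xi>). F bm < \<xi> \<and> \<xi> < F ap}" using K(2) W by blast
    then have "F bm < F (snd (snd w))" "F (snd (snd w)) < F ap" by simp_all
    then have "snd (snd w) \<in> {am..bp}" using F_range[of "snd (snd w)"] by simp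
    moreover have "fst w \<in> fst ` K" "fst (snd w) \<in> (fst \<circ> snd) ` K"
      using w by (auto intro!: image_eqI[where x = "?f w"])
    ultimately show "w \<in> fst ` K \<times> (fst \<circ> snd) ` K \<times> {am..bp}"
      unfolding mem_Times_iff by blast
  qed
  have bdd: "bounded (fst ` K \<times> (fst \<circ> snd) ` K \<times> {am..bp})"
  proof (intro bounded_Times compact_imp_bounded)
    show "compact (fst ` K)" by (intro compact_continuous_image continuous_intros K)
    show "compact ((fst \<circ> snd) ` K)" unfolding o_def by (intro compact_continuous_image continuous_intros K)
  qed simp
  have C: "compact (?f -` K)"
    using cl bounded_subset[OF bdd sub] by (simp only: compact_eq_bounded_closed)
  have "integrable lborel (\<lambda>w. \<psi> (?f w))"
  proof (rule integrable_compact_support[OF C])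
    show "continuous_on UNIV (\<lambda>w. \<psi> (?f w))"
      by (rule continuous_on_compose2[OF test_function_cont[OF \<psi>] f]) simp
    show "\<psi> (?f w) = 0" if "w \<notin> ?f -` K" for w
      using that by (intro K(3)) simp
  qed
  then show ?thesis by (simp add: case_prod_unfold)
qed

text \<open>Here \<open>F l\<close> exceeds \<open>vlim\<close>. Then \<open>l\<close> lies strictly
  between the first and second branch values, where the remaining layers contribute
  \<open>lam2 + lam3 = 1 - lam1\<close>, or beyond the third, which no layer reaches. Branch values
  are excluded since \<open>F\<close> equals \<open>vlim\<close> there.\<close>

lemma kinetic_equation_above:
  assumes p: "AE w in lebesgue_on Q. p w = p_limit w"
    and q: "AE w in lebesgue_on Q. q w = (case w of (t, x, \<xi>) \<Rightarrow> indicator {0..vlim (t, x)} \<xi>)"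
    and W: "W \<subseteq> {(t, x, \<xi>). (t, x) \<in> D \<and> F bm < vlim (t, x) \<and> vlim (t, x) < \<xi> \<and> \<xi> < F ap}"
    and \<psi>: "test_function W \<psi>"
  shows "fun_distr Q q (D_t \<psi>) = 0" "fun_distr Q q (Lap_x3 \<psi>) = 0"
    "delta_distr D F p (D_t \<psi>) = delta_distr D F (\<lambda>(t, x, l). (1 - lam1 (t, x)) *
       indicator {S1 F ap (vlim (t, x))..S2 F ap bm (vlim (t, x))} l) (D_t \<psi>)"
proof -
  note t = D_t_test_function[OF \<psi>]
  have WQ: "W \<subseteq> Q" using W by (auto simp: Q_def)
  have q0: "AE w in lebesgue_on Q. w \<in> W \<longrightarrow> q w = 0"
    using q by eventually_elim (use W in auto)
  show "fun_distr Q q (D_t \<psi>) = 0"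
    by (rule fun_distr_eq_0[OF q0 WQ test_function_cont[OF t(2)] test_function_eq_0[OF t(2)] t(3)])
  show "fun_distr Q q (Lap_x3 \<psi>) = 0"
    by (rule fun_distr_eq_0[OF q0 WQ Lap_x3_continuous[OF \<psi>] Lap_x3_eq_0[OF \<psi>] integral_Lap_x3_test_function[OF \<psi>]])
  show "delta_distr D F p (D_t \<psi>) = delta_distr D F (\<lambda>(t, x, l). (1 - lam1 (t, x)) *
       indicator {S1 F ap (vlim (t, x))..S2 F ap bm (vlim (t, x))} l) (D_t \<psi>)"
  proof (rule delta_distr_p[OF p _ test_function_eq_0[OF t(2)]])
    fix t x l
    assume D: "(t, x) \<in> D" and "(t, x, F l) \<in> W" and sum: "lam1 (t, x) + lam2 (t, x) + lam3 (t, x) = 1"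
    then have v: "F bm < vlim (t, x)" "vlim (t, x) < F ap" and vl: "vlim (t, x) < F l" using W by auto
    let ?s1 = "S1 F ap (vlim (t, x))" and ?s2 = "S2 F ap bm (vlim (t, x))" and ?s3 = "S3 F bm (vlim (t, x))"
    have Fs: "F ?s1 = vlim (t, x)" "F ?s2 = vlim (t, x)" "F ?s3 = vlim (t, x)"
      using v F_S1 F_S2 F_S3 by auto
    then have "l \<noteq> ?s1" "l \<noteq> ?s2" "l \<noteq> ?s3" using vl by auto
    moreover have "\<not> l < ?s1" "\<not> (?s2 < l \<and> l < ?s3)" using F_sign(1,3)[OF v, of l] vl by auto
    ultimately consider "?s1 < l" "l < ?s2" | "?s3 < l" by linarith
    then show "p_limit (t, x, l) = (case (t, x, l) of (t, x, l) \<Rightarrow> (1 - lam1 (t, x)) *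
       indicator {S1 F ap (vlim (t, x))..S2 F ap bm (vlim (t, x))} l)"
    proof cases
      case 1
      then show ?thesis
        using S_order[of "vlim (t, x)"] v(1) sum by (simp add: p_limit_def indicator_def)
    next
      case 2
      then show ?thesis
        using S_order[of "vlim (t, x)"] v(1) by (simp add: p_limit_def indicator_def)
    qed
  qed
qed

text \<open>Here \<open>F l\<close> is less than \<open>vlim\<close>. Either \<open>l\<close> lies
  below the first branch value, inside all three layers of total weight 1, or strictly between the
  second and third, inside the third layer only. It exceeds the common lower endpoint 0 because
  \<open>F bm < F l\<close> forces \<open>am \<le> l\<close>.\<close>

lemma kinetic_equation_below:
  assumes p: "AE w in lebesgue_on Q. p w = p_limit w"
    and q: "AE w in lebesgue_on Q. q w = (case w of (t, x, \<xi>) \<Rightarrow> indicator {0..vlim (t, x)} \<xi>)"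
    and W: "W \<subseteq> {(t, x, \<xi>). (t, x) \<in> D \<and> F bm < \<xi> \<and> \<xi> < vlim (t, x) \<and> vlim (t, x) < F ap}"
    and \<psi>: "test_function W \<psi>"
  shows "fun_distr Q q (D_t \<psi>) = 0" "fun_distr Q q (Lap_x3 \<psi>) = 0"
    "delta_distr D F p (D_t \<psi>) = delta_distr D F (\<lambda>(t, x, l). indicator {0..S1 F ap (vlim (t, x))} l) (D_t \<psi>)
      + delta_distr D F (\<lambda>(t, x, l). lam3 (t, x) *
          indicator {S2 F ap bm (vlim (t, x))..S3 F bm (vlim (t, x))} l) (D_t \<psi>)"
proof -
  note t = D_t_test_function[OF \<psi>]
  have WQ: "W \<subseteq> Q" using W by (auto simp: Q_def)
  \<comment> \<open>The level \<open>\<xi>\<close> exceeds \<open>F bm\<close>, which is positive,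
    and so lies in \<open>{0..vlim (t, x)}\<close>.\<close>
  have q1: "AE w in lebesgue_on Q. w \<in> W \<longrightarrow> q w = 1"
    using q by eventually_elim (use W F_am_less in \<open>auto simp: indicator_def\<close>)
  show "fun_distr Q q (D_t \<psi>) = 0"
    by (rule fun_distr_eq_0[OF q1 WQ test_function_cont[OF t(2)] test_function_eq_0[OF t(2)] t(3)])
  show "fun_distr Q q (Lap_x3 \<psi>) = 0"
    by (rule fun_distr_eq_0[OF q1 WQ Lap_x3_continuous[OF \<psi>] Lap_x3_eq_0[OF \<psi>] integral_Lap_x3_test_function[OF \<psi>]])
  have W': "W \<subseteq> {(t, x, \<xi>). F bm < \<xi> \<and> \<xi> < F ap}" using W by auto
  have one: "AE z in lebesgue_on D. \<bar>1 :: real\<bar> \<le> 1" by simp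
  have b3: "AE z in lebesgue_on D. \<bar>lam3 z\<bar> \<le> 1" using weights_bounded by eventually_elim simp
  \<comment> \<open>The factor 1 gives the first summand the shape of a coefficient times an
    interval, as \<open>delta_distr_add\<close> expects.\<close>
  have "delta_distr D F p (D_t \<psi>) = delta_distr D F (\<lambda>(t, x, l). 1 * indicator {0..S1 F ap (vlim (t, x))} l
      + lam3 (t, x) * indicator {S2 F ap bm (vlim (t, x))..S3 F bm (vlim (t, x))} l) (D_t \<psi>)"
  proof (rule delta_distr_p[OF p _ test_function_eq_0[OF t(2)]])
    fix t x l
    assume D: "(t, x) \<in> D" and "(t, x, F l) \<in> W" and sum: "lam1 (t, x) + lam2 (t, x) + lam3 (t, x) = 1"
    then have v: "F bm < vlim (t, x)" "vlim (t, x) < F ap" and vl: "F l < vlim (t, x)" "F bm < F l" using W by auto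
    have l: "0 < l" using F_range(2)[of l] vl order by simp
    let ?s1 = "S1 F ap (vlim (t, x))" and ?s2 = "S2 F ap bm (vlim (t, x))" and ?s3 = "S3 F bm (vlim (t, x))"
    have Fs: "F ?s1 = vlim (t, x)" "F ?s2 = vlim (t, x)" "F ?s3 = vlim (t, x)"
      using v F_S1 F_S2 F_S3 by auto
    then have "l \<noteq> ?s1" "l \<noteq> ?s2" "l \<noteq> ?s3" using vl by auto
    moreover have "\<not> ?s3 < l" "\<not> (?s1 < l \<and> l < ?s2)" using F_sign(2,4)[OF v, of l] vl by auto
    ultimately consider "l < ?s1" | "?s2 < l" "l < ?s3" by linarith
    then show "p_limit (t, x, l) = (case (t, x, l) of (t, x, l) \<Rightarrow> 1 * indicator {0..S1 F ap (vlim (t, x))} l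
      + lam3 (t, x) * indicator {S2 F ap bm (vlim (t, x))..S3 F bm (vlim (t, x))} l)"
    proof cases
      case 1
      then show ?thesis
        using S_order[of "vlim (t, x)"] v(1) sum l by (simp add: p_limit_def indicator_def)
    next
      case 2
      then show ?thesis
        using S_order[of "vlim (t, x)"] v(1) l by (simp add: p_limit_def indicator_def)
    qed
  qed
  also have "\<dots> = delta_distr D F (\<lambda>(t, x, l). 1 * indicator {0..S1 F ap (vlim (t, x))} l) (D_t \<psi>)
      + delta_distr D F (\<lambda>(t, x, l). lam3 (t, x) *
          indicator {S2 F ap bm (vlim (t, x))..S3 F bm (vlim (t, x))} l) (D_t \<psi>)"
    by (rule delta_distr_add[where ?c1.0 = "\<lambda>_. 1" and ?a1.0 = "\<lambda>_. 0" and ?b1.0 = "\<lambda>z. S1 F ap (vlim z)"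
          and ?c2.0 = lam3 and ?a2.0 = "\<lambda>z. S2 F ap bm (vlim z)" and ?b2.0 = "\<lambda>z. S3 F bm (vlim z)" and \<psi> = "D_t \<psi>",
          OF borel_measurable_const borel_measurable_const S_vlim_measurable(1) one
          lam_measurable(3) S_vlim_measurable(2,3) b3 test_function_cont[OF t(2)] integrable_test_function_F[OF t(2) W'],
          symmetric])
  finally show "delta_distr D F p (D_t \<psi>) = delta_distr D F (\<lambda>(t, x, l). indicator {0..S1 F ap (vlim (t, x))} l) (D_t \<psi>)
      + delta_distr D F (\<lambda>(t, x, l). lam3 (t, x) *
          indicator {S2 F ap bm (vlim (t, x))..S3 F bm (vlim (t, x))} l) (D_t \<psi>)" by simp
qed

end

theorem theorem2p5:
  fixes \<Omega> :: "'a::euclidean_space set"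
    and F :: "real \<Rightarrow> real" and am ap bm bp \<alpha> T :: real
    and u0 v0 :: "'a \<Rightarrow> real"
    and u v :: "real \<Rightarrow> real \<times> 'a \<Rightarrow> real"
    and e :: "nat \<Rightarrow> real"
    and vlim :: "real \<times> 'a \<Rightarrow> real"
    and \<mu> :: "real \<times> 'a \<Rightarrow> real measure"
    and lam1 lam2 lam3 \<kappa>1 \<kappa>2 :: "real \<times> 'a \<Rightarrow> real"
    and p q :: "real \<times> 'a \<times> real \<Rightarrow> real"
    and n :: "(real \<times> 'a \<times> real) measure"
    and D :: "(real \<times> 'a) set" and Q :: "(real \<times> 'a \<times> real) set"
  assumes domain: "smooth_bounded_domain \<Omega>"
    and reaction: "reaction_function F am ap bm bp"
    and alpha: "0 < \<alpha>" "\<alpha> < 1"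
    and data_reg: "C2_holder \<alpha> \<Omega> u0" "C2_holder \<alpha> \<Omega> v0"
    and data_nonneg: "\<forall>x\<in>closure \<Omega>. u0 x \<ge> 0 \<and> v0 x \<ge> 0"
    and data_neumann: "neumann \<Omega> u0" "neumann \<Omega> v0"
    and T: "T > 0"
    and D_def: "D = {0<..<T} \<times> \<Omega>"
    and Q_def: "Q = {0<..<T} \<times> \<Omega> \<times> UNIV"
    and solution: "\<forall>\<epsilon>\<in>{0<..<1}. classical_solution F \<Omega> u0 v0 \<epsilon> (u \<epsilon>) (v \<epsilon>)"
    and subseq: "\<forall>k. e k \<in> {0<..<1}" "e \<longlonglongrightarrow> 0"
    and v_lim: "strong_L2_limit D (\<lambda>k. v (e k)) vlim"
    and young: "young_measure D (\<lambda>k. u (e k)) \<mu>"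
    and weights_measurable: "lam1 \<in> borel_measurable (lebesgue_on D)"
      "lam2 \<in> borel_measurable (lebesgue_on D)" "lam3 \<in> borel_measurable (lebesgue_on D)"
    and weights: "AE z in lebesgue_on D.
        lam1 z \<ge> 0 \<and> lam2 z \<ge> 0 \<and> lam3 z \<ge> 0 \<and> lam1 z + lam2 z + lam3 z = 1 \<and>
        (\<forall>A\<in>sets borel. measure (\<mu> z) A =
            lam1 z * indicator A (S1 F ap (vlim z))
          + lam2 z * indicator A (S2 F ap bm (vlim z))
          + lam3 z * indicator A (S3 F bm (vlim z)))"
    and p_lim: "weak_star_limit Q (\<lambda>k (t, x, \<xi>). indicator {0..u (e k) (t, x)} \<xi>) p"
    and q_lim: "weak_star_limit Q (\<lambda>k (t, x, \<xi>). indicator {0..v (e k) (t, x)} \<xi>) q"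
    and n_measure: "finite_measure n" "sets n = sets (restrict_space borel Q)"
    and n_eq: "eq_distr_on Q
        (\<lambda>\<psi>. dt_distr (\<lambda>\<phi>. delta_distr D F p \<phi> + fun_distr Q q \<phi>) \<psi>
              - lap_distr (fun_distr Q q) \<psi>)
        (dxi_distr (measure_distr n))"
    and kappa: "\<kappa>1 = (\<lambda>z. 1 - lam1 z)" "\<kappa>2 = lam3"
  shows
    \<comment> \<open>The identity for the Young measure determines \<open>lam1\<close> only where \<open>vlim\<close> differs from \<open>f\<^sub>+\<close>
        (at \<open>f\<^sub>+\<close> the points \<open>S1\<close> and \<open>S2\<close> coincide), \<open>lam3\<close> only where it differs from \<open>f\<^sub>-\<close>, and
        \<open>lam2\<close> only where it differs from both.\<close>
    "(bounded_in_L2 D (\<lambda>\<epsilon>. D_t (v \<epsilon>)) \<and> bounded_in_L2 D (\<lambda>\<epsilon>. Lap_x2 (v \<epsilon>)) \<longrightarrow>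
        (\<forall>W. open W \<and> W \<subseteq> D \<and> continuous_on W vlim \<longrightarrow>
           eq_distr_on {z\<in>W. vlim z \<noteq> F ap} (dt_distr (fun_distr D lam1)) (\<lambda>\<psi>. 0) \<and>
           eq_distr_on {z\<in>W. vlim z \<noteq> F am \<and> vlim z \<noteq> F ap}
             (dt_distr (fun_distr D lam2)) (\<lambda>\<psi>. 0) \<and>
           eq_distr_on {z\<in>W. vlim z \<noteq> F am} (dt_distr (fun_distr D lam3)) (\<lambda>\<psi>. 0)))
     \<and> (\<forall>W \<xi>0. open W \<and>
          W \<subseteq> {(t, x, \<xi>). (t, x) \<in> D \<and> F am < vlim (t, x) \<and> vlim (t, x) < \<xi>0 \<and>
                              \<xi>0 < \<xi> \<and> \<xi> < F ap} \<longrightarrow>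
          eq_distr_on W
            (dt_distr (delta_distr D F (\<lambda>(t, x, l). \<kappa>1 (t, x) *
               indicator {S1 F ap (vlim (t, x))..S2 F ap bm (vlim (t, x))} l)))
            (dxi_distr (measure_distr n)))
     \<and> (\<forall>W \<xi>0. open W \<and>
          W \<subseteq> {(t, x, \<xi>). (t, x) \<in> D \<and> F am < \<xi> \<and> \<xi> < \<xi>0 \<and>
                              \<xi>0 < vlim (t, x) \<and> vlim (t, x) < F ap} \<longrightarrow>
          eq_distr_on W
            (\<lambda>\<psi>. dt_distr (delta_distr D F (\<lambda>(t, x, l).
                     indicator {0..S1 F ap (vlim (t, x))} l)) \<psi>
                + dt_distr (delta_distr D F (\<lambda>(t, x, l). \<kappa>2 (t, x) *
                     indicator {S2 F ap bm (vlim (t, x))..S3 F bm (vlim (t, x))} l)) \<psi>)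
            (dxi_distr (measure_distr n)))"
proof -
  have \<Omega>: "open \<Omega>" "bounded \<Omega>" using domain unfolding smooth_bounded_domain_def by blast+
  interpret L: limit_system F am ap bm bp \<Omega> T u0 v0 u v e vlim \<mu> lam1 lam2 lam3 D
    by unfold_locales
       (fact reaction \<Omega> D_def subseq(2) v_lim young weights_measurable weights | use solution subseq(1) in blast)+
  \<comment> \<open>The statement describes this set as a product, the locale as the cylinder over
    \<open>D\<close>.\<close>
  have Q: "Q = L.Q" using Q_def L.Q_eq by simp
  have p: "AE w in lebesgue_on L.Q. p w = L.p_limit w"
    using p_lim unfolding Q by (rule L.p_eq)
  have q: "AE w in lebesgue_on L.Q. q w = (case w of (t, x, \<xi>) \<Rightarrow> indicator {0..vlim (t, x)} \<xi>)"
    using q_lim unfolding Q by (rule L.q_eq)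
  \<comment> \<open>Test functions supported in \<open>W\<close> are test functions on
    \<open>Q\<close>, so the given equation localises; the region matters only in evaluating its
    left-hand side.\<close>
  have n: "- (delta_distr D F p (D_t \<psi>) + fun_distr L.Q q (D_t \<psi>)) - fun_distr L.Q q (Lap_x3 \<psi>)
      = dxi_distr (measure_distr n) \<psi>" if "test_function W \<psi>" "W \<subseteq> L.Q" for W \<psi>
    using n_eq test_function_mono[OF that] unfolding Q eq_distr_on_def dt_distr_def lap_distr_def by blast
  show ?thesis
  proof (intro conjI impI allI)
    fix W
    assume "bounded_in_L2 D (\<lambda>\<epsilon>. D_t (v \<epsilon>)) \<and> bounded_in_L2 D (\<lambda>\<epsilon>. Lap_x2 (v \<epsilon>))"
    then interpret B: L2_bounded_system F am ap bm bp \<Omega> T u0 v0 u v e vlim \<mu> lam1 lam2 lam3 D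
      by unfold_locales blast+
    assume "open W \<and> W \<subseteq> D \<and> continuous_on W vlim"
    then have W: "open W" "W \<subseteq> D" "continuous_on W vlim" by blast+
    \<comment> \<open>The statement writes the lower critical level as \<open>F am\<close>, the
      branch lemmas write it as \<open>F bm\<close>.\<close>
    note d = B.weights_time_derivative[OF W, folded L.Fam]
    show "eq_distr_on {z \<in> W. vlim z \<noteq> F ap} (dt_distr (fun_distr D lam1)) (\<lambda>\<psi>. 0)"
      "eq_distr_on {z \<in> W. vlim z \<noteq> F am \<and> vlim z \<noteq> F ap} (dt_distr (fun_distr D lam2)) (\<lambda>\<psi>. 0)"
      "eq_distr_on {z \<in> W. vlim z \<noteq> F am} (dt_distr (fun_distr D lam3)) (\<lambda>\<psi>. 0)"
      unfolding eq_distr_on_def dt_distr_def fun_distr_def by (intro allI impI; simp only: d minus_zero)+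
  next
    fix W \<xi>0
    assume W: "open W \<and> W \<subseteq> {(t, x, \<xi>). (t, x) \<in> D \<and> F am < vlim (t, x) \<and> vlim (t, x) < \<xi>0 \<and> \<xi>0 < \<xi> \<and> \<xi> < F ap}"
    have W': "W \<subseteq> {(t, x, \<xi>). (t, x) \<in> D \<and> F bm < vlim (t, x) \<and> vlim (t, x) < \<xi> \<and> \<xi> < F ap}"
      and WQ: "W \<subseteq> L.Q" using W L.Fam by (auto simp: L.Q_def)
    show "eq_distr_on W
            (dt_distr (delta_distr D F (\<lambda>(t, x, l). \<kappa>1 (t, x) *
               indicator {S1 F ap (vlim (t, x))..S2 F ap bm (vlim (t, x))} l)))
            (dxi_distr (measure_distr n))"
      unfolding eq_distr_on_def
    proof (intro allI impI)
      fix \<psi> assume \<psi>: "test_function W \<psi>"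
      \<comment> \<open>With these substitutions both terms in \<open>q\<close> vanish, and minus
        the pairing with \<open>D_t \<psi>\<close> is the distributional time derivative.\<close>
      note k = L.kinetic_equation_above[OF p q W' \<psi>]
      show "dt_distr (delta_distr D F (\<lambda>(t, x, l). \<kappa>1 (t, x) *
               indicator {S1 F ap (vlim (t, x))..S2 F ap bm (vlim (t, x))} l)) \<psi>
          = dxi_distr (measure_distr n) \<psi>"
        using n[OF \<psi> WQ] unfolding k dt_distr_def kappa(1) by simp
    qed
  next
    fix W \<xi>0
    assume W: "open W \<and> W \<subseteq> {(t, x, \<xi>). (t, x) \<in> D \<and> F am < \<xi> \<and> \<xi> < \<xi>0 \<and> \<xi>0 < vlim (t, x) \<and> vlim (t, x) < F ap}"
    have W': "W \<subseteq> {(t, x, \<xi>). (t, x) \<in> D \<and> F bm < \<xi> \<and> \<xi> < vlim (t, x) \<and> vlim (t, x) < F ap}"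
      and WQ: "W \<subseteq> L.Q" using W L.Fam by (auto simp: L.Q_def)
    show "eq_distr_on W
            (\<lambda>\<psi>. dt_distr (delta_distr D F (\<lambda>(t, x, l).
                     indicator {0..S1 F ap (vlim (t, x))} l)) \<psi>
                + dt_distr (delta_distr D F (\<lambda>(t, x, l). \<kappa>2 (t, x) *
                     indicator {S2 F ap bm (vlim (t, x))..S3 F bm (vlim (t, x))} l)) \<psi>)
            (dxi_distr (measure_distr n))"
      unfolding eq_distr_on_def
    proof (intro allI impI)
      fix \<psi> assume \<psi>: "test_function W \<psi>"
      note k = L.kinetic_equation_below[OF p q W' \<psi>]
      show "dt_distr (delta_distr D F (\<lambda>(t, x, l).
                     indicator {0..S1 F ap (vlim (t, x))} l)) \<psi>
                + dt_distr (delta_distr D F (\<lambda>(t, x, l). \<kappa>2 (t, x) *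
                     indicator {S2 F ap bm (vlim (t, x))..S3 F bm (vlim (t, x))} l)) \<psi>
          = dxi_distr (measure_distr n) \<psi>"
        using n[OF \<psi> WQ] unfolding k dt_distr_def kappa(2) by simp
    qed
  qed
qed

end
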